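(* Let $l\in\mathbb{N}$, let $n\ge2$ be an even integer and let $\mathbb{K}\in\{\mathbb{R},\mathbb{C}\}$. Put $\mu=n-2$ if $\mathbb{K}=\mathbb{C}$ and $\mu=n$ if $\mathbb{K}=\mathbb{R}$. With every $d\in\mathscr{C}_{\mathbb{K},l}$ associate the scheme $((\mathbf{D}_N(d))_{N\ge1},(\mathbf{S}_N)_{N\ge1})$ defined in the context. Then, with respect to Lebesgue measure on $\mathscr{C}_{\mathbb{K},l}$: (1) for almost all $d\in\mathscr{C}_{\mathbb{C},l}$, the associated scheme is convergent of order $n$; (2) for almost all $d\in\mathscr{C}_{\mathbb{R},l}$, the associated scheme is convergent at the rate $\epsilon_N=h^n(\log h)^2$.
   Context: $\mathbb{N}=\{0,1,2,\dots\}$; for $N\ge1$, $h=\frac1{N+1}$ and $x_j^N=jh$, $j\in\mathbb{Z}$; $0^0=1$. Formulas. For $\mathbb{K}\in\{\mathbb{R},\mathbb{C}\}$, $\mathscr{S}_{\mathbb{K}}$ is the set of finitely supported $\mathbb{K}$-valued sequences $b=(b_j)_{j\in\mathbb{Z}}$ with $b_j=b_{-j}$; $\tau(b)=\max\{j:b_j\ne0\}$, $\tau(0)=-\infty$; $\mathscr{C}_{\mathbb{K},l}=\{d\in\mathscr{S}_{\mathbb{K}}:\sum_jd_j=0,\ \tau(d)\le l+1\}$. A pair $(d,s)\in\mathscr{S}_{\mathbb{C}}^2$ is consistent of order $n$ if for all $u\in C^\infty(\mathbb{R})$, $\sum_j\big(d_ju(jh)+h^2s_ju''(jh)\big)=\mathcal{O}(h^{n+2})$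 as $h\to0^+$. The associated scheme. Given $d\in\mathscr{C}_{\mathbb{K},l}$: - $s\in\mathscr{S}_{\mathbb{C}}$ is the unique symmetric formula with $\tau(s)\le\frac n2-1$ such that $(d,s)$ is consistent of order $n$. - For $i=1,\dots,l$, $b^i\in\mathscr{S}_{\mathbb{C}}$ is the symmetric formula with $\tau(b^i)\le\frac\mu2-1$ (so $b^i=0$ if $\mu=0$) determined by the invertible linear system: for $k=1,\dots,\frac\mu2$, $\ \frac{b^i_0}{2}0^{2k-2}+\sum_{r=1}^{\mu/2-1}b^i_r\,r^{2k-2}=\sum_{j>0}d_{i+j}\frac{j^{2k}}{2k(2k-1)}$. - $\mathbf{D}_N(d)\in\mathbb{C}^{N\times N}$ is the matrix, in the basis $\big(\mathbb{1}_{j+(2N+2)\mathbb{Z}}-\mathbb{1}_{-j+(2N+2)\mathbb{Z}}\big)_{j=1,\dots,N}$ of $\mathscr{E}_N=\{w\in\mathbb{C}^{\mathbb{Z}}:w_{-j}=-w_j,\ w_{N+1+j}=-w_{N+1-j}\ \forall j\}$, of the restriction to $\mathscr{E}_N$ of the convolution operator $w\mapsto\big(\sum_jd_jw_{i-j}\big)_{i\in\mathbb{Z}}$. - For all $N$ sufficiently large (depending on $d,n$), $\mathbf{S}_N:\mathbb{C}^{\mathbb{Z}}\to\mathbb{C}^N$ is given for $1\le i\le N$ by $(\mathbf{S}_N\mathbf{f})_i=\sum_{j\in\mathbb{Z}}s_{j-i}\mathbf{f}_j+\mathbb{1}_{i\le l}\sum_{j\in\mathbb{Z}}b^i_j\mathbf{f}_j+\mathbb{1}_{i\ge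 N+1-l}\sum_{j\in\mathbb{Z}}b^{N+1-i}_j\mathbf{f}_{N+1-j}$; for the finitely many remaining $N$, $\mathbf{S}_N$ is any fixed linear map depending on finitely many entries of $\mathbf{f}$. Convergence. For $f\in C^\infty(\mathbb{R})$ (complex valued) let $u:[0,1]\to\mathbb{C}$ solve $-u''=f$ on $]0,1[$, $u(0)=u(1)=0$; set $\mathbf{f}^{N,ex}=(f(x_j^N))_{j\in\mathbb{Z}}$, $\mathbf{u}^{N,ex}=(u(x_j^N))_{1\le j\le N}$. For a sequence $(\epsilon_N)$ of positive numbers tending to $0$, a scheme $((\mathbf{D}_N),(\mathbf{S}_N))$ is convergent at the rate $(\epsilon_N)$ if $\mathbf{D}_N$ is invertible for all $N\ge1$ and for every $f\in C^\infty(\mathbb{R})$ there is $c>0$ such that for all $N\ge1$ the solution $\mathbf{u}^N$ of $\mathbf{D}_N\mathbf{u}^N=h^2\mathbf{S}_N\mathbf{f}^{N,ex}$ satisfies $\|\mathbf{u}^{N,ex}-\mathbf{u}^N\|_\infty\le c\,\epsilon_N$. It is convergent of order $n$ if it is convergent at the rate $\epsilon_N=h^n$. *)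

theory Defs
  imports
    "HOL-Analysis.Analysis"
    "HOL-Library.Landau_Symbols"
    "Jordan_Normal_Form.Matrix"
begin

section \<open>Symmetric formulas\<close>

definition supp :: "(int \<Rightarrow> complex) \<Rightarrow> int set" where
  "supp b = {j. b j \<noteq> 0}"

text \<open>The field of coefficients is given as a set \<open>K\<close> of complex numbers: \<open>\<real>\<close> or \<open>UNIV\<close>.\<close>

definition sym_formulas :: "complex set \<Rightarrow> (int \<Rightarrow> complex) set" where
  "sym_formulas K = {b. range b \<subseteq> K \<and> finite (supp b) \<and> (\<forall>j. b j = b (- j))}"

text \<open>The supremum of the support, so that \<open>\<tau> 0 = -\<infinity>\<close>; on a finite non-empty support it is the
  maximum.\<close>

definition tau :: "(int \<Rightarrow> complex) \<Rightarrow> ereal" where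
  "tau b = (SUP j\<in>supp b. ereal (of_int j))"

lemma tau_zero: "tau (\<lambda>_. 0) = - \<infinity>"
  by (simp add: tau_def supp_def bot_ereal_def)

lemma tau_eq_Max:
  assumes "finite (supp b)" "supp b \<noteq> {}"
  shows "tau b = ereal (of_int (Max (supp b)))"
  unfolding tau_def
proof (rule antisym)
  show "(SUP j\<in>supp b. ereal (of_int j)) \<le> ereal (of_int (Max (supp b)))"
    by (rule SUP_least) (use assms in auto)
  show "ereal (of_int (Max (supp b))) \<le> (SUP j\<in>supp b. ereal (of_int j))"
    by (rule SUP_upper) (use assms in auto)
qed

lemma tau_le_iff: "tau b \<le> ereal c \<longleftrightarrow> (\<forall>j. b j \<noteq> 0 \<longrightarrow> of_int j \<le> c)"
  by (auto simp: tau_def supp_def SUP_le_iff)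

definition C_formulas :: "complex set \<Rightarrow> nat \<Rightarrow> (int \<Rightarrow> complex) set" where
  "C_formulas K l =
     {d \<in> sym_formulas K. (\<Sum>j\<in>supp d. d j) = 0 \<and> tau d \<le> ereal (real l + 1)}"


subsection \<open>Lebesgue measure on the spaces of formulas\<close>

text \<open>The linear isomorphism from \<open>K\<^sup>l\<^sup>+\<^sup>1\<close> onto \<^const>\<open>C_formulas\<close>, with coordinates
  \<open>d\<^sub>1, \<dots>, d\<^sub>l\<^sub>+\<^sub>1\<close>. Lebesgue measure is transported along it; another choice of coordinates changes
  it only by a positive factor.\<close>

definition formula_of_coords :: "nat \<Rightarrow> (nat \<Rightarrow> complex) \<Rightarrow> int \<Rightarrow> complex" where
  "formula_of_coords l x j =
     (if j = 0 then - 2 * (\<Sum>k = 1..l + 1. x k)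
      else if \<bar>j\<bar> \<le> int l + 1 then x (nat \<bar>j\<bar>) else 0)"

definition lebesgue_C_complex :: "nat \<Rightarrow> (int \<Rightarrow> complex) measure" where
  "lebesgue_C_complex l =
     embed_measure (\<Pi>\<^sub>M k\<in>{1..l + 1}. (lborel :: complex measure)) (formula_of_coords l)"

definition lebesgue_C_real :: "nat \<Rightarrow> (int \<Rightarrow> complex) measure" where
  "lebesgue_C_real l =
     embed_measure (\<Pi>\<^sub>M k\<in>{1..l + 1}. (lborel :: real measure))
       (\<lambda>x. formula_of_coords l (\<lambda>k. complex_of_real (x k)))"

lemma formula_of_coords_in:
  assumes K: "K = UNIV \<or> K = \<real>" and x: "\<And>k. k \<in> {1..l + 1} \<Longrightarrow> x k \<in> K"
  shows "formula_of_coords l x \<in> C_formulas K l"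
proof -
  let ?d = "formula_of_coords l x"
  have sub: "supp ?d \<subseteq> {- (int l + 1)..int l + 1}"
    by (auto simp: supp_def formula_of_coords_def split: if_splits)
  have fin: "finite (supp ?d)"
    using sub finite_subset by blast
  have sym: "?d j = ?d (- j)" for j
    by (simp add: formula_of_coords_def)
  have ran: "?d j \<in> K" for j
    using K
  proof
    assume KR: "K = \<real>"
    have "(\<Sum>k = 1..l + 1. x k) \<in> \<real>"
      using x KR by (intro sum_in_Reals) blast
    then have "- 2 * (\<Sum>k = 1..l + 1. x k) \<in> \<real>"
      by (intro Reals_mult) auto
    moreover have "x (nat \<bar>j\<bar>) \<in> \<real>" if "j \<noteq> 0" "\<bar>j\<bar> \<le> int l + 1"
    proof -
      have "nat \<bar>j\<bar> \<in> {1..l + 1}" using that by auto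
      then show ?thesis using x KR by blast
    qed
    ultimately show ?thesis
      unfolding formula_of_coords_def KR by auto
  qed auto
  have s1: "(\<Sum>j = 1..int l + 1. ?d j) = (\<Sum>k = 1..l + 1. x k)"
    by (rule sum.reindex_bij_witness[of _ int nat]) (auto simp: formula_of_coords_def)
  have s2: "(\<Sum>j = - (int l + 1)..- 1. ?d j) = (\<Sum>k = 1..l + 1. x k)"
    by (rule sum.reindex_bij_witness[of _ "\<lambda>k. - int k" "\<lambda>j. nat (- j)"])
      (auto simp: formula_of_coords_def)
  have split: "{- (int l + 1)..int l + 1} = {- (int l + 1)..- 1} \<union> ({0} \<union> {1..int l + 1})"
    by auto
  have "(\<Sum>j\<in>supp ?d. ?d j) = (\<Sum>j = - (int l + 1)..int l + 1. ?d j)"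
    by (rule sum.mono_neutral_left) (use sub in \<open>auto simp: supp_def\<close>)
  also have "\<dots> = (\<Sum>j = - (int l + 1)..- 1. ?d j) + (?d 0 + (\<Sum>j = 1..int l + 1. ?d j))"
    unfolding split
    by (subst sum.union_disjoint, simp, simp, force, subst sum.union_disjoint) auto
  also have "\<dots> = 0"
    unfolding s1 s2 by (simp add: formula_of_coords_def)
  finally have "(\<Sum>j\<in>supp ?d. ?d j) = 0" .
  moreover have "tau ?d \<le> ereal (real l + 1)"
    unfolding tau_le_iff
  proof (intro allI impI)
    fix j assume "?d j \<noteq> 0"
    then have "j \<le> int l + 1" using sub by (auto simp: supp_def)
    then show "of_int j \<le> real l + 1" by linarith
  qed
  ultimately show ?thesis
    using fin sym ran by (auto simp: C_formulas_def sym_formulas_def)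
qed

lemma formula_of_coords_self:
  assumes d: "d \<in> C_formulas K l" and x: "\<And>k. k \<in> {1..l + 1} \<Longrightarrow> x k = d (int k)"
  shows "formula_of_coords l x = d"
proof -
  have sym: "d j = d (- j)" for j
    using d by (simp add: C_formulas_def sym_formulas_def)
  have out0: "d j = 0" if "j > int l + 1" for j
  proof (rule ccontr)
    assume "d j \<noteq> 0"
    then have "real_of_int j \<le> real l + 1"
      using d by (auto simp: C_formulas_def tau_le_iff)
    with that show False by linarith
  qed
  have out: "d j = 0" if "\<bar>j\<bar> > int l + 1" for j
    using out0[of j] out0[of "- j"] sym[of j] that by (cases "j \<ge> 0") auto
  have off: "formula_of_coords l x j = d j" if "j \<noteq> 0" for j
  proof (cases "\<bar>j\<bar> \<le> int l + 1")
    case True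
    have "nat \<bar>j\<bar> \<in> {1..l + 1}" using True that by auto
    then have "x (nat \<bar>j\<bar>) = d \<bar>j\<bar>" using x by auto
    moreover have "d \<bar>j\<bar> = d j" using sym[of j] by (cases "j \<ge> 0") auto
    ultimately show ?thesis using True that by (simp add: formula_of_coords_def)
  next
    case False
    then show ?thesis using out[of j] that by (simp add: formula_of_coords_def)
  qed
  have "formula_of_coords l x \<in> C_formulas UNIV l"
    by (rule formula_of_coords_in) auto
  then have "(\<Sum>j\<in>supp (formula_of_coords l x). formula_of_coords l x j) = 0"
    and fin: "finite (supp (formula_of_coords l x))"
    by (auto simp: C_formulas_def sym_formulas_def)
  moreover have "(\<Sum>j\<in>supp d. d j) = 0" and find: "finite (supp d)"
    using d by (auto simp: C_formulas_def sym_formulas_def)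
  moreover define A where "A = supp d \<union> supp (formula_of_coords l x) \<union> {0}"
  moreover have finA: "finite A" using fin find by (simp add: A_def)
  moreover have "(\<Sum>j\<in>supp d. d j) = (\<Sum>j\<in>A. d j)"
    by (rule sum.mono_neutral_left) (use finA in \<open>auto simp: A_def supp_def\<close>)
  moreover have "(\<Sum>j\<in>supp (formula_of_coords l x). formula_of_coords l x j)
      = (\<Sum>j\<in>A. formula_of_coords l x j)"
    by (rule sum.mono_neutral_left) (use finA in \<open>auto simp: A_def supp_def\<close>)
  ultimately have eq: "(\<Sum>j\<in>A. d j) = (\<Sum>j\<in>A. formula_of_coords l x j)" by simp
  have "0 \<in> A" by (simp add: A_def)
  then have "d 0 + (\<Sum>j\<in>A - {0}. d j)
      = formula_of_coords l x 0 + (\<Sum>j\<in>A - {0}. formula_of_coords l x j)"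
    using eq finA by (simp add: sum.remove)
  moreover have "(\<Sum>j\<in>A - {0}. formula_of_coords l x j) = (\<Sum>j\<in>A - {0}. d j)"
    by (rule sum.cong) (use off in auto)
  ultimately have "formula_of_coords l x 0 = d 0" by simp
  then show ?thesis using off by (metis ext)
qed

lemma formula_of_coords_at:
  "k \<in> {1..l + 1} \<Longrightarrow> formula_of_coords l x (int k) = x k"
  by (auto simp: formula_of_coords_def)

lemma space_lebesgue_C_complex: "space (lebesgue_C_complex l) = C_formulas UNIV l"
proof (intro equalityI subsetI)
  fix d assume "d \<in> space (lebesgue_C_complex l)"
  then show "d \<in> C_formulas UNIV l"
    by (auto simp: lebesgue_C_complex_def space_embed_measure intro: formula_of_coords_in)
next
  fix d assume d: "d \<in> C_formulas UNIV l"
  let ?x = "\<lambda>k\<in>{1..l + 1}. d (int k)"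
  have "d = formula_of_coords l ?x"
    by (rule formula_of_coords_self[OF d, symmetric]) auto
  moreover have "?x \<in> space (\<Pi>\<^sub>M k\<in>{1..l + 1}. (lborel :: complex measure))"
    unfolding space_PiM space_lborel by (rule restrict_PiE_iff[THEN iffD2]) simp
  ultimately show "d \<in> space (lebesgue_C_complex l)"
    unfolding lebesgue_C_complex_def space_embed_measure by (rule image_eqI)
qed

lemma inj_on_formula_of_coords_complex:
  "inj_on (formula_of_coords l) (space (\<Pi>\<^sub>M k\<in>{1..l + 1}. (lborel :: complex measure)))"
proof (rule inj_onI)
  fix x y
  assume xy: "x \<in> space (\<Pi>\<^sub>M k\<in>{1..l + 1}. (lborel :: complex measure))"
    "y \<in> space (\<Pi>\<^sub>M k\<in>{1..l + 1}. (lborel :: complex measure))"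
    and eq: "formula_of_coords l x = formula_of_coords l y"
  show "x = y"
  proof (rule PiE_ext)
    show "x \<in> (\<Pi>\<^sub>E k\<in>{1..l + 1}. UNIV)" "y \<in> (\<Pi>\<^sub>E k\<in>{1..l + 1}. UNIV)"
      using xy by (simp_all add: space_PiM)
    show "x k = y k" if "k \<in> {1..l + 1}" for k
      using formula_of_coords_at[OF that] eq by metis
  qed
qed

lemma space_lebesgue_C_real: "space (lebesgue_C_real l) = C_formulas \<real> l"
proof (intro equalityI subsetI)
  fix d assume "d \<in> space (lebesgue_C_real l)"
  then show "d \<in> C_formulas \<real> l"
    by (auto simp: lebesgue_C_real_def space_embed_measure intro!: formula_of_coords_in)
next
  fix d assume d: "d \<in> C_formulas \<real> l"
  let ?x = "\<lambda>k\<in>{1..l + 1}. Re (d (int k))"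
  have re: "complex_of_real (Re (d j)) = d j" for j
  proof -
    have "d j \<in> \<real>" using d by (auto simp: C_formulas_def sym_formulas_def)
    then show ?thesis by simp
  qed
  have "d = formula_of_coords l (\<lambda>k. complex_of_real (?x k))"
    by (rule formula_of_coords_self[OF d, symmetric]) (simp add: re)
  moreover have "?x \<in> space (\<Pi>\<^sub>M k\<in>{1..l + 1}. (lborel :: real measure))"
    unfolding space_PiM space_lborel by (rule restrict_PiE_iff[THEN iffD2]) simp
  ultimately show "d \<in> space (lebesgue_C_real l)"
    unfolding lebesgue_C_real_def space_embed_measure by (rule image_eqI)
qed

lemma inj_on_formula_of_coords_real:
  "inj_on (\<lambda>x. formula_of_coords l (\<lambda>k. complex_of_real (x k)))
     (space (\<Pi>\<^sub>M k\<in>{1..l + 1}. (lborel :: real measure)))"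
proof (rule inj_onI)
  fix x y
  assume xy: "x \<in> space (\<Pi>\<^sub>M k\<in>{1..l + 1}. (lborel :: real measure))"
    "y \<in> space (\<Pi>\<^sub>M k\<in>{1..l + 1}. (lborel :: real measure))"
    and eq: "formula_of_coords l (\<lambda>k. complex_of_real (x k))
      = formula_of_coords l (\<lambda>k. complex_of_real (y k))"
  show "x = y"
  proof (rule PiE_ext)
    show "x \<in> (\<Pi>\<^sub>E k\<in>{1..l + 1}. UNIV)" "y \<in> (\<Pi>\<^sub>E k\<in>{1..l + 1}. UNIV)"
      using xy by (simp_all add: space_PiM)
    show "x k = y k" if "k \<in> {1..l + 1}" for k
      using formula_of_coords_at[OF that, of "\<lambda>k. complex_of_real (x k)"]
        formula_of_coords_at[OF that, of "\<lambda>k. complex_of_real (y k)"] eq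
      by (metis of_real_eq_iff)
  qed
qed


section \<open>Smooth functions and consistency\<close>

definition vderiv :: "(real \<Rightarrow> complex) \<Rightarrow> real \<Rightarrow> complex" where
  "vderiv u x = vector_derivative u (at x)"

definition C_infinity :: "(real \<Rightarrow> complex) \<Rightarrow> bool" where
  "C_infinity u \<longleftrightarrow> (\<forall>k x. (vderiv ^^ k) u differentiable (at x))"

definition consistent ::
    "nat \<Rightarrow> (int \<Rightarrow> complex) \<Rightarrow> (int \<Rightarrow> complex) \<Rightarrow> bool" where
  "consistent n d s \<longleftrightarrow> (\<forall>u. C_infinity u \<longrightarrow>
     (\<lambda>h. \<Sum>j\<in>supp d \<union> supp s. d j * u (of_int j * h)
            + (of_real h)\<^sup>2 * s j * (vderiv ^^ 2) u (of_int j * h))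
       \<in> O[at_right 0](\<lambda>h. of_real h ^ (n + 2)))"


section \<open>The associated scheme\<close>

definition mesh :: "nat \<Rightarrow> real" where
  "mesh N = 1 / (real N + 1)"

definition grid :: "nat \<Rightarrow> int \<Rightarrow> real" where
  "grid N j = of_int j * mesh N"

definition inner_formula :: "nat \<Rightarrow> (int \<Rightarrow> complex) \<Rightarrow> int \<Rightarrow> complex" where
  "inner_formula n d =
     (THE s. s \<in> sym_formulas UNIV \<and> tau s \<le> ereal (real n / 2 - 1) \<and> consistent n d s)"

text \<open>Used with \<open>\<mu>\<close> even; the convention \<open>0\<^sup>0 = 1\<close> is that of HOL.\<close>

definition boundary_formula ::
    "nat \<Rightarrow> (int \<Rightarrow> complex) \<Rightarrow> int \<Rightarrow> int \<Rightarrow> complex" where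
  "boundary_formula \<mu> d i =
     (THE b. b \<in> sym_formulas UNIV \<and> tau b \<le> ereal (real \<mu> / 2 - 1) \<and>
        (\<forall>k\<in>{1..\<mu> div 2}.
           b 0 / 2 * 0 ^ (2 * k - 2)
             + (\<Sum>r = 1..int \<mu> div 2 - 1. b r * of_int r ^ (2 * k - 2))
           = (\<Sum>j | 0 < j \<and> d (i + j) \<noteq> 0.
                d (i + j) * (of_int j ^ (2 * k) / (2 * of_nat k * (2 * of_nat k - 1))))))"

definition conv :: "(int \<Rightarrow> complex) \<Rightarrow> (int \<Rightarrow> complex) \<Rightarrow> int \<Rightarrow> complex" where
  "conv d w i = (\<Sum>j\<in>supp d. d j * w (i - j))"

definition E_space :: "nat \<Rightarrow> (int \<Rightarrow> complex) set" where
  "E_space N = {w. (\<forall>j. w (- j) = - w j) \<and> (\<forall>j. w (int N + 1 + j) = - w (int N + 1 - j))}"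

definition E_basis :: "nat \<Rightarrow> int \<Rightarrow> int \<Rightarrow> complex" where
  "E_basis N j m = indicator {j + (2 * int N + 2) * q | q. True} m
                 - indicator {- j + (2 * int N + 2) * q | q. True} m"

text \<open>Matrices and vectors of \<open>Jordan_Normal_Form\<close> are indexed from 0: the entry \<open>(i, j)\<close> belongs to
  the basis vectors with numbers \<open>i + 1\<close> and \<open>j + 1\<close>.\<close>

definition D_matrix :: "nat \<Rightarrow> (int \<Rightarrow> complex) \<Rightarrow> complex mat" where
  "D_matrix N d =
     (THE A. A \<in> carrier_mat N N \<and>
        (\<forall>j<N. \<forall>m. conv d (E_basis N (int j + 1)) m
                 = (\<Sum>i<N. A $$ (i, j) * E_basis N (int i + 1) m)))"

lemma E_basis_dvd:
  "E_basis N j m = of_bool (2 * int N + 2 dvd m - j) - of_bool (2 * int N + 2 dvd m + j)"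
proof -
  have mem: "m \<in> {k + (2 * int N + 2) * q | q. True} \<longleftrightarrow> 2 * int N + 2 dvd m - k" for k
    unfolding dvd_def mem_Collect_eq by (simp only: simp_thms diff_eq_eq add.commute)
  show ?thesis
    unfolding E_basis_def indicator_def mem[of j] mem[of "- j"] by simp
qed

lemma E_space_periodic:
  assumes "w \<in> E_space N"
  shows "w (m + (2 * int N + 2)) = w m"
proof -
  have "w (int N + 1 + (m + (int N + 1))) = - w (int N + 1 - (m + (int N + 1)))"
    using assms unfolding E_space_def by blast
  also have "\<dots> = - w (- m)" by simp
  also have "\<dots> = w m" using assms unfolding E_space_def by simp
  finally show ?thesis by (simp add: algebra_simps)
qed

lemma E_space_periodic_mult:
  assumes "w \<in> E_space N"
  shows "w (m + (2 * int N + 2) * q) = w m"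
proof (induction q rule: int_induct[where k = 0])
  case base show ?case by simp
next
  case (step1 q)
  have "m + (2 * int N + 2) * (q + 1) = (m + (2 * int N + 2) * q) + (2 * int N + 2)"
    by (simp add: algebra_simps)
  then show ?case
    using E_space_periodic[OF assms, of "m + (2 * int N + 2) * q"] step1 by (simp only:)
next
  case (step2 q)
  have "m + (2 * int N + 2) * q = (m + (2 * int N + 2) * (q - 1)) + (2 * int N + 2)"
    by (simp add: algebra_simps)
  then show ?case
    using E_space_periodic[OF assms, of "m + (2 * int N + 2) * (q - 1)"] step2 by (simp only:)
qed

lemma E_basis_in: "E_basis N j \<in> E_space N"
proof -
  let ?P = "2 * int N + 2"
  have a: "?P dvd - m - j \<longleftrightarrow> ?P dvd m + j" for m j :: int
    using dvd_minus_iff[of ?P "m + j"] by simp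
  have "E_basis N j (- m) = - E_basis N j m" for m
    using a[of m j] a[of m "- j"] by (simp add: E_basis_dvd)
  moreover have "E_basis N j (int N + 1 + m) = - E_basis N j (int N + 1 - m)" for m
  proof -
    have b: "?P dvd int N + 1 + m - j \<longleftrightarrow> ?P dvd int N + 1 - m + j" for j
    proof -
      have eq: "int N + 1 + m - j = ?P + (- 1) * (int N + 1 - m + j)" by simp
      show ?thesis unfolding eq by (simp only: dvd_add_triv_left_iff dvd_minus_iff mult_minus1)
    qed
    show ?thesis using b[of j] b[of "- j"] by (simp add: E_basis_dvd)
  qed
  ultimately show ?thesis by (simp add: E_space_def)
qed

lemma E_basis_delta:
  assumes "i < N" "j < N"
  shows "E_basis N (int i + 1) (int j + 1) = of_bool (i = j)"
proof -
  let ?P = "2 * int N + 2"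
  have "\<not> ?P dvd int j + 1 + (int i + 1)"
    using assms by (intro zdvd_not_zless) auto
  moreover have "?P dvd int j + 1 - (int i + 1) \<longleftrightarrow> i = j"
  proof
    assume "?P dvd int j + 1 - (int i + 1)"
    then have "?P dvd \<bar>int j - int i\<bar>" by simp
    moreover have "\<bar>int j - int i\<bar> < ?P" using assms by auto
    ultimately have "\<not> 0 < \<bar>int j - int i\<bar>" using zdvd_not_zless by blast
    then show "i = j" by simp
  qed simp
  ultimately show ?thesis by (simp add: E_basis_dvd)
qed

lemma sum_E_basis:
  assumes "k < N"
  shows "(\<Sum>i<N. c i * E_basis N (int i + 1) (int k + 1)) = c k"
proof -
  have "(\<Sum>i<N. c i * E_basis N (int i + 1) (int k + 1)) = (\<Sum>i<N. if i = k then c i else 0)"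
    by (rule sum.cong) (use assms in \<open>auto simp: E_basis_delta\<close>)
  then show ?thesis using assms by simp
qed

lemma E_space_eqI:
  assumes v: "v \<in> E_space N" and w: "w \<in> E_space N"
    and eq: "\<And>j. j < N \<Longrightarrow> v (int j + 1) = w (int j + 1)"
  shows "v = w"
proof
  fix m
  let ?P = "2 * int N + 2"
  have zero: "u 0 = 0" "u (int N + 1) = 0" if "u \<in> E_space N" for u
  proof -
    have "u (- 0) = - u 0" "u (int N + 1 + 0) = - u (int N + 1 - 0)"
      using that unfolding E_space_def by blast+
    then show "u 0 = 0" "u (int N + 1) = 0" by (simp_all add: eq_neg_iff_add_eq_0)
  qed
  have pos: "v r = w r" if r: "0 \<le> r" "r \<le> int N + 1" for r
  proof -
    consider "r = 0" | "r = int N + 1" | "0 < r" "r < int N + 1" using r by linarith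
    then show ?thesis
    proof cases
      case 3
      then have "nat (r - 1) < N" "int (nat (r - 1)) + 1 = r" by auto
      then show ?thesis using eq[of "nat (r - 1)"] by simp
    qed (simp_all add: zero v w)
  qed
  have refl: "u r = - u (?P - r)" if "u \<in> E_space N" for u r
  proof -
    have "u (int N + 1 + (r - int N - 1)) = - u (int N + 1 - (r - int N - 1))"
      using that unfolding E_space_def by blast
    then show ?thesis by (simp add: algebra_simps)
  qed
  define r where "r = m mod ?P"
  have r: "0 \<le> r" "r < ?P" unfolding r_def by auto
  have "v r = w r"
  proof (cases "r \<le> int N + 1")
    case True then show ?thesis using pos r by simp
  next
    case False
    then have "v (?P - r) = w (?P - r)" using r by (intro pos) auto
    then show ?thesis using refl[OF v, of r] refl[OF w, of r] by simp
  qed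
  moreover have "r + ?P * (m div ?P) = m" unfolding r_def by (rule mod_mult_div_eq)
  ultimately show "v m = w m"
    using E_space_periodic_mult[OF v, of r "m div ?P"] E_space_periodic_mult[OF w, of r "m div ?P"]
    by simp
qed

lemma E_space_sum:
  assumes "\<And>i. i \<in> I \<Longrightarrow> w i \<in> E_space N"
  shows "(\<lambda>m. \<Sum>i\<in>I. c i * w i m) \<in> E_space N"
proof -
  have "w i (- m) = - w i m" "w i (int N + 1 + m) = - w i (int N + 1 - m)" if "i \<in> I" for i m
    using assms[OF that] unfolding E_space_def by blast+
  then show ?thesis
    by (simp add: E_space_def sum_negf)
qed

lemma conv_in_E_space:
  assumes d: "d \<in> sym_formulas K" and w: "w \<in> E_space N"
  shows "conv d w \<in> E_space N"
proof -
  have sym: "d (- j) = d j" for j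
    using d unfolding sym_formulas_def by auto
  have flip: "conv d w m = (\<Sum>j\<in>supp d. d j * w (m + j))" for m
    unfolding conv_def
    by (rule sum.reindex_bij_witness[of _ uminus uminus]) (auto simp: supp_def sym)
  have w1: "w (- m) = - w m" and w2: "w (int N + 1 + m) = - w (int N + 1 - m)" for m
    using w unfolding E_space_def by blast+
  have "conv d w (- m) = - conv d w m" for m
  proof -
    have "w (- m + j) = - w (m - j)" for j using w1[of "m - j"] by simp
    then show ?thesis unfolding flip[of "- m"] by (simp add: conv_def sum_negf)
  qed
  moreover have "conv d w (int N + 1 + m) = - conv d w (int N + 1 - m)" for m
  proof -
    have "w (int N + 1 + m + j) = - w (int N + 1 - m - j)" for j
      using w2[of "m + j"] by (simp add: algebra_simps)
    then show ?thesis unfolding flip[of "int N + 1 + m"] by (simp add: conv_def sum_negf)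
  qed
  ultimately show ?thesis by (simp add: E_space_def)
qed

lemma D_matrix_eq:
  assumes d: "d \<in> sym_formulas K"
  shows "D_matrix N d = mat N N (\<lambda>(i, j). conv d (E_basis N (int j + 1)) (int i + 1))"
  unfolding D_matrix_def
proof (rule the_equality)
  let ?A = "mat N N (\<lambda>(i, j). conv d (E_basis N (int j + 1)) (int i + 1))"
  have col: "conv d (E_basis N (int j + 1)) =
      (\<lambda>m. \<Sum>i<N. ?A $$ (i, j) * E_basis N (int i + 1) m)" if j: "j < N" for j
  proof (rule E_space_eqI)
    show "conv d (E_basis N (int j + 1)) \<in> E_space N"
      using conv_in_E_space[OF d E_basis_in] .
    show "(\<lambda>m. \<Sum>i<N. ?A $$ (i, j) * E_basis N (int i + 1) m) \<in> E_space N"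
      by (rule E_space_sum) (rule E_basis_in)
    show "conv d (E_basis N (int j + 1)) (int k + 1) =
        (\<Sum>i<N. ?A $$ (i, j) * E_basis N (int i + 1) (int k + 1))" if "k < N" for k
    proof -
      have "(\<Sum>i<N. ?A $$ (i, j) * E_basis N (int i + 1) (int k + 1)) = ?A $$ (k, j)"
        by (rule sum_E_basis[OF that])
      then show ?thesis using that j by simp
    qed
  qed
  show "?A \<in> carrier_mat N N \<and> (\<forall>j<N. \<forall>m. conv d (E_basis N (int j + 1)) m
      = (\<Sum>i<N. ?A $$ (i, j) * E_basis N (int i + 1) m))"
  proof (intro conjI allI impI)
    show "?A \<in> carrier_mat N N" by simp
  next
    fix j m assume "j < N"
    from fun_cong[OF col[OF this], of m]
    show "conv d (E_basis N (int j + 1)) m = (\<Sum>i<N. ?A $$ (i, j) * E_basis N (int i + 1) m)" .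
  qed
next
  fix A
  assume A: "A \<in> carrier_mat N N \<and> (\<forall>j<N. \<forall>m. conv d (E_basis N (int j + 1)) m
      = (\<Sum>i<N. A $$ (i, j) * E_basis N (int i + 1) m))"
  show "A = mat N N (\<lambda>(i, j). conv d (E_basis N (int j + 1)) (int i + 1))"
  proof (rule eq_matI)
    fix k j
    assume "k < dim_row (mat N N (\<lambda>(i, j). conv d (E_basis N (int j + 1)) (int i + 1)))"
      "j < dim_col (mat N N (\<lambda>(i, j). conv d (E_basis N (int j + 1)) (int i + 1)))"
    then have kj: "k < N" "j < N" by simp_all
    have "conv d (E_basis N (int j + 1)) (int k + 1)
        = (\<Sum>i<N. A $$ (i, j) * E_basis N (int i + 1) (int k + 1))"
      using A kj by blast
    also have "\<dots> = A $$ (k, j)"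
      by (rule sum_E_basis[OF kj(1)])
    finally show "A $$ (k, j)
        = mat N N (\<lambda>(i, j). conv d (E_basis N (int j + 1)) (int i + 1)) $$ (k, j)"
      using kj by simp
  qed (use A in auto)
qed

text \<open>Indices are shifted as above: the component number \<open>i\<close> of the vector is \<open>S_row \<dots> (i + 1)\<close>.\<close>

definition S_row ::
    "nat \<Rightarrow> nat \<Rightarrow> nat \<Rightarrow> (int \<Rightarrow> complex) \<Rightarrow> nat \<Rightarrow> (int \<Rightarrow> complex) \<Rightarrow> int \<Rightarrow> complex" where
  "S_row l n \<mu> d N f i =
     (let s = inner_formula n d; b = boundary_formula \<mu> d in
        (\<Sum>j | s (j - i) \<noteq> 0. s (j - i) * f j)
        + of_bool (i \<le> int l) * (\<Sum>j\<in>supp (b i). b i j * f j)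
        + of_bool (i \<ge> int N + 1 - int l)
            * (\<Sum>j\<in>supp (b (int N + 1 - i)). b (int N + 1 - i) j * f (int N + 1 - j)))"

definition S_operator ::
    "nat \<Rightarrow> nat \<Rightarrow> nat \<Rightarrow> (int \<Rightarrow> complex) \<Rightarrow> nat \<Rightarrow> (int \<Rightarrow> complex) \<Rightarrow> complex vec" where
  "S_operator l n \<mu> d N f = vec N (\<lambda>i. S_row l n \<mu> d N f (int i + 1))"

definition linear_finitely_dependent ::
    "nat \<Rightarrow> ((int \<Rightarrow> complex) \<Rightarrow> complex vec) \<Rightarrow> bool" where
  "linear_finitely_dependent N T \<longleftrightarrow>
     (\<forall>f. T f \<in> carrier_vec N) \<and>
     (\<forall>f g. T (\<lambda>j. f j + g j) = T f + T g) \<and>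
     (\<forall>a f. T (\<lambda>j. a * f j) = a \<cdot>\<^sub>v T f) \<and>
     (\<exists>J. finite J \<and> (\<forall>f g. (\<forall>j\<in>J. f j = g j) \<longrightarrow> T f = T g))"

text \<open>The finitely many exceptional \<open>N\<close> and the maps \<open>S N\<close> for these \<open>N\<close> are arbitrary, so being an
  associated family is a predicate.\<close>

definition associated_S ::
    "nat \<Rightarrow> nat \<Rightarrow> nat \<Rightarrow> (int \<Rightarrow> complex) \<Rightarrow> (nat \<Rightarrow> (int \<Rightarrow> complex) \<Rightarrow> complex vec) \<Rightarrow> bool" where
  "associated_S l n \<mu> d S \<longleftrightarrow>
     (\<forall>N\<ge>1. linear_finitely_dependent N (S N)) \<and>
     (\<forall>\<^sub>F N in sequentially. S N = S_operator l n \<mu> d N)"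


section \<open>Convergence\<close>

definition solves_dirichlet :: "(real \<Rightarrow> complex) \<Rightarrow> (real \<Rightarrow> complex) \<Rightarrow> bool" where
  "solves_dirichlet f u \<longleftrightarrow>
     continuous_on {0..1} u \<and> u 0 = 0 \<and> u 1 = 0 \<and>
     (\<exists>u'. \<forall>x\<in>{0<..<1}. (u has_vector_derivative u' x) (at x) \<and>
                         (u' has_vector_derivative - f x) (at x))"

definition max_norm :: "complex vec \<Rightarrow> real" where
  "max_norm v = (MAX i\<in>{..<dim_vec v}. cmod (vec_index v i))"

text \<open>Meant for positive \<open>\<epsilon>\<close> tending to \<open>0\<close>. The solution \<open>u\<close> is unique on \<open>[0, 1]\<close>, and \<open>uN\<close> is
  unique because \<open>D N\<close> is invertible.\<close>

definition convergent_at_rate ::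
    "(nat \<Rightarrow> complex mat) \<Rightarrow> (nat \<Rightarrow> (int \<Rightarrow> complex) \<Rightarrow> complex vec) \<Rightarrow> (nat \<Rightarrow> real) \<Rightarrow> bool" where
  "convergent_at_rate D S \<epsilon> \<longleftrightarrow>
     (\<forall>N\<ge>1. invertible_mat (D N)) \<and>
     (\<forall>f u. C_infinity f \<longrightarrow> solves_dirichlet f u \<longrightarrow>
        (\<exists>c>0. \<forall>N\<ge>1. \<forall>uN\<in>carrier_vec N.
           D N *\<^sub>v uN = (of_real (mesh N))\<^sup>2 \<cdot>\<^sub>v S N (\<lambda>j. f (grid N j)) \<longrightarrow>
           max_norm (vec N (\<lambda>j. u (grid N (int j + 1))) - uN) \<le> c * \<epsilon> N))"

definition convergent_of_order ::
    "(nat \<Rightarrow> complex mat) \<Rightarrow> (nat \<Rightarrow> (int \<Rightarrow> complex) \<Rightarrow> complex vec) \<Rightarrow> nat \<Rightarrow> bool" where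
  "convergent_of_order D S n \<longleftrightarrow> convergent_at_rate D S (\<lambda>N. mesh N ^ n)"

end

theory Submission
  imports Defs "Jordan_Normal_Form.Determinant" "HOL-Computational_Algebra.Polynomial" "HOL-Real_Asymp.Real_Asymp"
begin

text \<open>
  The sine vectors \<open>j \<mapsto> sin (k \<pi> j h)\<close>, \<open>k = 1, \<dots>, N\<close>, form a basis of the space of odd
  periodic sequences on which the matrix \<open>D\<^sub>N\<close> acts, and convolution with the symmetric formula \<open>d\<close>
  multiplies each of them by \<open>d\<^sub>0 + 2 \<Sum> d\<^sub>j cos (j a)\<close> with \<open>a = k \<pi> h\<close>. Because the coefficients of \<open>d\<close>
  sum to zero, this eigenvalue factors as \<open>- 2 (1 - cos a) P (cos a)\<close>, where \<open>P\<close> is a polynomial of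
  degree at most \<open>l\<close> that depends linearly on \<open>d\<close> (\<open>reduced_symbol\<close>). The factor \<open>2 (1 - cos a)\<close> belongs to the
  standard second difference, so everything depends on the zeros of \<open>P\<close> in \<open>[- 1, 1]\<close>. As usual,
  convergence is consistency plus stability.

  Consistency. Inserting the exact solution into the scheme leaves a residual that Taylor expansion
  bounds by \<open>h ^ (n + 2)\<close>, except that near an end point the matrix uses the odd reflection of the
  solution in place of its smooth continuation. The difference of the two is again a symmetric formula
  applied to the solution at the end point (\<open>odd_reflection_defect\<close>), and \<open>b i\<close> is to that
  formula what \<open>s\<close> is to \<open>d\<close>. So the residual is \<open>h ^ (\<mu> + 2)\<close> in the \<open>2 l\<close> outer rows
  (\<open>truncation_error\<close>). Existence and uniqueness of \<open>s\<close> and \<open>b i\<close> are one Vandermonde argument.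

  Stability. Write \<open>1 / ((1 - t) P t)\<close> as \<open>1 / ((1 - t) P 1)\<close> plus a remainder of size at most a constant
  times \<open>1 / \<bar>P t\<bar>\<close>. In the inverse of \<open>D\<^sub>N\<close> the first part contributes a multiple of the Green
  function \<open>min i j - i j h\<close> of the second difference, the second part at most a constant times \<open>h T\<close>
  with \<open>T = \<Sum>k. 1 / \<bar>P (cos (k \<pi> h))\<bar>\<close> (\<open>green_bound\<close>). The Green function is of size \<open>1 / h\<close> in general, but
  bounded in the columns near the two ends. Hence the error is of order
  \<open>h ^ n (1 + h\<^sup>2 T) + h ^ (\<mu> + 2) (1 + h T)\<close> (\<open>discretization_error\<close>), and in the complex case the
  value \<open>\<mu> = n - 2\<close> is good enough because \<open>h T\<close> will be bounded.

  Genericity. Fix all coordinates but \<open>d\<^sub>1\<close>; then \<open>P t = d\<^sub>1 + Q t\<close>. A complex \<open>d\<^sub>1\<close> has to avoid the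
  curve \<open>- Q [- 1, 1]\<close>, which has measure zero in the plane; then \<open>P\<close> is bounded away from zero on
  \<open>[- 1, 1]\<close> and \<open>T \<le> const / h\<close>. A real \<open>P\<close> may have zeros that persist under perturbation. For almost
  every real \<open>d\<^sub>1\<close>, however, the zeros in \<open>[- 1, 1]\<close> are simple and none is an end point, so that only boundedly
  many of the numbers \<open>P (cos (k \<pi> h))\<close>, \<open>k = 1, \<dots>, N\<close>, are smaller than a constant times \<open>h\<close>
  (\<open>inverse_sum_at_nodes\<close>); and since \<open>\<Sum> 1 / (N (ln N)\<^sup>2)\<close> converges, the Borel-Cantelli lemma shows that
  almost surely, for all large \<open>N\<close>, all of them are at least \<open>1 / ((N + 1) ln (N + 1))\<^sup>2\<close> in absolute value
  (\<open>AE_far_from_nodes\<close>). Together \<open>h\<^sup>2 T\<close> is of order \<open>(ln h)\<^sup>2\<close>, which is the loss in the rate.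
\<close>

section \<open>Moment equations\<close>

text \<open>Subtracting \<open>x p\<close> times each equation from the next one eliminates the unknown of the node \<open>x p\<close> and
  leaves a system of the same kind in the remaining nodes, with unknowns \<open>c r * (x r - x p)\<close>. This proves
  solvability here and uniqueness below.\<close>

lemma moment_system_solvable:
  fixes x :: "nat \<Rightarrow> 'a::field"
  assumes "inj_on x {..<p}"
  shows "\<exists>c. \<forall>k<p. (\<Sum>r<p. c r * x r ^ k) = y k"
  using assms
proof (induction p arbitrary: y)
  case (Suc p)
  have "inj_on x {..<p}"
    using Suc.prems by (rule inj_on_subset) auto
  then obtain c' where c': "\<And>k. k < p \<Longrightarrow> (\<Sum>r<p. c' r * x r ^ k) = y (Suc k) - x p * y k"
    using Suc.IH[of "\<lambda>k. y (Suc k) - x p * y k"] by blast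
  have ne: "x r \<noteq> x p" if "r < p" for r
    using inj_onD[OF Suc.prems, of r p] that by auto
  define c where "c r = (if r = p then y 0 - (\<Sum>r<p. c' r / (x r - x p)) else c' r / (x r - x p))" for r
  have "(\<Sum>r<Suc p. c r * x r ^ k) = y k" if "k < Suc p" for k
    using that
  proof (induction k)
    case 0
    then show ?case by (simp add: c_def)
  next
    case (Suc k)
    have "(\<Sum>r<Suc p. c r * x r ^ Suc k)
        = (\<Sum>r<Suc p. c r * (x r - x p) * x r ^ k) + x p * (\<Sum>r<Suc p. c r * x r ^ k)"
      unfolding sum_distrib_left sum.distrib[symmetric]
      by (rule sum.cong) (simp_all add: algebra_simps)
    also have "(\<Sum>r<Suc p. c r * (x r - x p) * x r ^ k) = (\<Sum>r<p. c' r * x r ^ k)"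
    proof -
      have "(\<Sum>r<p. c r * (x r - x p) * x r ^ k) = (\<Sum>r<p. c' r * x r ^ k)"
        by (rule sum.cong) (use ne in \<open>auto simp: c_def\<close>)
      then show ?thesis by simp
    qed
    also have "\<dots> = y (Suc k) - x p * y k"
      using c' Suc.prems by simp
    also have "(\<Sum>r<Suc p. c r * x r ^ k) = y k"
      using Suc by simp
    finally show ?case by simp
  qed
  then show ?case by blast
qed simp

lemma moment_system_unique:
  fixes x :: "nat \<Rightarrow> 'a::field"
  assumes "inj_on x {..<p}" "\<And>k. k < p \<Longrightarrow> (\<Sum>r<p. c r * x r ^ k) = 0" "r < p"
  shows "c r = 0"
  using assms
proof (induction p arbitrary: c r)
  case (Suc p)
  have inj: "inj_on x {..<p}"
    using Suc.prems(1) by (rule inj_on_subset) auto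
  have ne: "x r \<noteq> x p" if "r < p" for r
    using inj_onD[OF Suc.prems(1), of r p] that by auto
  have "(\<Sum>r<p. (c r * (x r - x p)) * x r ^ k) = 0" if "k < p" for k
  proof -
    have "(\<Sum>r<p. (c r * (x r - x p)) * x r ^ k)
        = (\<Sum>r<Suc p. (c r * (x r - x p)) * x r ^ k)" by simp
    also have "\<dots> = (\<Sum>r<Suc p. c r * x r ^ Suc k) - x p * (\<Sum>r<Suc p. c r * x r ^ k)"
      unfolding sum_distrib_left sum_subtractf[symmetric]
      by (rule sum.cong) (simp_all add: algebra_simps)
    also have "\<dots> = 0"
      using Suc.prems(2)[of k] Suc.prems(2)[of "Suc k"] that by simp
    finally show ?thesis .
  qed
  then have zero: "c r = 0" if "r < p" for r
    using Suc.IH[OF inj, of "\<lambda>r. c r * (x r - x p)" r] ne[OF that] that by auto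
  moreover have "c p = 0"
    using Suc.prems(2)[of 0] zero by simp
  ultimately show ?case
    using Suc.prems(3) less_Suc_eq by auto
qed simp

lemma sum_over_supp:
  assumes "finite A" "supp b \<subseteq> A"
  shows "(\<Sum>j\<in>supp b. b j * g j) = (\<Sum>j\<in>A. b j * g j)"
  by (rule sum.mono_neutral_left) (use assms in \<open>auto simp: supp_def\<close>)

lemma sum_even_formula:
  fixes b :: "int \<Rightarrow> complex" and g :: "int \<Rightarrow> complex"
  assumes b: "\<And>j. b (- j) = b j" and g: "\<And>j. g (- j) = g j"
    and supp: "\<And>j. b j \<noteq> 0 \<Longrightarrow> j \<le> J"
  shows "(\<Sum>j\<in>supp b. b j * g j) = b 0 * g 0 + 2 * (\<Sum>j = 1..J. b j * g j)"
proof -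
  define K where "K = max J 0"
  have sub: "supp b \<subseteq> {-K..K}"
  proof
    fix j assume "j \<in> supp b"
    then have "b j \<noteq> 0" "b (- j) \<noteq> 0" by (simp_all add: supp_def b)
    then show "j \<in> {-K..K}" using supp[of j] supp[of "- j"] by (auto simp: K_def)
  qed
  have neg: "(\<Sum>j = -K..- 1. b j * g j) = (\<Sum>j = 1..K. b j * g j)"
    by (rule sum.reindex_bij_witness[of _ uminus uminus]) (auto simp: b g)
  have split: "{-K..K} = {-K..- 1} \<union> ({0} \<union> {1..K})"
    by (auto simp: K_def)
  have "(\<Sum>j\<in>supp b. b j * g j) = (\<Sum>j\<in>{-K..K}. b j * g j)"
    using sub by (intro sum_over_supp) auto
  also have "\<dots> = (\<Sum>j = -K..- 1. b j * g j) + (b 0 * g 0 + (\<Sum>j = 1..K. b j * g j))"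
    unfolding split
    by (subst sum.union_disjoint, simp, simp, force, subst sum.union_disjoint) auto
  also have "(\<Sum>j = 1..K. b j * g j) = (\<Sum>j = 1..J. b j * g j)"
    by (rule sum.cong) (auto simp: K_def)
  finally show ?thesis unfolding neg
    using \<open>(\<Sum>j = 1..K. b j * g j) = (\<Sum>j = 1..J. b j * g j)\<close> by simp
qed

definition moment :: "(int \<Rightarrow> complex) \<Rightarrow> nat \<Rightarrow> complex" where
  "moment b m = (\<Sum>j\<in>supp b. b j * of_int j ^ m)"

lemma moment_odd:
  assumes "\<And>j. b (- j) = b j" "odd m"
  shows "moment b m = 0"
proof -
  have "moment b m = - moment b m"
    unfolding moment_def sum_negf[symmetric]
    by (rule sum.reindex_bij_witness[of _ uminus uminus]) (use assms in \<open>auto simp: supp_def\<close>)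
  then show ?thesis by simp
qed

lemma sym_formulasD:
  assumes "b \<in> sym_formulas K"
  shows "finite (supp b)" "b (- j) = b j"
  using assms unfolding sym_formulas_def by auto

text \<open>The Taylor coefficient of degree \<open>2 k\<close> of \<open>h \<mapsto> \<Sum>j. d j * u (j h) + h\<^sup>2 * s j * u'' (j h)\<close> is a multiple of
  the left-hand side. Degree \<open>0\<close> does not involve \<open>s\<close>, and the odd degrees vanish by symmetry.\<close>

definition moments_match :: "nat \<Rightarrow> (int \<Rightarrow> complex) \<Rightarrow> (int \<Rightarrow> complex) \<Rightarrow> bool" where
  "moments_match p d s \<longleftrightarrow>
     (\<forall>k\<in>{1..p}. moment d (2 * k) + of_nat (2 * k * (2 * k - 1)) * moment s (2 * k - 2) = 0)"

text \<open>By symmetry the even moments of a short formula only see the squares of the offsets. In the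
  unknowns \<open>s 0\<close>, \<open>2 * s r\<close> the moment equations are therefore a Vandermonde system with the distinct
  nodes \<open>r\<^sup>2\<close>, \<open>r < p\<close>.\<close>

lemma moment_short_formula:
  assumes s: "s \<in> sym_formulas UNIV" and tau: "tau s \<le> ereal (real (2 * p) / 2 - 1)"
  shows "moment s (2 * k) = s 0 * 0 ^ (2 * k) + 2 * (\<Sum>r = 1..int p - 1. s r * of_int r ^ (2 * k))"
    and "p > 0 \<Longrightarrow> moment s (2 * k) = (\<Sum>r<p. (if r = 0 then s 0 else 2 * s (int r)) * ((of_nat r)\<^sup>2) ^ k)"
    and "p = 0 \<Longrightarrow> s = (\<lambda>_. 0)"
proof -
  have le: "j \<le> int p - 1" if "s j \<noteq> 0" for j
  proof -
    have "real_of_int j \<le> real (2 * p) / 2 - 1"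
      using tau that unfolding tau_le_iff by blast
    then show ?thesis by linarith
  qed
  show eq: "moment s (2 * k) = s 0 * 0 ^ (2 * k) + 2 * (\<Sum>r = 1..int p - 1. s r * of_int r ^ (2 * k))"
    unfolding moment_def
    using sum_even_formula[of s "\<lambda>j. of_int j ^ (2 * k)" "int p - 1"] sym_formulasD[OF s] le by auto
  show "moment s (2 * k) = (\<Sum>r<p. (if r = 0 then s 0 else 2 * s (int r)) * ((of_nat r)\<^sup>2) ^ k)" if "p > 0"
  proof -
    have "(\<Sum>r = 1..int p - 1. s r * of_int r ^ (2 * k)) = (\<Sum>r\<in>{..<p} - {0}. s (int r) * of_nat r ^ (2 * k))"
      by (rule sum.reindex_bij_witness[of _ int nat]) auto
    moreover have "(\<Sum>r<p. (if r = 0 then s 0 else 2 * s (int r)) * ((of_nat r)\<^sup>2) ^ k)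
        = s 0 * 0 ^ (2 * k)
          + (\<Sum>r\<in>{..<p} - {0}. (if r = 0 then s 0 else 2 * s (int r)) * ((of_nat r)\<^sup>2) ^ k)"
      using that by (subst sum.remove[of "{..<p}" 0]) (simp_all add: power_mult)
    moreover have "(\<Sum>r\<in>{..<p} - {0}. (if r = 0 then s 0 else 2 * s (int r)) * ((of_nat r)\<^sup>2) ^ k)
        = 2 * (\<Sum>r\<in>{..<p} - {0}. s (int r) * of_nat r ^ (2 * k))"
      unfolding sum_distrib_left by (rule sum.cong) (simp_all add: power_mult)
    ultimately show ?thesis unfolding eq by simp
  qed
  show "s = (\<lambda>_. 0)" if "p = 0"
  proof
    fix j
    show "s j = 0"
      using le[of j] le[of "- j"] sym_formulasD(2)[OF s, of j] that by (cases "s j = 0") auto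
  qed
qed

lemma ex1_moments_match:
  shows "\<exists>!s. s \<in> sym_formulas UNIV \<and> tau s \<le> ereal (real (2 * p) / 2 - 1) \<and> moments_match p d s"
    (is "\<exists>!s. ?A s")
proof -
  have inj: "inj_on (\<lambda>r. (of_nat r)\<^sup>2 :: complex) {..<p}"
  proof (rule inj_onI)
    fix r q :: nat assume "(of_nat r)\<^sup>2 = ((of_nat q)\<^sup>2 :: complex)"
    then have "of_nat (r\<^sup>2) = (of_nat (q\<^sup>2) :: complex)" by simp
    then show "r = q" unfolding of_nat_eq_iff by simp
  qed
  have ne: "of_nat (2 * k * (2 * k - 1)) \<noteq> (0 :: complex)" if "k \<ge> 1" for k
    unfolding of_nat_eq_0_iff using that by auto
  have ex: "\<exists>s. ?A s"
  proof -
    obtain c where c: "\<And>k. k < p \<Longrightarrow> (\<Sum>r<p. c r * ((of_nat r)\<^sup>2 :: complex) ^ k)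
        = - moment d (2 * Suc k) / of_nat (2 * Suc k * (2 * Suc k - 1))"
      using moment_system_solvable[OF inj, of "\<lambda>k. - moment d (2 * Suc k) / of_nat (2 * Suc k * (2 * Suc k - 1))"]
      by blast
    define s where "s j = (if j = 0 \<and> p > 0 then c 0 else if \<bar>j\<bar> < int p then c (nat \<bar>j\<bar>) / 2 else 0)"
      for j :: int
    have sub: "supp s \<subseteq> {- int p..int p}"
      by (auto simp: supp_def s_def split: if_splits)
    have s: "s \<in> sym_formulas UNIV"
      using finite_subset[OF sub] by (auto simp: sym_formulas_def s_def)
    have tau: "tau s \<le> ereal (real (2 * p) / 2 - 1)"
      unfolding tau_le_iff by (auto simp: s_def)
    have "moment s (2 * k - 2) = - moment d (2 * k) / of_nat (2 * k * (2 * k - 1))" if k: "k \<in> {1..p}" for k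
    proof -
      obtain q where q: "k = Suc q" using k by (cases k) auto
      have "p > 0" "q < p" using k q by auto
      then have "moment s (2 * q) = (\<Sum>r<p. c r * ((of_nat r)\<^sup>2) ^ q)"
        using moment_short_formula(2)[OF s tau, of q]
        by (auto simp: s_def intro!: sum.cong)
      then show ?thesis using c[OF \<open>q < p\<close>] q by simp
    qed
    then have "moments_match p d s"
      using ne by (auto simp: moments_match_def)
    then show ?thesis using s tau by blast
  qed
  have un: "s = s'" if s: "?A s" and s': "?A s'" for s s'
  proof (cases "p = 0")
    case True
    then show ?thesis
      using s s' moment_short_formula(3)[of s p] moment_short_formula(3)[of s' p] by auto
  next
    case False
    define c where "c b r = (if r = 0 then b 0 else 2 * b (int r))" for b :: "int \<Rightarrow> complex" and r :: nat
    have "(\<Sum>r<p. (c s r - c s' r) * ((of_nat r)\<^sup>2) ^ k) = 0" if "k < p" for k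
    proof -
      have "moment d (2 * Suc k) + of_nat (2 * Suc k * (2 * Suc k - 1)) * moment b (2 * Suc k - 2) = 0"
        if b: "?A b" for b
      proof -
        have "Suc k \<in> {1..p}" using \<open>k < p\<close> by simp
        then show ?thesis using b unfolding moments_match_def by blast
      qed
      from this[OF s] this[OF s']
      have "of_nat (2 * Suc k * (2 * Suc k - 1)) * moment s (2 * Suc k - 2)
          = of_nat (2 * Suc k * (2 * Suc k - 1)) * moment s' (2 * Suc k - 2)"
        by (metis add_left_cancel)
      then have "moment s (2 * k) = moment s' (2 * k)"
        using ne[of "Suc k"] by (simp only: mult_cancel_left) simp
      then show ?thesis
        using moment_short_formula(2)[of s p k] moment_short_formula(2)[of s' p k] s s' False
        by (simp add: c_def left_diff_distrib sum_subtractf)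
    qed
    then have c: "c s r = c s' r" if "r < p" for r
      using moment_system_unique[OF inj, of "\<lambda>r. c s r - c s' r" r] that by auto
    have out: "b j = 0" if "?A b" "j \<ge> int p" for b j
    proof (rule ccontr)
      assume "b j \<noteq> 0"
      then have "real_of_int j \<le> real (2 * p) / 2 - 1"
        using that unfolding tau_le_iff by blast
      then show False using that by linarith
    qed
    have nonneg: "s j = s' j" if "j \<ge> 0" for j
    proof (cases "j < int p")
      case True
      then have "c s (nat j) = c s' (nat j)" using that by (intro c) auto
      then show ?thesis using that by (cases "j = 0") (simp_all add: c_def)
    next
      case False
      then have "int p \<le> j" by simp
      then show ?thesis using out[OF s] out[OF s'] by simp
    qed
    show ?thesis
    proof
      fix j
      show "s j = s' j"
        using nonneg[of j] nonneg[of "- j"] sym_formulasD(2)[of s UNIV j] sym_formulasD(2)[of s' UNIV j] s s'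
        by (cases "j \<ge> 0") auto
    qed
  qed
  show ?thesis using ex un by blast
qed

section \<open>Taylor expansion and consistency\<close>

text \<open>The derivative of the remainder of order \<open>K + 1\<close> of \<open>G 0\<close> is the remainder of order \<open>K\<close> of \<open>G 1\<close>, so
  the bound follows by induction from the mean value inequality.\<close>

lemma taylor_bound:
  fixes G :: "nat \<Rightarrow> real \<Rightarrow> complex"
  assumes S: "convex S" and a: "a \<in> S" and y: "y \<in> S"
    and deriv: "\<And>m t. m < K \<Longrightarrow> t \<in> S \<Longrightarrow> (G m has_vector_derivative G (Suc m) t) (at t within S)"
    and M: "\<And>t. t \<in> S \<Longrightarrow> cmod (G K t) \<le> M"
  shows "cmod (G 0 y - (\<Sum>m<K. of_real ((y - a) ^ m / fact m) * G m a)) \<le> M * \<bar>y - a\<bar> ^ K"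
  using y deriv M
proof (induction K arbitrary: G y)
  case (Suc K)
  let ?T = "closed_segment a y"
  define \<phi> where "\<phi> t = G 0 t - (\<Sum>m<Suc K. of_real ((t - a) ^ m / fact m) * G m a)" for t
  define \<psi> where "\<psi> t = G 1 t - (\<Sum>m<K. of_real ((t - a) ^ m / fact m) * G (Suc m) a)" for t
  have T: "?T \<subseteq> S"
    using S a Suc.prems(1) by (rule closed_segment_subset[rotated 2])
  have \<psi>: "cmod (\<psi> t) \<le> M * \<bar>t - a\<bar> ^ K" if "t \<in> S" for t
    using Suc.IH[of t "\<lambda>m. G (Suc m)"] Suc.prems that by (simp add: \<psi>_def)
  have poly: "((\<lambda>t. of_real ((t - a) ^ Suc m / fact (Suc m)) * G (Suc m) a) has_vector_derivative
      of_real ((t - a) ^ m / fact m) * G (Suc m) a) (at t within ?T)" for m t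
  proof -
    have "((\<lambda>t. (t - a) ^ Suc m) has_real_derivative of_nat (Suc m) * (t - a) ^ m) (at t within ?T)"
      by (rule derivative_eq_intros refl)+ simp
    from DERIV_cdivide[OF this, of "fact (Suc m)"]
    have "((\<lambda>t. (t - a) ^ Suc m / fact (Suc m)) has_real_derivative (t - a) ^ m / fact m) (at t within ?T)"
      by (simp add: fact_Suc del: of_nat_Suc)
    then have "((\<lambda>t. complex_of_real ((t - a) ^ Suc m / fact (Suc m))) has_vector_derivative
        of_real ((t - a) ^ m / fact m)) (at t within ?T)"
      by (rule has_vector_derivative_of_real)
    then show ?thesis
      by (rule has_vector_derivative_mult_left)
  qed
  have \<phi>': "(\<phi> has_vector_derivative \<psi> t) (at t within ?T)" if t: "t \<in> ?T" for t
  proof -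
    have "(G 0 has_vector_derivative G 1 t) (at t within ?T)"
      using Suc.prems(2)[of 0 t] t T by (auto intro: has_vector_derivative_within_subset)
    moreover have "((\<lambda>t. \<Sum>m<K. of_real ((t - a) ^ Suc m / fact (Suc m)) * G (Suc m) a)
        has_vector_derivative (\<Sum>m<K. of_real ((t - a) ^ m / fact m) * G (Suc m) a)) (at t within ?T)"
      by (rule has_vector_derivative_sum) (rule poly)
    ultimately have "((\<lambda>t. G 0 t - (\<Sum>m<K. of_real ((t - a) ^ Suc m / fact (Suc m)) * G (Suc m) a) - G 0 a)
        has_vector_derivative \<psi> t - 0) (at t within ?T)"
      unfolding \<psi>_def by (intro has_vector_derivative_diff has_vector_derivative_const)
    then show ?thesis
      unfolding \<phi>_def sum.lessThan_Suc_shift by (simp add: algebra_simps)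
  qed
  have B: "onorm (\<lambda>x. x *\<^sub>R \<psi> t) \<le> M * \<bar>y - a\<bar> ^ K" if t: "t \<in> ?T" for t
  proof (rule onorm_le)
    fix x :: real
    have M0: "0 \<le> M" using Suc.prems(3)[of y] Suc.prems(1) norm_ge_zero order_trans by blast
    have "\<bar>t - a\<bar> \<le> \<bar>y - a\<bar>"
      using t by (auto simp: closed_segment_eq_real_ivl split: if_splits)
    then have "M * \<bar>t - a\<bar> ^ K \<le> M * \<bar>y - a\<bar> ^ K"
      using M0 by (intro mult_left_mono power_mono) auto
    then have "cmod (\<psi> t) \<le> M * \<bar>y - a\<bar> ^ K"
      using \<psi>[of t] t T by auto
    then show "norm (x *\<^sub>R \<psi> t) \<le> M * \<bar>y - a\<bar> ^ K * norm x"
      by (simp add: mult.commute mult_left_mono)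
  qed
  have "norm (\<phi> y - \<phi> a) \<le> M * \<bar>y - a\<bar> ^ K * norm (y - a)"
    by (rule differentiable_bound[of ?T \<phi> "\<lambda>t x. x *\<^sub>R \<psi> t"])
      (use \<phi>' B in \<open>auto simp: has_vector_derivative_def\<close>)
  moreover have "\<phi> a = 0"
    unfolding \<phi>_def sum.lessThan_Suc_shift by simp
  ultimately show ?case
    by (simp add: \<phi>_def mult_ac)
qed simp

text \<open>All consistency estimates are instances of this lemma: in the interior \<open>a\<close> is the grid point, at an
  end point \<open>d\<close> is the defect caused by the reflection and \<open>a = 0\<close>.\<close>

lemma stencil_error:
  fixes G :: "nat \<Rightarrow> real \<Rightarrow> complex"
  assumes S: "convex S" and a: "a \<in> S"
    and deriv: "\<And>m t. m < K \<Longrightarrow> t \<in> S \<Longrightarrow> (G m has_vector_derivative G (Suc m) t) (at t within S)"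
    and M: "\<And>t. t \<in> S \<Longrightarrow> cmod (G K t) \<le> M"
    and K: "K \<ge> 2" and h: "h \<ge> 0"
    and moments: "\<And>m. m < K \<Longrightarrow> moment d m + of_nat (m * (m - 1)) * moment s (m - 2) = 0"
    and inS: "\<And>j. j \<in> supp d \<union> supp s \<Longrightarrow> a + of_int j * h \<in> S"
  shows "cmod ((\<Sum>j\<in>supp d. d j * G 0 (a + of_int j * h))
               + (of_real h)\<^sup>2 * (\<Sum>j\<in>supp s. s j * G 2 (a + of_int j * h)))
    \<le> M * h ^ K * ((\<Sum>j\<in>supp d. cmod (d j) * \<bar>of_int j\<bar> ^ K)
                   + (\<Sum>j\<in>supp s. cmod (s j) * \<bar>of_int j\<bar> ^ (K - 2)))"
proof -
  obtain L where L: "K = Suc (Suc L)"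
    using K by (metis One_nat_def Suc_1 Suc_le_D Suc_le_mono)
  define H where "H = complex_of_real h"
  define T0 where "T0 j = (\<Sum>m<K. of_real ((of_int j * h) ^ m / fact m) * G m a)" for j :: int
  define T2 where "T2 j = (\<Sum>m<L. of_real ((of_int j * h) ^ m / fact m) * G (m + 2) a)" for j :: int
  have e0: "cmod (G 0 (a + of_int j * h) - T0 j) \<le> M * (\<bar>of_int j\<bar> ^ K * h ^ K)"
    if "j \<in> supp d" for j
    using taylor_bound[OF S a inS, of j K G M] that deriv M h
    by (simp add: T0_def abs_mult power_mult_distrib)
  have e2: "cmod (G 2 (a + of_int j * h) - T2 j) \<le> M * (\<bar>of_int j\<bar> ^ L * h ^ L)"
    if "j \<in> supp s" for j
  proof -
    have "cmod ((\<lambda>m. G (m + 2)) 0 (a + of_int j * h)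
        - (\<Sum>m<L. of_real ((a + of_int j * h - a) ^ m / fact m) * (\<lambda>m. G (m + 2)) m a))
        \<le> M * \<bar>a + of_int j * h - a\<bar> ^ L"
    proof (rule taylor_bound[OF S a inS])
      show "j \<in> supp d \<union> supp s" using that by simp
      show "(G (m + 2) has_vector_derivative G (Suc m + 2) t) (at t within S)" if "m < L" "t \<in> S" for m t
        using deriv[of "m + 2" t] that L by simp
      show "cmod (G (L + 2) t) \<le> M" if "t \<in> S" for t
        using M[OF that] L by simp
    qed
    then show ?thesis
      using h by (simp add: T2_def abs_mult power_mult_distrib numeral_2_eq_2)
  qed
  have "(\<Sum>j\<in>supp d. d j * T0 j) = (\<Sum>m<K. H ^ m / fact m * moment d m * G m a)"
    unfolding T0_def moment_def sum_distrib_left sum_distrib_right H_def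
    by (subst sum.swap) (simp add: power_mult_distrib mult_ac)
  moreover have "H\<^sup>2 * (\<Sum>j\<in>supp s. s j * T2 j)
      = (\<Sum>m<K. H ^ m / fact m * (of_nat (m * (m - 1)) * moment s (m - 2)) * G m a)"
  proof -
    have "H\<^sup>2 * (\<Sum>j\<in>supp s. s j * T2 j) = (\<Sum>m<L. H ^ (m + 2) / fact m * moment s m * G (m + 2) a)"
      unfolding T2_def moment_def sum_distrib_left sum_distrib_right H_def
      by (subst sum.swap) (simp add: power_mult_distrib power_add power2_eq_square mult_ac)
    also have "\<dots> = (\<Sum>m<L. H ^ (m + 2) / fact (m + 2)
        * (of_nat ((m + 2) * (m + 1)) * moment s m) * G (m + 2) a)"
    proof (rule sum.cong[OF refl])
      fix m
      have "(fact (m + 2) :: complex) = of_nat ((m + 2) * (m + 1)) * fact m"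
        by (simp add: algebra_simps numeral_2_eq_2)
      moreover have "of_nat ((m + 2) * (m + 1)) \<noteq> (0 :: complex)"
        unfolding of_nat_eq_0_iff by simp
      moreover have "x / f * y * z = x / (q * f) * (q * y) * z" if "q \<noteq> 0" for q f x y z :: complex
        using that by simp
      ultimately show "H ^ (m + 2) / fact m * moment s m * G (m + 2) a
          = H ^ (m + 2) / fact (m + 2) * (of_nat ((m + 2) * (m + 1)) * moment s m) * G (m + 2) a"
        by metis
    qed
    also have "\<dots> = (\<Sum>m<K. H ^ m / fact m * (of_nat (m * (m - 1)) * moment s (m - 2)) * G m a)"
      unfolding L sum.lessThan_Suc_shift by (simp del: sum.lessThan_Suc of_nat_Suc)
    finally show ?thesis .
  qed
  \<comment> \<open>The moment conditions say that the Taylor polynomials contribute nothing.\<close>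
  ultimately have "(\<Sum>j\<in>supp d. d j * T0 j) + H\<^sup>2 * (\<Sum>j\<in>supp s. s j * T2 j)
      = (\<Sum>m<K. H ^ m / fact m * (moment d m + of_nat (m * (m - 1)) * moment s (m - 2)) * G m a)"
    by (simp only: sum.distrib distrib_left distrib_right)
  also have "\<dots> = 0"
    using moments by (intro sum.neutral) auto
  finally have zero: "(\<Sum>j\<in>supp d. d j * T0 j) + H\<^sup>2 * (\<Sum>j\<in>supp s. s j * T2 j) = 0" .
  have cancel: "x + c * y = (x - t) + c * (y - v)" if "t + c * v = 0" for x y t v c :: complex
  proof -
    have "(x - t) + c * (y - v) = x + c * y - (t + c * v)" by (simp add: algebra_simps)
    then show ?thesis using that by simp
  qed
  have "(\<Sum>j\<in>supp d. d j * G 0 (a + of_int j * h)) + H\<^sup>2 * (\<Sum>j\<in>supp s. s j * G 2 (a + of_int j * h))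
      = (\<Sum>j\<in>supp d. d j * (G 0 (a + of_int j * h) - T0 j))
        + H\<^sup>2 * (\<Sum>j\<in>supp s. s j * (G 2 (a + of_int j * h) - T2 j))"
    unfolding right_diff_distrib[of "d _"] right_diff_distrib[of "s _"] sum_subtractf
    by (rule cancel[OF zero])
  also have "cmod \<dots> \<le> (\<Sum>j\<in>supp d. cmod (d j) * (M * (\<bar>of_int j\<bar> ^ K * h ^ K)))
        + h\<^sup>2 * (\<Sum>j\<in>supp s. cmod (s j) * (M * (\<bar>of_int j\<bar> ^ L * h ^ L)))"
  proof (rule norm_triangle_le, rule add_mono)
    show "cmod (\<Sum>j\<in>supp d. d j * (G 0 (a + of_int j * h) - T0 j))
        \<le> (\<Sum>j\<in>supp d. cmod (d j) * (M * (\<bar>of_int j\<bar> ^ K * h ^ K)))"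
      by (rule sum_norm_le) (simp add: norm_mult e0 mult_left_mono)
    have "cmod (\<Sum>j\<in>supp s. s j * (G 2 (a + of_int j * h) - T2 j))
        \<le> (\<Sum>j\<in>supp s. cmod (s j) * (M * (\<bar>of_int j\<bar> ^ L * h ^ L)))"
      by (rule sum_norm_le) (simp add: norm_mult e2 mult_left_mono)
    then show "cmod (H\<^sup>2 * (\<Sum>j\<in>supp s. s j * (G 2 (a + of_int j * h) - T2 j)))
        \<le> h\<^sup>2 * (\<Sum>j\<in>supp s. cmod (s j) * (M * (\<bar>of_int j\<bar> ^ L * h ^ L)))"
      by (simp add: norm_mult norm_power H_def mult_left_mono)
  qed
  also have "\<dots> = M * h ^ K * ((\<Sum>j\<in>supp d. cmod (d j) * \<bar>of_int j\<bar> ^ K)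
                   + (\<Sum>j\<in>supp s. cmod (s j) * \<bar>of_int j\<bar> ^ (K - 2)))"
    unfolding L by (simp add: sum_distrib_left distrib_left power2_eq_square mult_ac)
  finally show ?thesis
    unfolding H_def .
qed

lemma moments_vanish:
  assumes d: "d \<in> sym_formulas K" and s: "s \<in> sym_formulas K'"
    and sum: "moment d 0 = 0" and match: "moments_match p d s" and m: "m < 2 * p + 2"
  shows "moment d m + of_nat (m * (m - 1)) * moment s (m - 2) = 0"
proof (cases "even m")
  case True
  then obtain k where k: "m = 2 * k" by blast
  show ?thesis
  proof (cases "k = 0")
    case False
    then have "k \<in> {1..p}" using m k by auto
    then show ?thesis using match k unfolding moments_match_def by blast
  qed (simp add: k sum)
next
  case False
  then have "moment d m = 0" using moment_odd sym_formulasD(2)[OF d] by blast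
  moreover have "m = 1 \<or> moment s (m - 2) = 0"
  proof (cases "m = 1")
    case False
    then have "odd (m - 2)" using \<open>odd m\<close> by presburger
    then show ?thesis using moment_odd[of s "m - 2"] sym_formulasD(2)[OF s] by simp
  qed simp
  ultimately show ?thesis by auto
qed

lemma vderiv_iter:
  assumes "C_infinity u"
  shows "((vderiv ^^ m) u has_vector_derivative (vderiv ^^ Suc m) u t) (at t)"
  using assms unfolding C_infinity_def
  by (simp add: vderiv_def vector_derivative_works[symmetric])

lemma vderiv_iter_bounded:
  assumes "C_infinity u"
  shows "\<exists>M\<ge>0. \<forall>t\<in>{a..b}. cmod ((vderiv ^^ m) u t) \<le> M"
proof -
  have "continuous_on {a..b} ((vderiv ^^ m) u)"
    using vderiv_iter[OF assms]
    by (intro continuous_at_imp_continuous_on ballI) (metis has_vector_derivative_continuous)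
  then have "bounded ((vderiv ^^ m) u ` {a..b})"
    using compact_continuous_image compact_imp_bounded by blast
  then obtain M where "M > 0" "\<forall>t\<in>{a..b}. cmod ((vderiv ^^ m) u t) \<le> M"
    unfolding bounded_pos by auto
  then show ?thesis by (intro exI[of _ M]) auto
qed

lemma sum_union_supp:
  assumes "finite (supp d)" "finite (supp s)"
  shows "(\<Sum>j\<in>supp d \<union> supp s. d j * g j + c * s j * k j)
    = (\<Sum>j\<in>supp d. d j * g j) + c * (\<Sum>j\<in>supp s. s j * k j)"
  using sum_over_supp[of "supp d \<union> supp s" d g] sum_over_supp[of "supp d \<union> supp s" s k] assms
  by (simp add: sum.distrib sum_distrib_left mult_ac)

lemma moments_match_imp_consistent:
  assumes d: "d \<in> sym_formulas K" and s: "s \<in> sym_formulas K'"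
    and sum: "moment d 0 = 0" and match: "moments_match p d s"
  shows "consistent (2 * p) d s"
  unfolding consistent_def
proof (intro allI impI)
  fix u assume u: "C_infinity u"
  have fin: "finite (supp d)" "finite (supp s)"
    using sym_formulasD(1) d s by auto
  define J where "J = real_of_int (Max (insert 0 (abs ` (supp d \<union> supp s))))"
  have J: "\<bar>real_of_int j\<bar> \<le> J" if "j \<in> supp d \<union> supp s" for j
  proof -
    have "\<bar>j\<bar> \<le> Max (insert 0 (abs ` (supp d \<union> supp s)))"
      using that fin by (intro Max_ge) auto
    then show ?thesis unfolding J_def by linarith
  qed
  have J0: "J \<ge> 0" using fin unfolding J_def by simp
  obtain M where M: "\<And>t. t \<in> {-J..J} \<Longrightarrow> cmod ((vderiv ^^ (2 * p + 2)) u t) \<le> M"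
    using vderiv_iter_bounded[OF u] by blast
  let ?C = "M * ((\<Sum>j\<in>supp d. cmod (d j) * \<bar>of_int j\<bar> ^ (2 * p + 2))
                   + (\<Sum>j\<in>supp s. cmod (s j) * \<bar>of_int j\<bar> ^ (2 * p + 2 - 2)))"
  show "(\<lambda>h. \<Sum>j\<in>supp d \<union> supp s. d j * u (of_int j * h)
            + (of_real h)\<^sup>2 * s j * (vderiv ^^ 2) u (of_int j * h))
       \<in> O[at_right 0](\<lambda>h. of_real h ^ (2 * p + 2))"
  proof (rule bigoI[of _ ?C])
    have "cmod (\<Sum>j\<in>supp d \<union> supp s. d j * u (of_int j * h)
            + (of_real h)\<^sup>2 * s j * (vderiv ^^ 2) u (of_int j * h))
         \<le> ?C * norm (complex_of_real h ^ (2 * p + 2))" if h: "0 < h" "h < 1" for h :: real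
    proof -
      have in_J: "0 + of_int j * h \<in> {-J..J}" if "j \<in> supp d \<union> supp s" for j
      proof -
        have "\<bar>of_int j * h\<bar> \<le> J * 1"
          unfolding abs_mult using J[OF that] h J0 by (intro mult_mono) auto
        then show ?thesis by auto
      qed
      have "cmod ((\<Sum>j\<in>supp d. d j * (vderiv ^^ 0) u (0 + of_int j * h))
               + (of_real h)\<^sup>2 * (\<Sum>j\<in>supp s. s j * (vderiv ^^ 2) u (0 + of_int j * h)))
          \<le> M * h ^ (2 * p + 2) * ((\<Sum>j\<in>supp d. cmod (d j) * \<bar>of_int j\<bar> ^ (2 * p + 2))
                   + (\<Sum>j\<in>supp s. cmod (s j) * \<bar>of_int j\<bar> ^ (2 * p + 2 - 2)))"
        using in_J h J0 M moments_vanish[OF d s sum match]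
        by (intro stencil_error[where S = "{-J..J}" and G = "\<lambda>m. (vderiv ^^ m) u"])
          (auto intro: has_vector_derivative_at_within vderiv_iter[OF u, unfolded funpow.simps o_def] simp: o_def)
      moreover have "norm (complex_of_real h ^ (2 * p + 2)) = h ^ (2 * p + 2)"
        using h by (simp only: norm_power norm_of_real abs_of_pos)
      ultimately show ?thesis
        unfolding sum_union_supp[OF fin] by (simp only: add_0_left funpow_0 mult_ac)
    qed
    then show "\<forall>\<^sub>F h in at_right 0. cmod (\<Sum>j\<in>supp d \<union> supp s. d j * u (of_int j * h)
            + (of_real h)\<^sup>2 * s j * (vderiv ^^ 2) u (of_int j * h))
         \<le> ?C * norm (complex_of_real h ^ (2 * p + 2))"
      unfolding eventually_at_right_field by (intro exI[of _ 1]) auto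
  qed
qed

lemma vderiv_iter_monomial:
  "(vderiv ^^ k) (\<lambda>x. c * of_real x ^ m) = (\<lambda>x. c * of_nat (\<Prod>i<k. m - i) * of_real x ^ (m - k))"
proof (induction k)
  case (Suc k)
  have "vderiv (\<lambda>x. c * of_nat (\<Prod>i<k. m - i) * of_real x ^ (m - k)) x
      = c * of_nat (\<Prod>i<k. m - i) * (of_nat (m - k) * of_real x ^ (m - k - 1))" for x
  proof -
    have "((\<lambda>x. x ^ (m - k)) has_real_derivative of_nat (m - k) * x ^ (m - k - 1)) (at x)"
      by (rule derivative_eq_intros refl)+ simp
    then have "((\<lambda>x. complex_of_real (x ^ (m - k))) has_vector_derivative
        of_real (of_nat (m - k) * x ^ (m - k - 1))) (at x)"
      by (rule has_vector_derivative_of_real)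
    then have "((\<lambda>x. c * of_nat (\<Prod>i<k. m - i) * complex_of_real (x ^ (m - k))) has_vector_derivative
        c * of_nat (\<Prod>i<k. m - i) * of_real (of_nat (m - k) * x ^ (m - k - 1))) (at x)"
      by (rule has_vector_derivative_mult_right)
    then show ?thesis
      unfolding vderiv_def by (auto dest: vector_derivative_at)
  qed
  then show ?case by (simp add: Suc mult_ac)
qed simp

lemma C_infinity_monomial: "C_infinity (\<lambda>x. of_real x ^ m)"
proof -
  have "(\<lambda>x. a * complex_of_real x ^ k) differentiable (at x)" for a k x
    by (intro derivative_intros)
  then show ?thesis
    unfolding C_infinity_def using vderiv_iter_monomial[of _ 1 m] by simp
qed

text \<open>Tested on the monomial \<open>x ^ (2 k)\<close>, the consistency expression is exactly \<open>c * h ^ (2 k)\<close>, where \<open>c\<close> is the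
  left-hand side of the moment equation. It can be of order \<open>h ^ (2 p + 2)\<close> only if \<open>c = 0\<close>.\<close>

lemma consistent_imp_moments_match:
  assumes d: "d \<in> sym_formulas K" and s: "s \<in> sym_formulas K'" and cons: "consistent (2 * p) d s"
  shows "moments_match p d s"
  unfolding moments_match_def
proof (intro ballI)
  fix k assume k: "k \<in> {1..p}"
  define c where "c = moment d (2 * k) + of_nat (2 * k * (2 * k - 1)) * moment s (2 * k - 2)"
  have fin: "finite (supp d)" "finite (supp s)"
    using sym_formulasD(1) d s by auto
  have "(\<Sum>j\<in>supp d \<union> supp s. d j * of_real (of_int j * h) ^ (2 * k)
      + (of_real h)\<^sup>2 * s j * (vderiv ^^ 2) (\<lambda>x. of_real x ^ (2 * k)) (of_int j * h))
      = c * of_real h ^ (2 * k)" for h :: real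
  proof -
    have e1: "(vderiv ^^ 2) (\<lambda>x. complex_of_real x ^ (2 * k))
        = (\<lambda>x. of_nat (2 * k * (2 * k - 1)) * of_real x ^ (2 * k - 2))"
      using vderiv_iter_monomial[of 2 1 "2 * k"] by (simp add: lessThan_nat_numeral mult_ac del: funpow.simps)
    have e2: "complex_of_real h ^ (2 * k) = (of_real h)\<^sup>2 * of_real h ^ (2 * k - 2)"
    proof -
      have "2 * k = 2 + (2 * k - 2)" using k by auto
      then show ?thesis by (metis power_add)
    qed
    have e3: "(\<Sum>j\<in>supp d. d j * of_real (of_int j * h) ^ (2 * k)) = moment d (2 * k) * of_real h ^ (2 * k)"
      unfolding moment_def sum_distrib_right by (simp add: power_mult_distrib mult_ac)
    have e4: "(\<Sum>j\<in>supp s. s j * (Q * of_real (of_int j * h) ^ (2 * k - 2)))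
        = Q * (moment s (2 * k - 2) * of_real h ^ (2 * k - 2))" for Q :: complex
      unfolding moment_def sum_distrib_right sum_distrib_left by (simp add: power_mult_distrib mult_ac)
    show ?thesis
      unfolding sum_union_supp[OF fin] c_def e1 e3 e4 e2 by (simp only: distrib_right distrib_left mult_ac)
  qed
  then have "(\<lambda>h. c * of_real h ^ (2 * k)) \<in> O[at_right 0](\<lambda>h::real. of_real h ^ (2 * p + 2))"
    using cons C_infinity_monomial[of "2 * k"] unfolding consistent_def by auto
  then obtain B where B: "B > 0"
    and "\<forall>\<^sub>F h::real in at_right 0. cmod (c * of_real h ^ (2 * k)) \<le> B * cmod (of_real h ^ (2 * p + 2))"
    by (elim landau_o.bigE)
  then obtain b :: real where b: "b > 0"
    "\<And>h. 0 < h \<Longrightarrow> h < b \<Longrightarrow> cmod (c * of_real h ^ (2 * k)) \<le> B * cmod (of_real h ^ (2 * p + 2))"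
    unfolding eventually_at_right_field by auto
  have "cmod c \<le> B * h" if h: "0 < h" "h < min b 1" for h
  proof -
    have "cmod c * h ^ (2 * k) \<le> B * h ^ (2 * p + 2)"
      using b(2)[of h] h by (simp add: norm_mult norm_power)
    also have "h ^ (2 * p + 2) \<le> h ^ (2 * k + 1)"
      using k h by (intro power_decreasing) auto
    then have "B * h ^ (2 * p + 2) \<le> B * h * h ^ (2 * k)"
      using B by (simp add: mult_ac)
    finally show ?thesis
      using h by (simp add: mult_le_cancel_right)
  qed
  then have "\<forall>\<^sub>F h in at_right 0. cmod c \<le> B * h"
    unfolding eventually_at_right_field using b(1) by (intro exI[of _ "min b 1"]) auto
  moreover have "((\<lambda>h. B * h) \<longlongrightarrow> B * 0) (at_right 0)"
    by (intro tendsto_intros)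
  ultimately have "cmod c \<le> B * 0"
    by (intro tendsto_lowerbound[of "\<lambda>h. B * h" _ "at_right 0"]) auto
  then show "moment d (2 * k) + of_nat (2 * k * (2 * k - 1)) * moment s (2 * k - 2) = 0"
    by (simp add: c_def)
qed

section \<open>The two correction formulas\<close>

lemma inner_formula_matches:
  assumes d: "d \<in> sym_formulas K" and sum: "moment d 0 = 0"
  shows "inner_formula (2 * p) d \<in> sym_formulas UNIV"
    and "tau (inner_formula (2 * p) d) \<le> ereal (real (2 * p) / 2 - 1)"
    and "moments_match p d (inner_formula (2 * p) d)"
proof -
  have iff: "(s \<in> sym_formulas UNIV \<and> tau s \<le> ereal (real (2 * p) / 2 - 1) \<and> consistent (2 * p) d s)
      \<longleftrightarrow> (s \<in> sym_formulas UNIV \<and> tau s \<le> ereal (real (2 * p) / 2 - 1) \<and> moments_match p d s)" for s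
    using moments_match_imp_consistent[OF d _ sum] consistent_imp_moments_match[OF d] by blast
  have "inner_formula (2 * p) d \<in> sym_formulas UNIV
      \<and> tau (inner_formula (2 * p) d) \<le> ereal (real (2 * p) / 2 - 1)
      \<and> moments_match p d (inner_formula (2 * p) d)"
    unfolding inner_formula_def iff by (rule theI'[OF ex1_moments_match])
  then show "inner_formula (2 * p) d \<in> sym_formulas UNIV"
    and "tau (inner_formula (2 * p) d) \<le> ereal (real (2 * p) / 2 - 1)"
    and "moments_match p d (inner_formula (2 * p) d)"
    by blast+
qed

text \<open>In row \<open>i\<close> the odd reflection replaces \<open>V (- m h)\<close> by \<open>- V (m h)\<close> for \<open>m > 0\<close>, with weight
  \<open>d (- m - i) = d (i + m)\<close>. The resulting error \<open>- d (i + m) * (V (m h) + V (- m h))\<close> is that of a symmetric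
  formula. As \<open>V 0 = 0\<close>, the weight at \<open>0\<close> is free; it is chosen to make the sum of the weights vanish, so
  that the formula is of the same kind as \<open>d\<close>.\<close>

definition reflection_defect :: "(int \<Rightarrow> complex) \<Rightarrow> int \<Rightarrow> int \<Rightarrow> complex" where
  "reflection_defect d i m =
     (if m = 0 then 2 * (\<Sum>j | 0 < j \<and> d (i + j) \<noteq> 0. d (i + j)) else - d (i + \<bar>m\<bar>))"

lemma reflection_defect_moments:
  assumes L: "\<And>j. d j \<noteq> 0 \<Longrightarrow> j \<le> L" and i: "i \<ge> 0" and L0: "0 \<le> L"
  shows "reflection_defect d i \<in> sym_formulas UNIV"
    and "reflection_defect d i m \<noteq> 0 \<Longrightarrow> m \<le> L"
    and "moment (reflection_defect d i) 0 = 0"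
    and "k > 0 \<Longrightarrow> moment (reflection_defect d i) (2 * k)
           = - 2 * (\<Sum>j | 0 < j \<and> d (i + j) \<noteq> 0. d (i + j) * of_int j ^ (2 * k))"
proof -
  let ?g = "reflection_defect d i"
  have up: "m \<le> L" if "?g m \<noteq> 0" for m
    using that L[of "i + \<bar>m\<bar>"] i L0 by (auto simp: reflection_defect_def split: if_splits)
  then show "?g m \<noteq> 0 \<Longrightarrow> m \<le> L" .
  have even: "?g (- m) = ?g m" for m
    by (simp add: reflection_defect_def)
  have "supp ?g \<subseteq> {- L..L}"
    using up even by (auto simp: supp_def) (metis even minus_le_iff up)
  then show "?g \<in> sym_formulas UNIV"
    using finite_subset even by (auto simp: sym_formulas_def)
  have S: "(\<Sum>j | 0 < j \<and> d (i + j) \<noteq> 0. d (i + j) * c j) = (\<Sum>j = 1..L. d (i + j) * c j)" for c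
  proof (rule sum.mono_neutral_left)
    show "{j. 0 < j \<and> d (i + j) \<noteq> 0} \<subseteq> {1..L}" using L i by force
  qed auto
  have M: "moment ?g (2 * k) = ?g 0 * of_int 0 ^ (2 * k) + 2 * (\<Sum>j = 1..L. ?g j * of_int j ^ (2 * k))" for k
    unfolding moment_def by (rule sum_even_formula) (use even up in auto)
  have g: "(\<Sum>j = 1..L. ?g j * of_int j ^ (2 * k)) = - (\<Sum>j = 1..L. d (i + j) * of_int j ^ (2 * k))" for k
    unfolding sum_negf[symmetric] by (rule sum.cong) (auto simp: reflection_defect_def)
  show "moment ?g 0 = 0"
    using M[of 0] g[of 0] S[of "\<lambda>_. 1"] by (simp add: reflection_defect_def)
  show "moment ?g (2 * k) = - 2 * (\<Sum>j | 0 < j \<and> d (i + j) \<noteq> 0. d (i + j) * of_int j ^ (2 * k))"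
    if "k > 0"
    unfolding M g S using that by simp
qed

text \<open>Up to a nonzero factor the equations that determine \<open>b i\<close> are the moment equations for the reflection
  defect of row \<open>i\<close>: the left-hand side of the system is half a moment of \<open>b i\<close>, since a symmetric
  formula counts every offset \<open>r > 0\<close> twice.\<close>

lemma boundary_formula_matches:
  assumes L: "\<And>j. d j \<noteq> 0 \<Longrightarrow> j \<le> L" and i: "i \<ge> 0" and L0: "0 \<le> L"
  shows "boundary_formula (2 * q) d i \<in> sym_formulas UNIV"
    and "tau (boundary_formula (2 * q) d i) \<le> ereal (real (2 * q) / 2 - 1)"
    and "moments_match q (reflection_defect d i) (boundary_formula (2 * q) d i)"
proof -
  have row: "(b 0 / 2 * 0 ^ (2 * k - 2) + (\<Sum>r = 1..int (2 * q) div 2 - 1. b r * of_int r ^ (2 * k - 2))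
        = (\<Sum>j | 0 < j \<and> d (i + j) \<noteq> 0.
             d (i + j) * (of_int j ^ (2 * k) / (2 * of_nat k * (2 * of_nat k - 1)))))
      \<longleftrightarrow> moment (reflection_defect d i) (2 * k) + of_nat (2 * k * (2 * k - 1)) * moment b (2 * k - 2) = 0"
    if b: "b \<in> sym_formulas UNIV" "tau b \<le> ereal (real (2 * q) / 2 - 1)" and k: "k \<in> {1..2 * q div 2}"
    for b k
  proof -
    define c :: complex where "c = of_nat (2 * k * (2 * k - 1))"
    have c: "2 * of_nat k * (2 * of_nat k - 1) = c" and c0: "c \<noteq> 0"
    proof -
      show "2 * of_nat k * (2 * of_nat k - 1) = c"
        using k by (simp add: c_def of_nat_diff)
      show "c \<noteq> 0" unfolding c_def of_nat_eq_0_iff using k by auto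
    qed
    define S where "S = (\<Sum>j | 0 < j \<and> d (i + j) \<noteq> 0. d (i + j) * of_int j ^ (2 * k))"
    have m1: "moment (reflection_defect d i) (2 * k) = - 2 * S"
      unfolding S_def using k by (intro reflection_defect_moments(4)[OF L i L0]) auto
    have "2 * k - 2 = 2 * (k - 1)" by simp
    then have m2: "b 0 / 2 * 0 ^ (2 * k - 2) + (\<Sum>r = 1..int (2 * q) div 2 - 1. b r * of_int r ^ (2 * k - 2))
        = moment b (2 * k - 2) / 2"
      using moment_short_formula(1)[OF b, of "k - 1"] by simp
    have m3: "(\<Sum>j | 0 < j \<and> d (i + j) \<noteq> 0. d (i + j) * (of_int j ^ (2 * k) / c)) = S / c"
      unfolding S_def sum_divide_distrib by simp
    show ?thesis
      unfolding c m2 m3 m1 c_def[symmetric] using c0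
      by (auto simp: field_simps)
  qed
  have iff: "(b \<in> sym_formulas UNIV \<and> tau b \<le> ereal (real (2 * q) / 2 - 1) \<and>
        (\<forall>k\<in>{1..2 * q div 2}.
           b 0 / 2 * 0 ^ (2 * k - 2) + (\<Sum>r = 1..int (2 * q) div 2 - 1. b r * of_int r ^ (2 * k - 2))
           = (\<Sum>j | 0 < j \<and> d (i + j) \<noteq> 0.
                d (i + j) * (of_int j ^ (2 * k) / (2 * of_nat k * (2 * of_nat k - 1))))))
      \<longleftrightarrow> (b \<in> sym_formulas UNIV \<and> tau b \<le> ereal (real (2 * q) / 2 - 1)
            \<and> moments_match q (reflection_defect d i) b)" for b
    unfolding moments_match_def using row[of b] by auto
  have "boundary_formula (2 * q) d i \<in> sym_formulas UNIV
      \<and> tau (boundary_formula (2 * q) d i) \<le> ereal (real (2 * q) / 2 - 1)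
      \<and> moments_match q (reflection_defect d i) (boundary_formula (2 * q) d i)"
    unfolding boundary_formula_def iff by (rule theI'[OF ex1_moments_match])
  then show "boundary_formula (2 * q) d i \<in> sym_formulas UNIV"
    and "tau (boundary_formula (2 * q) d i) \<le> ereal (real (2 * q) / 2 - 1)"
    and "moments_match q (reflection_defect d i) (boundary_formula (2 * q) d i)"
    by blast+
qed

lemma supp_short_formula:
  assumes "s \<in> sym_formulas K" "tau s \<le> ereal (real (2 * p) / 2 - 1)" "j \<in> supp s"
  shows "\<bar>j\<bar> \<le> int p"
proof -
  have *: "real_of_int k \<le> real (2 * p) / 2 - 1" if "s k \<noteq> 0" for k
    using assms(2) that unfolding tau_le_iff by blast
  have "s j \<noteq> 0" "s (- j) \<noteq> 0"
    using assms(3) sym_formulasD(2)[OF assms(1)] by (auto simp: supp_def)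
  from this[THEN *] show ?thesis by linarith
qed

lemma C_formulasD:
  assumes "d \<in> C_formulas K l"
  shows "d \<in> sym_formulas K" "moment d 0 = 0" "d j \<noteq> 0 \<Longrightarrow> \<bar>j\<bar> \<le> int l + 1"
proof -
  show d: "d \<in> sym_formulas K" "moment d 0 = 0"
    using assms by (simp_all add: C_formulas_def moment_def)
  show "\<bar>j\<bar> \<le> int l + 1" if "d j \<noteq> 0"
  proof -
    have *: "real_of_int k \<le> real l + 1" if "d k \<noteq> 0" for k
      using assms that by (auto simp: C_formulas_def tau_le_iff)
    have "d (- j) \<noteq> 0" using that sym_formulasD(2)[OF d(1)] by simp
    then show ?thesis using *[OF that] *[of "- j"] by linarith
  qed
qed

lemma conv_flip:
  assumes "\<And>j. d (- j) = d j"
  shows "conv d w i = (\<Sum>j\<in>supp d. d j * w (i + j))"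
  unfolding conv_def
  by (rule sum.reindex_bij_witness[of _ uminus uminus]) (auto simp: supp_def assms)

lemma odd_reflection_defect:
  fixes V :: "real \<Rightarrow> complex"
  assumes d: "\<And>j. d (- j) = d j" and L: "\<And>j. d j \<noteq> 0 \<Longrightarrow> \<bar>j\<bar> \<le> L"
    and odd: "\<And>j. w (- j) = - w j" and w: "\<And>j. 0 \<le> j \<Longrightarrow> j \<le> J \<Longrightarrow> w j = V (of_int j * h)"
    and V: "V 0 = 0" and i: "0 \<le> i" "i + L \<le> J"
  shows "(\<Sum>j\<in>supp d. d j * (w (i + j) - V (of_int (i + j) * h)))
    = (\<Sum>m\<in>supp (reflection_defect d i). reflection_defect d i m * V (of_int m * h))"
proof (cases "0 \<le> L")
  case L0: True
  let ?g = "reflection_defect d i" and ?v = "\<lambda>m. V (of_int m * h)"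
  have sg: "supp ?g \<subseteq> {-L..L}"
  proof
    fix m assume "m \<in> supp ?g"
    then have "?g m \<noteq> 0" "?g (- m) \<noteq> 0" by (auto simp: supp_def reflection_defect_def)
    moreover have "k \<le> L" if "?g k \<noteq> 0" for k
      using reflection_defect_moments(2)[of d L i k] L i L0 that by (meson abs_le_D1)
    ultimately show "m \<in> {-L..L}" by (metis atLeastAtMost_iff minus_le_iff)
  qed
  have split: "{-L..L} = {-L..- 1} \<union> ({0} \<union> {1..L})"
    using L0 by auto
  have neg: "(\<Sum>m = -L..- 1. ?g m * ?v m) = (\<Sum>m = 1..L. ?g m * ?v (- m))"
    by (rule sum.reindex_bij_witness[of _ uminus uminus]) (auto simp: reflection_defect_def)
  have "(\<Sum>m\<in>supp ?g. ?g m * ?v m) = (\<Sum>m\<in>{-L..L}. ?g m * ?v m)"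
    by (rule sum_over_supp[OF _ sg]) simp
  also have "\<dots> = (\<Sum>m = -L..- 1. ?g m * ?v m) + (?g 0 * ?v 0 + (\<Sum>m = 1..L. ?g m * ?v m))"
    unfolding split
    by (subst sum.union_disjoint, simp, simp, force, subst sum.union_disjoint) auto
  also have "\<dots> = (\<Sum>m = 1..L. - (d (i + m) * (?v m + ?v (- m))))"
    unfolding neg using V by (simp add: reflection_defect_def algebra_simps flip: sum.distrib)
  finally have rhs: "(\<Sum>m\<in>supp ?g. ?g m * ?v m) = (\<Sum>m = 1..L. - (d (i + m) * (?v m + ?v (- m))))" .
  have "(\<Sum>j\<in>supp d. d j * (w (i + j) - ?v (i + j)))
      = (\<Sum>j\<in>{-L - i..L}. d j * (w (i + j) - ?v (i + j)))"
  proof (rule sum_over_supp)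
    show "supp d \<subseteq> {-L - i..L}" using L i by (force simp: supp_def)
  qed simp
  also have "\<dots> = (\<Sum>j\<in>{-L - i..- 1 - i}. d j * (w (i + j) - ?v (i + j)))"
  proof (rule sum.mono_neutral_right)
    show "\<forall>j\<in>{- L - i..L} - {- L - i..- 1 - i}. d j * (w (i + j) - ?v (i + j)) = 0"
      using w i by auto
  qed (use i L0 in auto)
  also have "\<dots> = (\<Sum>m = 1..L. - (d (i + m) * (?v m + ?v (- m))))"
  proof (rule sum.reindex_bij_witness[of _ "\<lambda>m. - m - i" "\<lambda>j. - j - i"])
    fix j assume j: "j \<in> {- L - i..- 1 - i}"
    have "w (i + j) = - ?v (- j - i)"
      using odd[of "- j - i"] w[of "- j - i"] j i by (simp add: add.commute)
    moreover have "d (i + (- j - i)) = d j" using d[of j] by simp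
    ultimately show "- (d (i + (- j - i)) * (?v (- j - i) + ?v (- (- j - i)))) = d j * (w (i + j) - ?v (i + j))"
      by (simp add: algebra_simps)
  qed auto
  finally show ?thesis using rhs by simp
next
  case False
  then have "d j = 0" for j using L[of j] by force
  then have "d = (\<lambda>_. 0)" by auto
  then show ?thesis by (simp add: supp_def reflection_defect_def)
qed

section \<open>Truncation error\<close>

text \<open>The successive derivatives of \<open>G 0\<close> on \<open>S\<close>. Carrying the whole sequence around avoids iterated
  derivatives of a function that is only defined on an interval.\<close>

definition derivative_sequence :: "real set \<Rightarrow> (nat \<Rightarrow> real \<Rightarrow> complex) \<Rightarrow> bool" where
  "derivative_sequence S G \<longleftrightarrow> (\<forall>m. \<forall>t\<in>S. (G m has_vector_derivative G (Suc m) t) (at t within S))"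

lemma derivative_sequenceD:
  "derivative_sequence S G \<Longrightarrow> t \<in> S \<Longrightarrow> (G m has_vector_derivative G (Suc m) t) (at t within S)"
  unfolding derivative_sequence_def by blast

text \<open>The stencils reach beyond \<open>[0, 1]\<close>, where \<open>u\<close> carries no information. Integrating \<open>- f\<close> twice extends
  \<open>u\<close> smoothly; the interval \<open>[- R, R + 1]\<close> is symmetric about \<open>1 / 2\<close>, so that the reflection
  \<open>x \<mapsto> 1 - x\<close>, which exchanges the two ends, maps it to itself.\<close>

lemma dirichlet_derivative_sequence:
  assumes f: "C_infinity f" and u: "solves_dirichlet f u" and R: "R \<ge> 0"
  shows "\<exists>G. derivative_sequence {-R..R + 1} G \<and> (\<forall>x\<in>{0..1}. G 0 x = u x) \<and> (\<forall>x. G 2 x = - f x)"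
proof -
  let ?S = "{-R..R + 1}"
  have cf: "continuous_on ?S f"
    using vderiv_iter[OF f, of 0]
    by (intro continuous_at_imp_continuous_on ballI) (simp, metis has_vector_derivative_continuous)
  obtain F1 where F1: "\<And>x. x \<in> ?S \<Longrightarrow> (F1 has_vector_derivative f x) (at x within ?S)"
    using antiderivative_continuous[OF cf] by blast
  have "continuous_on ?S F1"
    using F1 by (rule continuous_on_vector_derivative)
  then obtain F2 where F2: "\<And>x. x \<in> ?S \<Longrightarrow> (F2 has_vector_derivative F1 x) (at x within ?S)"
    using antiderivative_continuous by blast
  obtain u' where cu: "continuous_on {0..1} u"
    and u': "\<And>x. x \<in> {0<..<1} \<Longrightarrow> (u has_vector_derivative u' x) (at x)"
            "\<And>x. x \<in> {0<..<1} \<Longrightarrow> (u' has_vector_derivative - f x) (at x)"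
    using u unfolding solves_dirichlet_def by blast
  have S: "{0<..<1} \<subseteq> ?S" "{0..1} \<subseteq> ?S" using R by auto
  have "((\<lambda>x. u' x + F1 x) has_vector_derivative 0) (at x within {0<..<1})" if x: "x \<in> {0<..<1}" for x
  proof -
    have "((\<lambda>x. u' x + F1 x) has_vector_derivative (- f x + f x)) (at x within {0<..<1})"
      using u'(2)[OF x] F1[of x] x S
      by (intro has_vector_derivative_add) (auto intro: has_vector_derivative_at_within has_vector_derivative_within_subset)
    then show ?thesis by simp
  qed
  then obtain c where c: "\<And>x. x \<in> {0<..<1} \<Longrightarrow> u' x + F1 x = c"
    using has_derivative_zero_constant[of "{0<..<1::real}" "\<lambda>x. u' x + F1 x"]
    by (auto simp: has_vector_derivative_def)
  have "((\<lambda>x. u x + F2 x - of_real x * c) has_vector_derivative 0) (at x within {0<..<1})"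
    if x: "x \<in> {0<..<1}" for x
  proof -
    have "((\<lambda>x. of_real x * c) has_vector_derivative 1 * c) (at x within {0<..<1})"
      using has_vector_derivative_of_real[of "\<lambda>x. x" 1 "at x within {0<..<1}"]
      by (intro has_vector_derivative_mult_left) simp
    then have "((\<lambda>x. u x + F2 x - of_real x * c) has_vector_derivative (u' x + F1 x - 1 * c)) (at x within {0<..<1})"
      using u'(1)[OF x] F2[of x] x S
      by (intro has_vector_derivative_add has_vector_derivative_diff)
        (auto intro: has_vector_derivative_at_within has_vector_derivative_within_subset)
    then show ?thesis using c[OF x] by simp
  qed
  then obtain k where k: "\<And>x. x \<in> {0<..<1} \<Longrightarrow> u x + F2 x - of_real x * c = k"
    using has_derivative_zero_constant[of "{0<..<1::real}" "\<lambda>x. u x + F2 x - of_real x * c"]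
    by (auto simp: has_vector_derivative_def)
  have "continuous_on ?S F2"
    using F2 by (rule continuous_on_vector_derivative)
  then have cont: "continuous_on (closure {0<..<1}) (\<lambda>x. u x + F2 x - of_real x * c)"
    using cu S(2) by (auto intro!: continuous_intros intro: continuous_on_subset)
  have k': "u x + F2 x - of_real x * c = k" if "x \<in> {0..1}" for x
    using continuous_constant_on_closure[OF cont k] that by simp
  define G where "G m = (case m of 0 \<Rightarrow> (\<lambda>x. k + of_real x * c - F2 x) | Suc 0 \<Rightarrow> (\<lambda>x. c - F1 x)
      | Suc (Suc m) \<Rightarrow> (\<lambda>x. - (vderiv ^^ m) f x))" for m
  show ?thesis
  proof (intro exI[of _ G] conjI allI ballI)
    have "(G m has_vector_derivative G (Suc m) t) (at t within ?S)" if t: "t \<in> ?S" for m t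
    proof -
      consider "m = 0" | "m = 1" | q where "m = Suc (Suc q)"
        by (metis One_nat_def not0_implies_Suc)
      then show ?thesis
      proof cases
        case 1
        have "((\<lambda>x. of_real x * c) has_vector_derivative 1 * c) (at t within ?S)"
          using has_vector_derivative_of_real[of "\<lambda>x. x" 1 "at t within ?S"]
          by (intro has_vector_derivative_mult_left) simp
        then have "((\<lambda>x. k + of_real x * c - F2 x) has_vector_derivative 0 + 1 * c - F1 t) (at t within ?S)"
          using F2[OF t] by (intro has_vector_derivative_add has_vector_derivative_diff has_vector_derivative_const)
        then show ?thesis using 1 by (simp add: G_def)
      next
        case 2
        have "((\<lambda>x. c - F1 x) has_vector_derivative 0 - f t) (at t within ?S)"
          using F1[OF t] by (intro has_vector_derivative_diff has_vector_derivative_const)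
        then show ?thesis using 2 by (simp add: G_def)
      next
        case 3
        have "((vderiv ^^ q) f has_vector_derivative (vderiv ^^ Suc q) f t) (at t within ?S)"
          using vderiv_iter[OF f] by (rule has_vector_derivative_at_within)
        then show ?thesis using 3 by (auto simp: G_def dest: has_vector_derivative_minus)
      qed
    qed
    then show "derivative_sequence ?S G"
      unfolding derivative_sequence_def by blast
    fix x :: real assume "x \<in> {0..1}"
    then show "G 0 x = u x"
      using k'[of x] by (simp add: G_def algebra_simps)
  next
    fix x
    show "G 2 x = - f x"
      by (simp add: G_def numeral_2_eq_2)
  qed
qed

lemma derivative_sequence_bounded:
  fixes G :: "nat \<Rightarrow> real \<Rightarrow> complex"
  assumes "derivative_sequence {a..b} G"
  obtains M where "M \<ge> 0" "\<And>t. t \<in> {a..b} \<Longrightarrow> cmod (G m t) \<le> M"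
proof -
  have "continuous_on {a..b} (G m)"
    using derivative_sequenceD[OF assms] by (rule continuous_on_vector_derivative)
  then have "bounded (G m ` {a..b})"
    using compact_continuous_image compact_imp_bounded by blast
  then obtain M where "M > 0" "\<forall>t\<in>{a..b}. cmod (G m t) \<le> M"
    unfolding bounded_pos by auto
  then show thesis by (intro that[of M]) auto
qed

lemma mesh_bounds: "0 < mesh N" "mesh N \<le> 1" "(real N + 1) * mesh N = 1"
  by (simp_all add: mesh_def)

lemma grid_reflect: "grid N (int N + 1 - j) = 1 - grid N j"
  using mesh_bounds(3)[of N] by (simp add: grid_def algebra_simps)

lemma derivative_sequence_mirror:
  fixes G :: "nat \<Rightarrow> real \<Rightarrow> complex"
  assumes "derivative_sequence {-R..R + 1} G"
  shows "derivative_sequence {-R..R + 1} (\<lambda>m x. (- 1) ^ m * G m (1 - x))"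
  unfolding derivative_sequence_def
proof (intro allI ballI)
  fix m t assume t: "t \<in> {-R..R + 1}"
  let ?S = "{-R..R + 1}"
  have "((\<lambda>x. 1 - x) has_real_derivative 0 - 1) (at t within ?S)"
    by (intro DERIV_diff DERIV_const DERIV_ident)
  then have 1: "((\<lambda>x. 1 - x) has_vector_derivative - 1) (at t within ?S)"
    by (simp add: has_real_derivative_iff_has_vector_derivative)
  have im: "(\<lambda>x. 1 - x) ` ?S \<subseteq> ?S" by auto
  have "1 - t \<in> ?S" using t by auto
  from has_vector_derivative_within_subset[OF derivative_sequenceD[OF assms this] im]
  have "((G m \<circ> (\<lambda>x. 1 - x)) has_vector_derivative (- 1) *\<^sub>R G (Suc m) (1 - t)) (at t within ?S)"
    by (rule vector_diff_chain_within[OF 1])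
  then have "((\<lambda>x. (- 1) ^ m * G m (1 - x)) has_vector_derivative (- 1) ^ m * ((- 1) *\<^sub>R G (Suc m) (1 - t))) (at t within ?S)"
    by (intro has_vector_derivative_mult_right) (simp add: o_def)
  then show "((\<lambda>x. (- 1) ^ m * G m (1 - x)) has_vector_derivative (- 1) ^ Suc m * G (Suc m) (1 - t)) (at t within ?S)"
    by simp
qed

text \<open>The correction by \<open>b i\<close> cancels the reflection defect up to order \<open>2 q + 2\<close>. The second end point is
  covered by the same estimate, applied to the mirrored solution.\<close>

lemma boundary_row_error:
  fixes V :: "nat \<Rightarrow> real \<Rightarrow> complex"
  assumes d: "d \<in> C_formulas K l" and R: "real (l + 1 + q) \<le> R"
    and deriv: "derivative_sequence {-R..R + 1} V"
    and i: "1 \<le> i"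
  shows "\<exists>C\<ge>0. \<forall>h\<in>{0..1}.
    cmod ((\<Sum>m\<in>supp (reflection_defect d i). reflection_defect d i m * V 0 (of_int m * h))
      + (of_real h)\<^sup>2 * (\<Sum>j\<in>supp (boundary_formula (2 * q) d i).
           boundary_formula (2 * q) d i j * V 2 (of_int j * h))) \<le> C * h ^ (2 * q + 2)"
proof -
  let ?g = "reflection_defect d i" and ?b = "boundary_formula (2 * q) d i"
  have L: "j \<le> int l + 1" if "d j \<noteq> 0" for j
    using C_formulasD(3)[OF d that] by simp
  note g = reflection_defect_moments[of d "int l + 1" i, OF L]
  note b = boundary_formula_matches[of d "int l + 1" i q, OF L]
  obtain M where M0: "M \<ge> 0" and M: "\<And>t. t \<in> {-R..R + 1} \<Longrightarrow> cmod (V (2 * q + 2) t) \<le> M"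
    using derivative_sequence_bounded[OF deriv] by blast
  let ?C = "(\<Sum>m\<in>supp ?g. cmod (?g m) * \<bar>of_int m\<bar> ^ (2 * q + 2))
    + (\<Sum>j\<in>supp ?b. cmod (?b j) * \<bar>of_int j\<bar> ^ (2 * q + 2 - 2))"
  have R0: "R \<ge> 0" using R by linarith
  have near: "\<bar>real_of_int j\<bar> \<le> R" if "j \<in> supp ?g \<union> supp ?b" for j
  proof -
    have "\<bar>j\<bar> \<le> int (l + 1 + q)"
      using that
    proof
      assume "j \<in> supp ?g"
      then have "?g j \<noteq> 0" "?g (- j) \<noteq> 0" by (auto simp: supp_def reflection_defect_def)
      then have "j \<le> int l + 1" "- j \<le> int l + 1"
        using g(2) i by auto
      then show ?thesis by simp
    next
      assume "j \<in> supp ?b"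
      then have "\<bar>j\<bar> \<le> int q"
        using supp_short_formula b(1,2) i by simp
      then show ?thesis by simp
    qed
    then have "real_of_int \<bar>j\<bar> \<le> real_of_int (int (l + 1 + q))" by (simp only: of_int_le_iff)
    then show ?thesis using R by simp
  qed
  have com: "M * x * ?C = M * ?C * x" for x by (simp only: mult_ac)
  have bound: "cmod ((\<Sum>m\<in>supp ?g. ?g m * V 0 (0 + of_int m * h))
      + (of_real h)\<^sup>2 * (\<Sum>j\<in>supp ?b. ?b j * V 2 (0 + of_int j * h)))
      \<le> M * h ^ (2 * q + 2) * ?C" if h: "h \<in> {0..1}" for h
  proof (rule stencil_error[of "{-R..R + 1}"])
    show "moment ?g m + of_nat (m * (m - 1)) * moment ?b (m - 2) = 0" if "m < 2 * q + 2" for m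
      using moments_vanish[OF g(1) b(1) g(3) b(3) that] i by simp
    show "0 + of_int j * h \<in> {- R..R + 1}" if j: "j \<in> supp ?g \<union> supp ?b" for j
    proof -
      have "\<bar>of_int j * h\<bar> \<le> R * 1"
        unfolding abs_mult using near[OF j] h R0 by (intro mult_mono) auto
      then show ?thesis by auto
    qed
  qed (use h M R0 derivative_sequenceD[OF deriv] in auto)
  have "cmod ((\<Sum>m\<in>supp ?g. ?g m * V 0 (of_int m * h))
      + (of_real h)\<^sup>2 * (\<Sum>j\<in>supp ?b. ?b j * V 2 (of_int j * h)))
      \<le> (M * ?C) * h ^ (2 * q + 2)" if "h \<in> {0..1}" for h
    using bound[OF that] unfolding com by (simp only: add_0_left)
  moreover have "M * ?C \<ge> 0"
    using M0 by (intro mult_nonneg_nonneg add_nonneg_nonneg sum_nonneg) auto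
  ultimately show ?thesis by blast
qed

lemma inner_row_error:
  fixes G :: "nat \<Rightarrow> real \<Rightarrow> complex"
  assumes d: "d \<in> C_formulas K l" and R: "real (l + 1 + p) \<le> R" and p: "p \<ge> 1"
    and deriv: "derivative_sequence {-R..R + 1} G"
  shows "\<exists>C\<ge>0. \<forall>h\<in>{0..1}. \<forall>a\<in>{0..1}.
    cmod ((\<Sum>j\<in>supp d. d j * G 0 (a + of_int j * h))
      + (of_real h)\<^sup>2 * (\<Sum>j\<in>supp (inner_formula (2 * p) d).
           inner_formula (2 * p) d j * G 2 (a + of_int j * h))) \<le> C * h ^ (2 * p + 2)"
proof -
  let ?s = "inner_formula (2 * p) d"
  note dd = C_formulasD[OF d]
  note s = inner_formula_matches[OF dd(1,2), of p]
  obtain M where M0: "M \<ge> 0" and M: "\<And>t. t \<in> {-R..R + 1} \<Longrightarrow> cmod (G (2 * p + 2) t) \<le> M"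
    using derivative_sequence_bounded[OF deriv] by blast
  let ?C = "(\<Sum>m\<in>supp d. cmod (d m) * \<bar>of_int m\<bar> ^ (2 * p + 2))
    + (\<Sum>j\<in>supp ?s. cmod (?s j) * \<bar>of_int j\<bar> ^ (2 * p + 2 - 2))"
  have R0: "R \<ge> 0" using R by linarith
  have near: "\<bar>real_of_int j\<bar> \<le> R" if "j \<in> supp d \<union> supp ?s" for j
  proof -
    have "\<bar>j\<bar> \<le> int (l + 1 + p)"
      using that dd(3)[of j] supp_short_formula[OF s(1,2), of j] by (auto simp: supp_def)
    then have "real_of_int \<bar>j\<bar> \<le> real_of_int (int (l + 1 + p))" by (simp only: of_int_le_iff)
    then show ?thesis using R by simp
  qed
  have com: "M * x * ?C = M * ?C * x" for x by (simp only: mult_ac)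
  have bound: "cmod ((\<Sum>j\<in>supp d. d j * G 0 (a + of_int j * h))
      + (of_real h)\<^sup>2 * (\<Sum>j\<in>supp ?s. ?s j * G 2 (a + of_int j * h)))
      \<le> M * h ^ (2 * p + 2) * ?C" if h: "h \<in> {0..1}" and a: "a \<in> {0..1}" for h a
  proof (rule stencil_error[of "{-R..R + 1}"])
    show "moment d m + of_nat (m * (m - 1)) * moment ?s (m - 2) = 0" if "m < 2 * p + 2" for m
      using moments_vanish[OF dd(1) s(1) dd(2) s(3) that] .
    show "a + of_int j * h \<in> {- R..R + 1}" if j: "j \<in> supp d \<union> supp ?s" for j
    proof -
      have "\<bar>of_int j * h\<bar> \<le> R * 1"
        unfolding abs_mult using near[OF j] h R0 by (intro mult_mono) auto
      then show ?thesis using a by auto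
    qed
  qed (use h a M R0 derivative_sequenceD[OF deriv] in auto)
  have "cmod ((\<Sum>j\<in>supp d. d j * G 0 (a + of_int j * h))
      + (of_real h)\<^sup>2 * (\<Sum>j\<in>supp ?s. ?s j * G 2 (a + of_int j * h)))
      \<le> (M * ?C) * h ^ (2 * p + 2)" if "h \<in> {0..1}" "a \<in> {0..1}" for h a
    using bound that unfolding com by blast
  moreover have "M * ?C \<ge> 0"
    using M0 by (intro mult_nonneg_nonneg add_nonneg_nonneg sum_nonneg) auto
  ultimately show ?thesis by blast
qed

lemma uniform_boundary_row_error:
  fixes V :: "nat \<Rightarrow> real \<Rightarrow> complex"
  assumes d: "d \<in> C_formulas K l" and R: "real (l + 1 + q) \<le> R"
    and deriv: "derivative_sequence {-R..R + 1} V"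
  shows "\<exists>C\<ge>0. \<forall>i\<in>{1..int l}. \<forall>h\<in>{0..1}.
    cmod ((\<Sum>m\<in>supp (reflection_defect d i). reflection_defect d i m * V 0 (of_int m * h))
      + (of_real h)\<^sup>2 * (\<Sum>j\<in>supp (boundary_formula (2 * q) d i).
           boundary_formula (2 * q) d i j * V 2 (of_int j * h))) \<le> C * h ^ (2 * q + 2)"
proof -
  define E where "E i h = cmod ((\<Sum>m\<in>supp (reflection_defect d i). reflection_defect d i m * V 0 (of_int m * h))
      + (of_real h)\<^sup>2 * (\<Sum>j\<in>supp (boundary_formula (2 * q) d i).
           boundary_formula (2 * q) d i j * V 2 (of_int j * h)))" for i h
  define P where "P = 2 * q + 2"
  have "\<forall>i\<in>{1..int l}. \<exists>C\<ge>0. \<forall>h\<in>{0..1}. E i h \<le> C * h ^ P"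
    unfolding E_def P_def
    by (intro ballI boundary_row_error[OF d R deriv]) simp
  then have "\<exists>C. \<forall>i\<in>{1..int l}. C i \<ge> 0 \<and> (\<forall>h\<in>{0..1}. E i h \<le> C i * h ^ P)"
    by (rule bchoice)
  then obtain C where C: "\<And>i. i \<in> {1..int l} \<Longrightarrow> C i \<ge> 0"
    "\<And>i h. i \<in> {1..int l} \<Longrightarrow> h \<in> {0..1} \<Longrightarrow> E i h \<le> C i * h ^ P"
    by blast
  show ?thesis
    unfolding E_def[symmetric] P_def[symmetric]
  proof (intro exI[of _ "\<Sum>i=1..int l. C i"] conjI ballI)
    show "0 \<le> (\<Sum>i=1..int l. C i)" using C(1) by (intro sum_nonneg) auto
    fix i h assume i: "i \<in> {1..int l}" and h: "h \<in> {0..1::real}"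
    have "C i \<le> (\<Sum>i=1..int l. C i)"
      using i C(1) by (intro member_le_sum) auto
    then have "C i * h ^ P \<le> (\<Sum>i=1..int l. C i) * h ^ P"
      using h by (intro mult_right_mono) auto
    then show "E i h \<le> (\<Sum>i=1..int l. C i) * h ^ P"
      using C(2)[OF i h] by linarith
  qed
qed

definition residual :: "nat \<Rightarrow> nat \<Rightarrow> nat \<Rightarrow> (int \<Rightarrow> complex) \<Rightarrow> nat \<Rightarrow> (real \<Rightarrow> complex) \<Rightarrow> (int \<Rightarrow> complex) \<Rightarrow> int \<Rightarrow> complex" where
  "residual l n \<mu> d N f w i =
     conv d w i - (of_real (mesh N))\<^sup>2 * S_row l n \<mu> d N (\<lambda>j. f (grid N j)) i"

text \<open>A row splits into the consistency error of \<open>(d, s)\<close> for the smooth extension of \<open>u\<close> and, in the rows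
  whose stencil leaves the interval, the reflection defect corrected by \<open>b i\<close>. For \<open>N \<ge> 2 * l\<close> no
  row is close to both ends.\<close>

lemma truncation_error:
  assumes d: "d \<in> C_formulas K l" and p: "p \<ge> 1"
    and f: "C_infinity f" and u: "solves_dirichlet f u"
  shows "\<exists>C\<ge>0. \<forall>N\<ge>2 * l. \<forall>w\<in>E_space N. (\<forall>j\<in>{1..int N}. w j = u (grid N j)) \<longrightarrow>
     (\<forall>i\<in>{1..int N}. cmod (residual l (2 * p) (2 * q) d N f w i) \<le> C * mesh N ^ (2 * p + 2)
        + of_bool (i \<le> int l \<or> i \<ge> int N + 1 - int l) * (C * mesh N ^ (2 * q + 2)))"
proof -
  define R where "R = real (l + 1 + p + q)"
  have R: "R \<ge> 0" "real (l + 1 + p) \<le> R" "real (l + 1 + q) \<le> R" by (simp_all add: R_def)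
  let ?S = "{-R..R + 1}"
  from dirichlet_derivative_sequence[OF f u R(1)] obtain G where G: "derivative_sequence ?S G"
    and Gu': "\<forall>x\<in>{0..1}. G 0 x = u x" and Gf': "\<forall>x. G 2 x = - f x"
    by (elim exE conjE)
  have Gu: "G 0 x = u x" if "x \<in> {0..1}" for x using Gu' that by (rule bspec)
  have Gf: "G 2 x = - f x" for x using Gf' by (rule spec)
  define H where "H = (\<lambda>m x. (- 1) ^ m * G m (1 - x))"
  have H: "derivative_sequence ?S H"
    using derivative_sequence_mirror[OF G] unfolding H_def .
  from inner_row_error[where G = G, OF d R(2) p G] obtain C0
    where C0: "C0 \<ge> 0" and inner: "\<forall>h\<in>{0..1}. \<forall>a\<in>{0..1}.
    cmod ((\<Sum>j\<in>supp d. d j * G 0 (a + of_int j * h))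
      + (of_real h)\<^sup>2 * (\<Sum>j\<in>supp (inner_formula (2 * p) d).
           inner_formula (2 * p) d j * G 2 (a + of_int j * h))) \<le> C0 * h ^ (2 * p + 2)"
    by (elim exE conjE)
  from uniform_boundary_row_error[where V = G, OF d R(3) G] obtain C1
    where C1: "C1 \<ge> 0" and left: "\<forall>i\<in>{1..int l}. \<forall>h\<in>{0..1}.
    cmod ((\<Sum>m\<in>supp (reflection_defect d i). reflection_defect d i m * G 0 (of_int m * h))
      + (of_real h)\<^sup>2 * (\<Sum>j\<in>supp (boundary_formula (2 * q) d i).
           boundary_formula (2 * q) d i j * G 2 (of_int j * h))) \<le> C1 * h ^ (2 * q + 2)"
    by (elim exE conjE)
  from uniform_boundary_row_error[where V = H, OF d R(3) H] obtain C2
    where C2: "C2 \<ge> 0" and right: "\<forall>i\<in>{1..int l}. \<forall>h\<in>{0..1}.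
    cmod ((\<Sum>m\<in>supp (reflection_defect d i). reflection_defect d i m * H 0 (of_int m * h))
      + (of_real h)\<^sup>2 * (\<Sum>j\<in>supp (boundary_formula (2 * q) d i).
           boundary_formula (2 * q) d i j * H 2 (of_int j * h))) \<le> C2 * h ^ (2 * q + 2)"
    by (elim exE conjE)
  have U: "G 0 0 = 0" "H 0 0 = 0"
    using u Gu[of 0] Gu[of 1] by (simp_all add: H_def solves_dirichlet_def)
  have dsym: "d (- j) = d j" for j
    using sym_formulasD(2)[OF C_formulasD(1)[OF d]] .
  show ?thesis
  proof (intro exI[of _ "C0 + C1 + C2"] conjI allI ballI impI)
    show "0 \<le> C0 + C1 + C2" using C0 C1 C2 by simp
    fix N w i
    assume N: "2 * l \<le> N" and w: "w \<in> E_space N" and wu: "\<forall>j\<in>{1..int N}. w j = u (grid N j)"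
      and i: "i \<in> {1..int N}"
    let ?h = "mesh N" and ?s = "inner_formula (2 * p) d" and ?b = "boundary_formula (2 * q) d"
    let ?a = "of_int i * ?h"
    have h: "?h \<in> {0..1}" using mesh_bounds[of N] by simp
    have grid01: "grid N j \<in> {0..1}" if "0 \<le> j" "j \<le> int N + 1" for j
    proof -
      have "of_int j * ?h \<le> (real N + 1) * ?h"
        using that mesh_bounds(1)[of N] by (intro mult_right_mono) auto
      then show ?thesis using that mesh_bounds[of N] by (simp add: grid_def)
    qed
    have odd: "w (- j) = - w j" "w (int N + 1 + j) = - w (int N + 1 - j)" for j
      using w unfolding E_space_def by auto
    have w0: "w 0 = 0" "w (int N + 1) = 0"
      using odd(1)[of 0] odd(2)[of 0] by (simp_all add: eq_neg_iff_add_eq_0)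
    have "u (grid N 0) = 0" "u (grid N (int N + 1)) = 0"
      using u grid_reflect[of N 0] by (simp_all add: solves_dirichlet_def grid_def)
    note ends = w0 this
    have wG: "w j = G 0 (of_int j * ?h)" if "0 \<le> j" "j \<le> int N + 1" for j
    proof -
      consider "j = 0" | "j = int N + 1" | "j \<in> {1..int N}" using \<open>0 \<le> j\<close> \<open>j \<le> int N + 1\<close> by fastforce
      then have "w j = u (grid N j)"
        using wu ends by cases simp_all
      then show ?thesis using Gu[OF grid01[OF that]] by (simp add: grid_def)
    qed
    \<comment> \<open>The sequence seen from the right end; there the left-hand estimates apply.\<close>
    define w' where "w' j = w (int N + 1 - j)" for j
    have mirror: "of_int (int N + 1 - j) * ?h = 1 - of_int j * ?h" for j
      using grid_reflect[of N j] by (simp add: grid_def)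
    have w'H: "w' j = H 0 (of_int j * ?h)" if "0 \<le> j" "j \<le> int N + 1" for j
      using wG[of "int N + 1 - j"] that mirror[of j] by (simp add: w'_def H_def)
    have w'odd: "w' (- j) = - w' j" for j
      using odd(2)[of j] by (simp add: w'_def)
    define I where "I = (\<Sum>j\<in>supp d. d j * G 0 (?a + of_int j * ?h))
      + (of_real ?h)\<^sup>2 * (\<Sum>j\<in>supp ?s. ?s j * G 2 (?a + of_int j * ?h))"
    define \<Delta> where "\<Delta> = (\<Sum>j\<in>supp d. d j * (w (i + j) - G 0 (of_int (i + j) * ?h)))"
    have I: "cmod I \<le> C0 * ?h ^ (2 * p + 2)"
      unfolding I_def using grid01[of i] i
      by (intro inner[THEN bspec, THEN bspec] h) (simp add: grid_def)
    have "(\<Sum>j | ?s (j - i) \<noteq> 0. ?s (j - i) * f (grid N j))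
        = (\<Sum>m\<in>supp ?s. ?s m * f (?a + of_int m * ?h))"
      by (rule sum.reindex_bij_witness[of _ "\<lambda>m. m + i" "\<lambda>j. j - i"])
        (auto simp: supp_def grid_def algebra_simps)
    then have sum_s: "(\<Sum>j | ?s (j - i) \<noteq> 0. ?s (j - i) * f (grid N j))
        = - (\<Sum>m\<in>supp ?s. ?s m * G 2 (?a + of_int m * ?h))"
      by (simp add: Gf sum_negf)
    have conv: "conv d w i = (\<Sum>j\<in>supp d. d j * G 0 (?a + of_int j * ?h)) + \<Delta>"
      unfolding conv_flip[of d, OF dsym] \<Delta>_def
      by (simp add: distrib_right right_diff_distrib sum_subtractf)
    let ?left = "of_bool (i \<le> int l) * (\<Sum>j\<in>supp (?b i). ?b i j * f (grid N j))"
    let ?right = "of_bool (i \<ge> int N + 1 - int l)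
      * (\<Sum>j\<in>supp (?b (int N + 1 - i)). ?b (int N + 1 - i) j * f (grid N (int N + 1 - j)))"
    have res: "residual l (2 * p) (2 * q) d N f w i
        = I + (\<Delta> - (of_real ?h)\<^sup>2 * (?left + ?right))"
      unfolding residual_def S_row_def Let_def conv sum_s I_def by (simp add: algebra_simps)
    have bound: "cmod (\<Delta> - (of_real ?h)\<^sup>2 * (?left + ?right))
       \<le> of_bool (i \<le> int l \<or> i \<ge> int N + 1 - int l) * ((C0 + C1 + C2) * ?h ^ (2 * q + 2))"
    proof -
      have up: "C1 * ?h ^ (2 * q + 2) \<le> (C0 + C1 + C2) * ?h ^ (2 * q + 2)"
        "C2 * ?h ^ (2 * q + 2) \<le> (C0 + C1 + C2) * ?h ^ (2 * q + 2)"
        using C0 C1 C2 h by (intro mult_right_mono; simp)+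
      consider "i \<le> int l" "i < int N + 1 - int l" | "i \<ge> int N + 1 - int l" "i > int l"
        | "i > int l" "i < int N + 1 - int l"
        using N by linarith
      then show ?thesis
      proof cases
        case 1
        have "\<Delta> = (\<Sum>m\<in>supp (reflection_defect d i). reflection_defect d i m * G 0 (of_int m * ?h))"
          unfolding \<Delta>_def
          by (rule odd_reflection_defect[where d = d and w = w and V = "G 0" and h = ?h
                and L = "int l + 1" and J = "int N + 1", OF dsym C_formulasD(3)[OF d] odd(1) wG U(1)])
            (use i 1 N in simp_all)
        then have eq: "\<Delta> - (of_real ?h)\<^sup>2 * (?left + ?right)
            = (\<Sum>m\<in>supp (reflection_defect d i). reflection_defect d i m * G 0 (of_int m * ?h))
              + (of_real ?h)\<^sup>2 * (\<Sum>j\<in>supp (?b i). ?b i j * G 2 (of_int j * ?h))"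
          using 1 by (simp add: Gf grid_def sum_negf)
        have "i \<in> {1..int l}" using i 1 by simp
        from left[THEN bspec, THEN bspec, OF this h] have "cmod (\<Delta> - (of_real ?h)\<^sup>2 * (?left + ?right)) \<le> C1 * ?h ^ (2 * q + 2)"
          unfolding eq .
        also note up(1)
        also have "(C0 + C1 + C2) * ?h ^ (2 * q + 2)
            = of_bool (i \<le> int l \<or> i \<ge> int N + 1 - int l) * ((C0 + C1 + C2) * ?h ^ (2 * q + 2))"
          using 1 by simp
        finally show ?thesis .
      next
        case 2
        let ?k = "int N + 1 - i"
        have k: "?k \<in> {1..int l}" using 2 i by auto
        have "\<Delta> = (\<Sum>j\<in>supp d. d j * (w (i - j) - G 0 (of_int (i - j) * ?h)))"
          unfolding \<Delta>_def
          by (rule sum.reindex_bij_witness[of _ uminus uminus]) (auto simp: supp_def dsym)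
        also have "\<dots> = (\<Sum>j\<in>supp d. d j * (w' (?k + j) - H 0 (of_int (?k + j) * ?h)))"
        proof (rule sum.cong[OF refl])
          fix j
          have "of_int (i - j) * ?h = 1 - of_int (?k + j) * ?h"
            using mirror[of "?k + j"] by (simp add: algebra_simps)
          then show "d j * (w (i - j) - G 0 (of_int (i - j) * ?h))
              = d j * (w' (?k + j) - H 0 (of_int (?k + j) * ?h))"
            by (simp add: w'_def H_def)
        qed
        also have "\<dots> = (\<Sum>m\<in>supp (reflection_defect d ?k). reflection_defect d ?k m * H 0 (of_int m * ?h))"
          by (rule odd_reflection_defect[where d = d and w = w' and V = "H 0" and h = ?h
                and L = "int l + 1" and J = "int N + 1", OF dsym C_formulasD(3)[OF d] w'odd w'H U(2)])
            (use i 2 N in simp_all)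
        finally have \<Delta>: "\<Delta> = (\<Sum>m\<in>supp (reflection_defect d ?k). reflection_defect d ?k m * H 0 (of_int m * ?h))" .
        have "f (grid N (int N + 1 - j)) = - H 2 (of_int j * ?h)" for j
          using mirror[of j] by (simp add: H_def Gf grid_def)
        then have eq: "\<Delta> - (of_real ?h)\<^sup>2 * (?left + ?right)
            = (\<Sum>m\<in>supp (reflection_defect d ?k). reflection_defect d ?k m * H 0 (of_int m * ?h))
              + (of_real ?h)\<^sup>2 * (\<Sum>j\<in>supp (?b ?k). ?b ?k j * H 2 (of_int j * ?h))"
          using 2 \<Delta> by (simp add: sum_negf)
        from right[THEN bspec, THEN bspec, OF k h] have "cmod (\<Delta> - (of_real ?h)\<^sup>2 * (?left + ?right)) \<le> C2 * ?h ^ (2 * q + 2)"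
          unfolding eq .
        also note up(2)
        also have "(C0 + C1 + C2) * ?h ^ (2 * q + 2)
            = of_bool (i \<le> int l \<or> i \<ge> int N + 1 - int l) * ((C0 + C1 + C2) * ?h ^ (2 * q + 2))"
          using 2 by simp
        finally show ?thesis .
      next
        case 3
        have "\<Delta> = 0"
          unfolding \<Delta>_def
        proof (rule sum.neutral, rule ballI)
          fix j assume "j \<in> supp d"
          then have "\<bar>j\<bar> \<le> int l + 1" using C_formulasD(3)[OF d] by (simp add: supp_def)
          then show "d j * (w (i + j) - G 0 (of_int (i + j) * ?h)) = 0"
            using wG[of "i + j"] 3 by simp
        qed
        then show ?thesis using 3 by simp
      qed
    qed
    have "C0 * ?h ^ (2 * p + 2) \<le> (C0 + C1 + C2) * ?h ^ (2 * p + 2)"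
      using C1 C2 h by (intro mult_right_mono) auto
    then have "cmod I \<le> (C0 + C1 + C2) * ?h ^ (2 * p + 2)" using I by linarith
    then show "cmod (residual l (2 * p) (2 * q) d N f w i) \<le> (C0 + C1 + C2) * ?h ^ (2 * p + 2)
        + of_bool (i \<le> int l \<or> i \<ge> int N + 1 - int l) * ((C0 + C1 + C2) * ?h ^ (2 * q + 2))"
      unfolding res using bound by (intro norm_triangle_le add_mono)
  qed
qed

section \<open>Eigenvalues of the matrices\<close>

text \<open>\<open>fejer k\<close> evaluated at \<open>cos a\<close> is the Fejer kernel \<open>(sin (k a / 2) / sin (a / 2))\<^sup>2\<close>. The recurrence
  is that of the Chebyshev polynomials, up to the constant \<open>2\<close>.\<close>

fun fejer :: "nat \<Rightarrow> real poly" where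
  "fejer 0 = 0"
| "fejer (Suc 0) = 1"
| "fejer (Suc (Suc k)) = [:0, 2:] * fejer (Suc k) - fejer k + 2"

lemma fejer_cos: "(1 - cos a) * poly (fejer k) (cos a) = 1 - cos (real k * a)"
proof (induction k rule: fejer.induct)
  case (3 k)
  have "cos (real (Suc (Suc k)) * a) + cos (real k * a) = 2 * cos a * cos (real (Suc k) * a)"
    using cos_add[of "real (Suc k) * a" a] cos_diff[of "real (Suc k) * a" a] by (simp add: algebra_simps)
  moreover have "(1 - cos a) * poly (fejer (Suc (Suc k))) (cos a)
      = 2 * cos a * ((1 - cos a) * poly (fejer (Suc k)) (cos a)) - (1 - cos a) * poly (fejer k) (cos a)
        + 2 * (1 - cos a)"
    by (simp add: algebra_simps)
  ultimately show ?case
    unfolding 3 by (simp add: algebra_simps)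
qed simp_all

text \<open>The eigenvalue divided by the factor \<open>- 2 (1 - cos a)\<close>, as a polynomial in \<open>t = cos a\<close>. Since
  \<open>fejer 1 = 1\<close>, the coordinate \<open>x 1\<close> enters only as an additive constant.\<close>

definition reduced_symbol :: "nat \<Rightarrow> (nat \<Rightarrow> complex) \<Rightarrow> real \<Rightarrow> complex" where
  "reduced_symbol l x t = (\<Sum>k = 1..l + 1. x k * of_real (poly (fejer k) t))"

definition eigenvalue :: "nat \<Rightarrow> (nat \<Rightarrow> complex) \<Rightarrow> real \<Rightarrow> complex" where
  "eigenvalue l x a = - 2 * of_real (1 - cos a) * reduced_symbol l x (cos a)"

text \<open>Averaging the convolution over \<open>j\<close> and \<open>- j\<close> turns the shifted sines into \<open>cos (a j) * sin (a i)\<close>. The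
  constraint \<open>\<Sum>j. d j = 0\<close> then replaces \<open>cos (k a)\<close> by \<open>cos (k a) - 1\<close>, and the factor \<open>1 - cos a\<close> splits off.\<close>

lemma conv_sine:
  "conv (formula_of_coords l x) (\<lambda>m. of_real (sin (a * of_int m))) i
    = eigenvalue l x a * of_real (sin (a * of_int i))"
proof -
  let ?d = "formula_of_coords l x" and ?w = "\<lambda>m::int. complex_of_real (sin (a * of_int m))"
  have d: "?d \<in> C_formulas UNIV l" by (rule formula_of_coords_in) auto
  have sym: "?d (- j) = ?d j" for j
    using sym_formulasD(2)[OF C_formulasD(1)[OF d]] .
  have "conv ?d ?w i + conv ?d ?w i = (\<Sum>j\<in>supp ?d. ?d j * (?w (i - j) + ?w (i + j)))"
    unfolding distrib_left sum.distrib using conv_flip[of ?d ?w i, OF sym] by (simp add: conv_def)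
  also have "\<dots> = (\<Sum>j\<in>supp ?d. 2 * (?d j * of_real (cos (a * of_int j)) * ?w i))"
  proof (rule sum.cong[OF refl])
    fix j
    have "sin (a * of_int (i - j)) + sin (a * of_int (i + j)) = 2 * (cos (a * of_int j) * sin (a * of_int i))"
      by (simp add: distrib_left right_diff_distrib sin_add sin_diff)
    then have "?w (i - j) + ?w (i + j) = 2 * (of_real (cos (a * of_int j)) * ?w i)"
      by (metis of_real_add of_real_mult of_real_numeral)
    then show "?d j * (?w (i - j) + ?w (i + j)) = 2 * (?d j * of_real (cos (a * of_int j)) * ?w i)"
      by simp
  qed
  also have "\<dots> = 2 * ((\<Sum>j\<in>supp ?d. ?d j * of_real (cos (a * of_int j))) * ?w i)"
    by (simp add: sum_distrib_left sum_distrib_right)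
  finally have "conv ?d ?w i = (\<Sum>j\<in>supp ?d. ?d j * of_real (cos (a * of_int j))) * ?w i"
    by simp
  also have "(\<Sum>j\<in>supp ?d. ?d j * complex_of_real (cos (a * of_int j)))
      = ?d 0 * of_real (cos (a * of_int 0)) + 2 * (\<Sum>j = 1..int l + 1. ?d j * of_real (cos (a * of_int j)))"
    using C_formulasD(3)[OF d] by (intro sum_even_formula) (simp_all add: sym abs_le_iff)
  also have "(\<Sum>j = 1..int l + 1. ?d j * complex_of_real (cos (a * of_int j)))
      = (\<Sum>k = 1..l + 1. x k * of_real (cos (real k * a)))"
    by (rule sum.reindex_bij_witness[of _ int nat]) (auto simp: formula_of_coords_def mult.commute)
  also have "?d 0 * of_real (cos (a * of_int 0)) + 2 * (\<Sum>k = 1..l + 1. x k * of_real (cos (real k * a)))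
      = (\<Sum>k = 1..l + 1. - 2 * (x k * of_real (1 - cos (real k * a))))"
    unfolding sum_distrib_left[symmetric]
    by (simp add: formula_of_coords_def right_diff_distrib sum_subtractf)
  also have "\<dots> = eigenvalue l x a"
    unfolding eigenvalue_def reduced_symbol_def fejer_cos[symmetric] sum_distrib_left
    by (rule sum.cong[OF refl]) (simp only: of_real_mult mult_ac)
  finally show ?thesis .
qed

definition freq :: "nat \<Rightarrow> nat \<Rightarrow> real" where
  "freq N k = real k * pi / (real N + 1)"

lemma freq_bounds:
  assumes "k \<in> {1..N}"
  shows "0 < freq N k" "freq N k < pi" "cos (freq N k) < 1"
proof -
  show 0: "0 < freq N k" "freq N k < pi"
    using assms mult_strict_right_mono[of "real k" "real N + 1" pi]
    by (auto simp: freq_def divide_less_eq mult.commute)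
  have "cos (freq N k) < cos 0"
    using 0 by (intro cos_monotone_0_pi) auto
  then show "cos (freq N k) < 1" by simp
qed

text \<open>With \<open>y = m * \<pi> / (N + 1)\<close> and multiplied by \<open>2 * sin (y / 2)\<close>, the sum telescopes; at
  \<open>(N + 1 / 2) * y = m * \<pi> - y / 2\<close> only the parity of \<open>m\<close> survives. This is what makes the two cosine sums in the product formula for sines cancel, as
  \<open>i - j\<close> and \<open>i + j\<close> have the same parity.\<close>

lemma sum_cos_freq:
  assumes m: "0 < m" "m < 2 * (N + 1)"
  shows "(\<Sum>k = 1..N. cos (freq N k * real m)) = - (1 + (- 1) ^ m) / 2"
proof -
  define y where "y = real m * pi / (real N + 1)"
  have telescope: "2 * sin (y / 2) * (\<Sum>k = 1..M. cos (real k * y)) = sin ((real M + 1 / 2) * y) - sin (y / 2)" for M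
  proof (induction M)
    case (Suc M)
    have "2 * sin (y / 2) * cos (real (Suc M) * y) = sin ((real (Suc M) + 1 / 2) * y) - sin ((real M + 1 / 2) * y)"
      using sin_add[of "real (Suc M) * y" "y / 2"] sin_diff[of "real (Suc M) * y" "y / 2"]
      by (simp add: algebra_simps)
    then show ?case using Suc by (simp add: distrib_left)
  qed simp
  have "real m < real (2 * (N + 1))" using m(2) by (simp only: of_nat_less_iff)
  then have "real m * pi < real (2 * (N + 1)) * pi" by (rule mult_strict_right_mono) simp
  then have "0 < y / 2" "y / 2 < pi"
    using m(1) by (auto simp: y_def divide_less_eq algebra_simps)
  then have pos: "sin (y / 2) > 0" by (rule sin_gt_zero)
  have "(real N + 1 / 2) * y = real m * pi - y / 2"
    by (simp add: y_def field_simps)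
  then have "2 * sin (y / 2) * (\<Sum>k = 1..N. cos (real k * y)) = sin (real m * pi - y / 2) - sin (y / 2)"
    using telescope[of N] by simp
  also have "\<dots> = sin (y / 2) * (- (1 + (- 1) ^ m))"
    by (simp add: sin_diff algebra_simps)
  finally have "sin (y / 2) * (2 * (\<Sum>k = 1..N. cos (real k * y))) = sin (y / 2) * (- (1 + (- 1) ^ m))"
    by (simp only: mult_ac)
  then have "2 * (\<Sum>k = 1..N. cos (real k * y)) = - (1 + (- 1) ^ m)"
    unfolding mult_cancel_left using pos by auto
  then have "(\<Sum>k = 1..N. cos (real k * y)) = - (1 + (- 1) ^ m) / 2"
    by simp
  then show ?thesis by (simp add: freq_def y_def mult_ac)
qed

lemma sine_orthogonality:
  assumes i: "i \<in> {1..N}" and j: "j \<in> {1..N}"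
  shows "(\<Sum>k = 1..N. sin (freq N k * real i) * sin (freq N k * real j)) = (real N + 1) / 2 * of_bool (i = j)"
proof -
  have less: "(\<Sum>k = 1..N. sin (freq N k * real i) * sin (freq N k * real j)) = 0"
    if "j < i" "i \<le> N" "1 \<le> j" for i j
  proof -
    have "sin (freq N k * real i) * sin (freq N k * real j)
        = (cos (freq N k * real (i - j)) - cos (freq N k * real (i + j))) / 2" for k
      using that by (simp add: sin_times_sin of_nat_diff right_diff_distrib distrib_left)
    then have "(\<Sum>k = 1..N. sin (freq N k * real i) * sin (freq N k * real j))
        = ((\<Sum>k = 1..N. cos (freq N k * real (i - j))) - (\<Sum>k = 1..N. cos (freq N k * real (i + j)))) / 2"
      by (simp only: sum_subtractf flip: sum_divide_distrib)
    also have "\<dots> = (- (1 + (- 1) ^ (i - j)) / 2 - (- (1 + (- 1) ^ (i + j)) / 2)) / 2"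
      using that by (subst (1 2) sum_cos_freq) auto
    also have "(- 1 :: real) ^ (i + j) = (- 1) ^ (i - j)"
      using that by (simp add: minus_one_power_iff)
    finally show ?thesis by simp
  qed
  consider "i = j" | "j < i" | "i < j" by linarith
  then show ?thesis
  proof cases
    case 1
    have "sin (freq N k * real i) * sin (freq N k * real i) = (1 - cos (freq N k * real (i + i))) / 2" for k
      by (simp add: sin_times_sin distrib_left mult_ac)
    then have "(\<Sum>k = 1..N. sin (freq N k * real i) * sin (freq N k * real i))
        = (real N - (\<Sum>k = 1..N. cos (freq N k * real (i + i)))) / 2"
      by (simp only: sum_subtractf sum_constant card_atLeastAtMost flip: sum_divide_distrib) simp
    also have "\<dots> = (real N + 1) / 2"
      using i by (subst sum_cos_freq) (auto simp: field_simps)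
    finally show ?thesis using 1 by simp
  next
    case 2
    then show ?thesis using less[of j i] i j by simp
  next
    case 3
    then show ?thesis using less[of i j] i j by (simp add: mult.commute)
  qed
qed

lemma sine_in_E_space: "(\<lambda>m. complex_of_real (sin (freq N k * of_int m))) \<in> E_space N"
proof -
  have "sin (freq N k * of_int (int N + 1 + m)) = - sin (freq N k * of_int (int N + 1 - m))" for m
  proof -
    have "freq N k * of_int (int N + 1 + m) = real k * pi + freq N k * of_int m"
      "freq N k * of_int (int N + 1 - m) = real k * pi - freq N k * of_int m"
      by (simp_all add: freq_def field_simps)
    then show ?thesis by (simp add: sin_add sin_diff)
  qed
  then show ?thesis by (simp add: E_space_def flip: of_real_minus)
qed

lemma conv_sum:
  "conv d (\<lambda>m. \<Sum>k\<in>I. c k * w k m) i = (\<Sum>k\<in>I. c k * conv d (w k) i)"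
  unfolding conv_def sum_distrib_left by (subst sum.swap) (simp add: mult_ac)

lemma D_matrix_mult_vec:
  assumes d: "d \<in> sym_formulas K" and w: "w \<in> E_space N" and v: "v \<in> carrier_vec N"
    and vw: "\<And>j. j < N \<Longrightarrow> w (int j + 1) = v $ j" and i: "i < N"
  shows "(D_matrix N d *\<^sub>v v) $ i = conv d w (int i + 1)"
proof -
  have "w = (\<lambda>m. \<Sum>j<N. v $ j * E_basis N (int j + 1) m)"
  proof (rule E_space_eqI[OF w])
    show "(\<lambda>m. \<Sum>j<N. v $ j * E_basis N (int j + 1) m) \<in> E_space N"
      by (rule E_space_sum) (rule E_basis_in)
    show "w (int k + 1) = (\<Sum>j<N. v $ j * E_basis N (int j + 1) (int k + 1))" if "k < N" for k
      using vw[OF that] sum_E_basis[OF that, of "\<lambda>j. v $ j"] by simp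
  qed
  then have "conv d w (int i + 1) = (\<Sum>j<N. v $ j * conv d (E_basis N (int j + 1)) (int i + 1))"
    using conv_sum by metis
  then show ?thesis
    using v i unfolding D_matrix_eq[OF d]
    by (simp add: scalar_prod_def mult.commute atLeast0LessThan)
qed

text \<open>The spectral expansion of the inverse matrix; \<open>2 * mesh N\<close> normalises the sine vectors, whose squared
  length is \<open>(N + 1) / 2\<close>.\<close>

definition green :: "nat \<Rightarrow> (nat \<Rightarrow> complex) \<Rightarrow> nat \<Rightarrow> nat \<Rightarrow> nat \<Rightarrow> complex" where
  "green l x N i j = (\<Sum>k = 1..N. of_real (2 * mesh N * sin (freq N k * real j) * sin (freq N k * real i))
      / eigenvalue l x (freq N k))"

lemma D_matrix_carrier:
  assumes "d \<in> sym_formulas K"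
  shows "D_matrix N d \<in> carrier_mat N N"
  unfolding D_matrix_eq[OF assms] by simp

text \<open>Applied to a column of \<open>green\<close>, the matrix cancels the eigenvalues, and orthogonality of the sines
  leaves a unit vector. A right inverse of a square matrix is also a left inverse.\<close>

lemma D_matrix_inverse:
  assumes nz: "\<And>k. k \<in> {1..N} \<Longrightarrow> eigenvalue l x (freq N k) \<noteq> 0"
  defines "D \<equiv> D_matrix N (formula_of_coords l x)"
    and "G \<equiv> mat N N (\<lambda>(i, j). green l x N (i + 1) (j + 1))"
  shows "D * G = 1\<^sub>m N" "G * D = 1\<^sub>m N"
proof -
  let ?d = "formula_of_coords l x"
  have d: "?d \<in> sym_formulas UNIV"
    using formula_of_coords_in[of UNIV l x] C_formulasD(1) by auto
  have D: "D \<in> carrier_mat N N" and G: "G \<in> carrier_mat N N"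
    unfolding D_def G_def using D_matrix_carrier[OF d] by simp_all
  show DG: "D * G = 1\<^sub>m N"
  proof (rule eq_matI)
    fix i j assume "i < dim_row (1\<^sub>m N)" "j < dim_col (1\<^sub>m N)"
    then have ij: "i < N" "j < N" by simp_all
    define c where "c k = of_real (2 * mesh N * sin (freq N k * real (j + 1))) / eigenvalue l x (freq N k)" for k
    define w where "w m = (\<Sum>k\<in>{1..N}. c k * of_real (sin (freq N k * of_int m)))" for m
    have w: "w \<in> E_space N"
      unfolding w_def by (rule E_space_sum) (rule sine_in_E_space)
    have "(D * G) $$ (i, j) = (D *\<^sub>v col G j) $ i"
      using ij D G by simp
    also have "\<dots> = conv ?d w (int i + 1)"
      unfolding D_def
    proof (rule D_matrix_mult_vec[OF d w _ _ ij(1)])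
      show "col G j \<in> carrier_vec N" using G ij by auto
      show "w (int r + 1) = col G j $ r" if "r < N" for r
        using that ij
        by (simp add: w_def G_def green_def c_def mult_ac add.commute)
    qed
    also have "\<dots> = (\<Sum>k\<in>{1..N}. c k * (eigenvalue l x (freq N k) * of_real (sin (freq N k * of_int (int i + 1)))))"
      unfolding w_def conv_sum conv_sine ..
    also have "\<dots> = (\<Sum>k\<in>{1..N}. of_real (2 * mesh N * (sin (freq N k * real (j + 1)) * sin (freq N k * real (i + 1)))))"
      by (rule sum.cong) (use nz in \<open>auto simp: c_def add.commute\<close>)
    also have "\<dots> = of_real (2 * mesh N * (\<Sum>k = 1..N. sin (freq N k * real (j + 1)) * sin (freq N k * real (i + 1))))"
      by (simp only: of_real_sum sum_distrib_left)
    also have "2 * mesh N * (\<Sum>k = 1..N. sin (freq N k * real (j + 1)) * sin (freq N k * real (i + 1)))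
        = of_bool (i = j)"
      using ij mesh_bounds(3)[of N] by (subst sine_orthogonality) (auto simp: mult_ac)
    finally show "(D * G) $$ (i, j) = 1\<^sub>m N $$ (i, j)" using ij by simp
  qed (use D G in auto)
  show "G * D = 1\<^sub>m N" by (rule mat_mult_left_right_inverse[OF D G DG])
qed

lemma D_matrix_invertible:
  assumes nz: "\<And>k. k \<in> {1..N} \<Longrightarrow> eigenvalue l x (freq N k) \<noteq> 0"
  shows "invertible_mat (D_matrix N (formula_of_coords l x))"
proof -
  have "formula_of_coords l x \<in> sym_formulas UNIV"
    using formula_of_coords_in[of UNIV l x] C_formulasD(1) by auto
  from D_matrix_carrier[OF this, of N] D_matrix_inverse[OF nz] show ?thesis
    unfolding invertible_mat_def inverts_mat_def square_mat.simps
    by (intro conjI exI[of _ "mat N N (\<lambda>(i, j). green l x N (i + 1) (j + 1))"]) auto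
qed

lemma D_matrix_solution:
  assumes nz: "\<And>k. k \<in> {1..N} \<Longrightarrow> eigenvalue l x (freq N k) \<noteq> 0"
    and e: "e \<in> carrier_vec N" and i: "i < N"
  shows "e $ i = (\<Sum>j<N. green l x N (i + 1) (j + 1) * (D_matrix N (formula_of_coords l x) *\<^sub>v e) $ j)"
proof -
  let ?D = "D_matrix N (formula_of_coords l x)" and ?G = "mat N N (\<lambda>(i, j). green l x N (i + 1) (j + 1))"
  have d: "formula_of_coords l x \<in> sym_formulas UNIV"
    using formula_of_coords_in[of UNIV l x] C_formulasD(1) by auto
  note D = D_matrix_carrier[OF d, of N]
  note inv = D_matrix_inverse[OF nz]
  have "e = (?G * ?D) *\<^sub>v e" using e by (simp only: inv(2) one_mult_mat_vec)
  also have "\<dots> = ?G *\<^sub>v (?D *\<^sub>v e)"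
    using D e by (intro assoc_mult_mat_vec[of _ N N _ N]) auto
  finally have "e $ i = (?G *\<^sub>v (?D *\<^sub>v e)) $ i" by simp
  also have "\<dots> = (\<Sum>j<N. green l x N (i + 1) (j + 1) * (?D *\<^sub>v e) $ j)"
    using i D e by (simp add: scalar_prod_def atLeast0LessThan)
  finally show ?thesis .
qed

section \<open>Bounds for the inverse matrices\<close>

definition laplace_green :: "nat \<Rightarrow> nat \<Rightarrow> nat \<Rightarrow> real" where
  "laplace_green N i j =
     mesh N * (\<Sum>k = 1..N. sin (freq N k * real i) * sin (freq N k * real j) / (1 - cos (freq N k)))"

text \<open>In \<open>i\<close> the sum vanishes at \<open>0\<close> and at \<open>N + 1\<close>, and its second difference is \<open>- 1\<close> at \<open>i = j\<close> and \<open>0\<close>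
  elsewhere by orthogonality. Hence it is the tent function \<open>min i j - i j h\<close>. The truncated subtraction
  in \<open>real (i - j)\<close> is meant: that term is the positive part of \<open>i - j\<close>.\<close>

lemma laplace_green_eq:
  assumes j: "j \<in> {1..N}" and i: "i \<le> N + 1"
  shows "laplace_green N i j = real i * (1 - real j * mesh N) - real (i - j)"
proof -
  let ?A = "\<lambda>i. laplace_green N i j"
  have A0: "?A 0 = 0"
    by (simp add: laplace_green_def)
  have AN: "?A (N + 1) = 0"
  proof -
    have "freq N k * real (N + 1) = real k * pi" for k
      by (simp add: freq_def add.commute)
    then show ?thesis by (simp add: laplace_green_def del: of_nat_Suc of_nat_add)
  qed
  have rec: "?A (i + 2) - 2 * ?A (i + 1) + ?A i = - of_bool (i + 1 = j)" if i: "i + 1 \<in> {1..N}" for i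
  proof -
    have step: "sin (freq N k * real (i + 2)) * s / (1 - cos (freq N k))
        - 2 * (sin (freq N k * real (i + 1)) * s / (1 - cos (freq N k)))
        + sin (freq N k * real i) * s / (1 - cos (freq N k))
        = - 2 * (sin (freq N k * real (i + 1)) * s)" if k: "k \<in> {1..N}" for k s
    proof -
      define a where "a = freq N k"
      have c: "1 - cos a \<noteq> 0" using freq_bounds(3)[OF k] by (simp add: a_def)
      have "sin (a * real (i + 2)) + sin (a * real i) = 2 * (sin (a * real (i + 1)) * cos a)"
        using sin_add[of "a * real (i + 1)" a] sin_diff[of "a * real (i + 1)" a] by (simp add: algebra_simps)
      then have "sin (a * real (i + 2)) * s - 2 * (sin (a * real (i + 1)) * s) + sin (a * real i) * s
          = - 2 * (sin (a * real (i + 1)) * s) * (1 - cos a)"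
        by (simp only: eq_diff_eq[of _ _ "sin (a * real i)", symmetric]) (simp add: algebra_simps)
      then have "(sin (a * real (i + 2)) * s - 2 * (sin (a * real (i + 1)) * s) + sin (a * real i) * s) / (1 - cos a)
          = - 2 * (sin (a * real (i + 1)) * s)"
        using c by simp
      then show ?thesis
        unfolding a_def by (simp only: add_divide_distrib diff_divide_distrib times_divide_eq_right)
    qed
    have "?A (i + 2) - 2 * ?A (i + 1) + ?A i
        = mesh N * (\<Sum>k = 1..N. sin (freq N k * real (i + 2)) * sin (freq N k * real j) / (1 - cos (freq N k))
        - 2 * (sin (freq N k * real (i + 1)) * sin (freq N k * real j) / (1 - cos (freq N k)))
        + sin (freq N k * real i) * sin (freq N k * real j) / (1 - cos (freq N k)))"
      unfolding laplace_green_def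
      by (simp only: sum.distrib sum_subtractf sum_distrib_left[symmetric] distrib_left right_diff_distrib mult_ac)
    also have "\<dots> = mesh N * (\<Sum>k = 1..N. - 2 * (sin (freq N k * real (i + 1)) * sin (freq N k * real j)))"
      using step by (intro arg_cong[of _ _ "\<lambda>s. mesh N * s"] sum.cong) auto
    also have "\<dots> = mesh N * (- 2 * (\<Sum>k = 1..N. sin (freq N k * real (i + 1)) * sin (freq N k * real j)))"
      by (simp only: sum_distrib_left)
    also have "\<dots> = mesh N * (- 2 * ((real N + 1) / 2 * of_bool (i + 1 = j)))"
      by (simp only: sine_orthogonality[OF i j])
    also have "\<dots> = - of_bool (i + 1 = j)"
      using mesh_bounds(3)[of N] by (simp add: mult_ac)
    finally show ?thesis .
  qed
  have lin: "?A i = real i * ?A 1 - real (i - j)" if "i \<le> N + 1" for i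
    using that
  proof (induction i rule: induct_nat_012)
    case (ge2 m)
    have "?A (m + 2) - 2 * ?A (m + 1) + ?A m = - of_bool (m + 1 = j)"
      using ge2 by (intro rec) auto
    moreover have "?A m = real m * ?A 1 - real (m - j)" "?A (m + 1) = real (m + 1) * ?A 1 - real (m + 1 - j)"
      using ge2 by auto
    moreover have "real (m + 2 - j) - 2 * real (m + 1 - j) + real (m - j) = of_bool (m + 1 = j)"
      by (simp add: of_nat_diff not_le split: nat_diff_split)
    ultimately show ?case by (simp add: algebra_simps)
  qed (use j in \<open>auto simp: A0\<close>)
  have "(real N + 1) * ?A 1 = real N + 1 - real j"
    using lin[of "N + 1"] AN j by (simp add: of_nat_diff add.commute)
  then have "(real N + 1) * ?A 1 * mesh N = (real N + 1 - real j) * mesh N" by simp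
  then have "?A 1 * ((real N + 1) * mesh N) = (real N + 1) * mesh N - real j * mesh N"
    by (simp only: left_diff_distrib right_diff_distrib mult_ac)
  then have "?A 1 = 1 - real j * mesh N"
    by (simp only: mesh_bounds(3) mult_1_right)
  then show ?thesis using lin[OF i] by simp
qed

text \<open>The bound depends on the column \<open>j\<close> only, through its distance to the nearer end; this is what makes
  residuals in the outer rows count two orders less.\<close>

lemma laplace_green_bound:
  assumes j: "j \<in> {1..N}" and i: "i \<in> {1..N}"
  shows "\<bar>laplace_green N i j\<bar> \<le> real (min j (N + 1 - j))"
proof -
  define h where "h = mesh N"
  have h: "h > 0" "(real N + 1) * h = 1" using mesh_bounds[of N] by (simp_all add: h_def)
  have jh: "real k * h \<le> 1" "real k * h \<ge> 0" if "k \<le> N + 1" for k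
    using mult_right_mono[of "real k" "real N + 1" h] that h by auto
  have eq: "laplace_green N i j = real i * (1 - real j * h) - real (i - j)"
    using laplace_green_eq[OF j] i by (simp add: h_def)
  have sym: "real N + 1 - real j = (real N + 1) * (1 - real j * h)"
  proof -
    have "real j * ((real N + 1) * h) = real j" using h(2) by simp
    then show ?thesis by (simp add: algebra_simps)
  qed
  have m: "real (min j (N + 1 - j)) = min (real j) (real N + 1 - real j)"
    using j by (simp add: of_nat_min of_nat_diff)
  show ?thesis
  proof (cases "i \<le> j")
    case True
    have "0 \<le> real i * (1 - real j * h)" using jh[of j] j by simp
    moreover have "real i * (1 - real j * h) \<le> real i * 1"
      using jh[of j] j by (intro mult_left_mono) auto
    moreover have "real i * (1 - real j * h) \<le> (real N + 1) * (1 - real j * h)"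
      using jh[of j] i j by (intro mult_right_mono) auto
    ultimately show ?thesis
      using True sym unfolding eq m by simp
  next
    case False
    then have e: "laplace_green N i j = real j * (1 - real i * h)"
      unfolding eq by (simp add: of_nat_diff algebra_simps)
    have "0 \<le> real j * (1 - real i * h)" using jh[of i] i by simp
    moreover have "real j * (1 - real i * h) \<le> real j * 1"
      using jh[of i] i by (intro mult_left_mono) auto
    moreover have "real j * (1 - real i * h) \<le> (real N + 1) * (1 - real i * h)"
      using jh[of i] i j by (intro mult_right_mono) auto
    moreover have "(real N + 1) * (1 - real i * h) \<le> (real N + 1) * (1 - real j * h)"
      using False h(1) by (intro mult_left_mono) auto
    ultimately show ?thesis
      using sym unfolding e m by linarith
  qed
qed

lemma poly_lipschitz_at_1:
  fixes p :: "real poly"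
  shows "\<exists>M\<ge>0. \<forall>t\<in>{-1..1}. \<bar>poly p 1 - poly p t\<bar> \<le> M * (1 - t)"
proof -
  have "poly (p - [:poly p 1:]) 1 = 0" by simp
  then obtain q where q: "p - [:poly p 1:] = [:- 1, 1:] * q"
    unfolding poly_eq_0_iff_dvd by (auto elim: dvdE)
  have "bounded (poly q ` {-1..1})"
    by (intro compact_imp_bounded compact_continuous_image continuous_intros) auto
  then obtain M where M: "M > 0" "\<And>t. t \<in> {-1..1} \<Longrightarrow> \<bar>poly q t\<bar> \<le> M"
    unfolding bounded_pos by auto
  have "\<bar>poly p 1 - poly p t\<bar> \<le> M * (1 - t)" if t: "t \<in> {-1..1}" for t
  proof -
    have "poly p t - poly p 1 = (t - 1) * poly q t"
      using arg_cong[OF q, of "\<lambda>r. poly r t"] by (simp add: algebra_simps)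
    then have "\<bar>poly p 1 - poly p t\<bar> = (1 - t) * \<bar>poly q t\<bar>"
      using t by (simp add: abs_minus_commute[of "poly p 1"] abs_minus_commute[of t] abs_mult)
    then show ?thesis
      using M(2)[OF t] t mult_left_mono[of "\<bar>poly q t\<bar>" M "1 - t"] by (simp add: mult.commute)
  qed
  then show ?thesis using M(1) by (intro exI[of _ M]) auto
qed

lemma reduced_symbol_lipschitz_at_1:
  "\<exists>L\<ge>0. \<forall>t\<in>{-1..1}. cmod (reduced_symbol l x 1 - reduced_symbol l x t) \<le> L * (1 - t)"
proof -
  obtain M where M: "\<And>k. M k \<ge> 0"
    "\<And>k t. t \<in> {-1..1} \<Longrightarrow> \<bar>poly (fejer k) 1 - poly (fejer k) t\<bar> \<le> M k * (1 - t)"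
  proof -
    have "\<forall>k. \<exists>M\<ge>0. \<forall>t\<in>{-1..1}. \<bar>poly (fejer k) 1 - poly (fejer k) t\<bar> \<le> M * (1 - t)"
      using poly_lipschitz_at_1 by blast
    from choice[OF this] show ?thesis using that by blast
  qed
  have "cmod (reduced_symbol l x 1 - reduced_symbol l x t) \<le> (\<Sum>k = 1..l + 1. cmod (x k) * M k) * (1 - t)"
    if t: "t \<in> {-1..1}" for t
  proof -
    have "reduced_symbol l x 1 - reduced_symbol l x t
        = (\<Sum>k = 1..l + 1. x k * of_real (poly (fejer k) 1 - poly (fejer k) t))"
      unfolding reduced_symbol_def by (simp only: of_real_diff right_diff_distrib sum_subtractf)
    also have "cmod \<dots> \<le> (\<Sum>k = 1..l + 1. cmod (x k) * (M k * (1 - t)))"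
      by (intro sum_norm_le) (simp only: norm_mult norm_of_real, intro mult_left_mono M t norm_ge_zero)
    also have "\<dots> = (\<Sum>k = 1..l + 1. cmod (x k) * M k) * (1 - t)"
      by (simp only: sum_distrib_right mult.assoc)
    finally show ?thesis .
  qed
  then show ?thesis
    using M(1) by (intro exI[of _ "\<Sum>k = 1..l + 1. cmod (x k) * M k"] conjI sum_nonneg) auto
qed

definition inverse_symbol_sum :: "nat \<Rightarrow> (nat \<Rightarrow> complex) \<Rightarrow> nat \<Rightarrow> real" where
  "inverse_symbol_sum l x N = (\<Sum>k = 1..N. 1 / cmod (reduced_symbol l x (cos (freq N k))))"

lemma eigenvalue_nonzero:
  assumes "k \<in> {1..N}" "reduced_symbol l x (cos (freq N k)) \<noteq> 0"
  shows "eigenvalue l x (freq N k) \<noteq> 0"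
  using freq_bounds(3)[OF assms(1)] assms(2) unfolding eigenvalue_def by (simp del: of_real_diff)

text \<open>With \<open>t = cos (freq N k)\<close>, the expansion
  \<open>1 / ((1 - t) P t) = 1 / ((1 - t) P 1) + (P 1 - P t) / ((1 - t) P t P 1)\<close> isolates the Green function of the
  second difference. The Lipschitz estimate cancels the factor \<open>1 - t\<close> in the remainder, whose
  terms are therefore bounded by a constant times \<open>1 / \<bar>P t\<bar>\<close>.\<close>

lemma green_bound:
  assumes one: "reduced_symbol l x 1 \<noteq> 0"
  shows "\<exists>C\<ge>0. \<forall>N. (\<forall>k\<in>{1..N}. reduced_symbol l x (cos (freq N k)) \<noteq> 0) \<longrightarrow>
    (\<forall>i\<in>{1..N}. \<forall>j\<in>{1..N}.
      cmod (green l x N i j) \<le> C * real (min j (N + 1 - j)) + C * mesh N * inverse_symbol_sum l x N)"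
proof -
  let ?P = "reduced_symbol l x"
  obtain L where L: "L \<ge> 0" "\<And>t. t \<in> {-1..1} \<Longrightarrow> cmod (?P 1 - ?P t) \<le> L * (1 - t)"
    using reduced_symbol_lipschitz_at_1 by metis
  define C where "C = (1 + L) / cmod (?P 1)"
  have C: "C \<ge> 0" "1 / cmod (?P 1) \<le> C" "L / cmod (?P 1) \<le> C"
    using L(1) by (simp_all add: C_def divide_right_mono)
  have "cmod (green l x N i j) \<le> C * real (min j (N + 1 - j)) + C * mesh N * inverse_symbol_sum l x N"
    if nz: "\<forall>k\<in>{1..N}. ?P (cos (freq N k)) \<noteq> 0" and i: "i \<in> {1..N}" and j: "j \<in> {1..N}" for N i j
  proof -
    define c where "c k = cos (freq N k)" for k
    define s where "s k = sin (freq N k * real i) * sin (freq N k * real j)" for k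
    have s1: "\<bar>s k\<bar> \<le> 1" for k
      unfolding s_def abs_mult by (intro mult_le_one) auto
    have c1: "c k < 1" "c k \<in> {-1..1}" if "k \<in> {1..N}" for k
      using freq_bounds(3)[OF that] by (auto simp: c_def)
    define E where "E k = (?P 1 - ?P (c k)) / (of_real (1 - c k) * ?P (c k) * ?P 1)" for k
    have E: "cmod (E k) \<le> C * (1 / cmod (?P (c k)))" if k: "k \<in> {1..N}" for k
    proof -
      have "cmod (?P 1 - ?P (c k)) / (1 - c k) \<le> L"
        using L(2)[OF c1(2)[OF k]] c1(1)[OF k] by (simp add: divide_le_eq)
      then have "cmod (?P 1 - ?P (c k)) / (1 - c k) / cmod (?P 1) \<le> C"
        using C(3) divide_right_mono[of _ L "cmod (?P 1)"] by fastforce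
      then have "cmod (?P 1 - ?P (c k)) / (1 - c k) / cmod (?P 1) * (1 / cmod (?P (c k))) \<le> C * (1 / cmod (?P (c k)))"
        by (intro mult_right_mono) auto
      moreover have "cmod (E k) = cmod (?P 1 - ?P (c k)) / (1 - c k) / cmod (?P 1) * (1 / cmod (?P (c k)))"
        using c1(1)[OF k] unfolding E_def by (simp add: norm_divide norm_mult del: of_real_diff)
      ultimately show ?thesis by simp
    qed
    have "green l x N i j = (\<Sum>k = 1..N. of_real (mesh N * s k / (1 - c k)) * (- 1 / ?P 1) - of_real (mesh N * s k) * E k)"
      unfolding green_def
    proof (rule sum.cong[OF refl])
      fix k assume k: "k \<in> {1..N}"
      have "?P (c k) \<noteq> 0" using nz k by (simp add: c_def)
      moreover have "complex_of_real (1 - c k) \<noteq> 0" using c1(1)[OF k] by (simp del: of_real_diff)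
      moreover have "2 * S / (- 2 * w * p) = S / w * (- 1 / q) - S * ((q - p) / (w * p * q))"
        if "w \<noteq> 0" "p \<noteq> 0" "q \<noteq> 0" for S w p q :: complex
        using that by (simp add: divide_simps) (simp add: algebra_simps)
      ultimately have "2 * of_real (mesh N * s k) / (- 2 * of_real (1 - c k) * ?P (c k))
          = of_real (mesh N * s k) / of_real (1 - c k) * (- 1 / ?P 1) - of_real (mesh N * s k) * E k"
        unfolding E_def using one by blast
      then show "of_real (2 * mesh N * sin (freq N k * real j) * sin (freq N k * real i)) / eigenvalue l x (freq N k)
          = of_real (mesh N * s k / (1 - c k)) * (- 1 / ?P 1) - of_real (mesh N * s k) * E k"
        by (simp add: eigenvalue_def s_def c_def mult_ac del: of_real_diff)
    qed
    also have "\<dots> = of_real (laplace_green N i j) * (- 1 / ?P 1) - (\<Sum>k = 1..N. of_real (mesh N * s k) * E k)"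
      unfolding sum_subtractf sum_distrib_right[symmetric] laplace_green_def s_def c_def
      by (simp only: sum_distrib_left of_real_sum times_divide_eq_right)
    also have "cmod \<dots> \<le> cmod (of_real (laplace_green N i j) * (- 1 / ?P 1)) + cmod (\<Sum>k = 1..N. of_real (mesh N * s k) * E k)"
      by (rule norm_triangle_ineq4)
    also have "\<dots> \<le> C * real (min j (N + 1 - j)) + C * mesh N * inverse_symbol_sum l x N"
    proof (rule add_mono)
      have "cmod (of_real (laplace_green N i j) * (- 1 / ?P 1)) = (1 / cmod (?P 1)) * \<bar>laplace_green N i j\<bar>"
        by (simp add: norm_mult norm_divide)
      also have "\<dots> \<le> C * real (min j (N + 1 - j))"
        using C laplace_green_bound[OF j i] by (intro mult_mono) auto
      finally show "cmod (of_real (laplace_green N i j) * (- 1 / ?P 1)) \<le> C * real (min j (N + 1 - j))" .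
      have "cmod (\<Sum>k = 1..N. of_real (mesh N * s k) * E k) \<le> (\<Sum>k = 1..N. mesh N * (C * (1 / cmod (?P (c k)))))"
      proof (rule sum_norm_le)
        fix k assume k: "k \<in> {1..N}"
        have "mesh N * \<bar>s k\<bar> \<le> mesh N"
          using mult_left_mono[OF s1[of k], of "mesh N"] mesh_bounds(1)[of N] by simp
        then show "cmod (of_real (mesh N * s k) * E k) \<le> mesh N * (C * (1 / cmod (?P (c k))))"
          unfolding norm_mult norm_of_real abs_mult using E[OF k] mesh_bounds(1)[of N]
          by (intro mult_mono) auto
      qed
      also have "\<dots> = C * mesh N * inverse_symbol_sum l x N"
        unfolding inverse_symbol_sum_def c_def sum_distrib_left by (simp only: mult_ac)
      finally show "cmod (\<Sum>k = 1..N. of_real (mesh N * s k) * E k) \<le> C * mesh N * inverse_symbol_sum l x N" .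
    qed
    finally show ?thesis .
  qed
  then show ?thesis using C(1) by blast
qed

section \<open>The error of the scheme\<close>

text \<open>The error is the inverse matrix applied to the residual. Interior residuals \<open>h ^ (2 p + 2)\<close> meet \<open>N\<close>
  entries of size \<open>N + h T\<close>, with \<open>T = inverse_symbol_sum l x N\<close>; the \<open>2 l\<close> outer residuals
  \<open>h ^ (2 q + 2)\<close> meet entries of size \<open>l + h T\<close>.\<close>

lemma discretization_error:
  assumes p: "p \<ge> 1" and f: "C_infinity f" and u: "solves_dirichlet f u"
    and one: "reduced_symbol l x 1 \<noteq> 0"
  defines "d \<equiv> formula_of_coords l x"
  shows "\<exists>C\<ge>0. \<forall>N\<ge>2 * l. (\<forall>k\<in>{1..N}. reduced_symbol l x (cos (freq N k)) \<noteq> 0) \<longrightarrow>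
    (\<forall>v\<in>carrier_vec N.
       D_matrix N d *\<^sub>v v = (of_real (mesh N))\<^sup>2 \<cdot>\<^sub>v S_operator l (2 * p) (2 * q) d N (\<lambda>j. f (grid N j)) \<longrightarrow>
       (\<forall>j<N. cmod (u (grid N (int j + 1)) - v $ j)
          \<le> C * (mesh N ^ (2 * p) * (1 + (mesh N)\<^sup>2 * inverse_symbol_sum l x N)
                 + mesh N ^ (2 * q + 2) * (1 + mesh N * inverse_symbol_sum l x N))))"
proof -
  have d: "d \<in> C_formulas UNIV l"
    unfolding d_def by (rule formula_of_coords_in) auto
  obtain C1 where C1: "C1 \<ge> 0" and green: "\<forall>N. (\<forall>k\<in>{1..N}. reduced_symbol l x (cos (freq N k)) \<noteq> 0) \<longrightarrow>
    (\<forall>i\<in>{1..N}. \<forall>j\<in>{1..N}.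
      cmod (green l x N i j) \<le> C1 * real (min j (N + 1 - j)) + C1 * mesh N * inverse_symbol_sum l x N)"
    using green_bound[OF one] by (elim exE conjE)
  obtain C2 where C2: "C2 \<ge> 0" and trunc: "\<forall>N\<ge>2 * l. \<forall>w\<in>E_space N. (\<forall>j\<in>{1..int N}. w j = u (grid N j)) \<longrightarrow>
     (\<forall>i\<in>{1..int N}. cmod (residual l (2 * p) (2 * q) d N f w i) \<le> C2 * mesh N ^ (2 * p + 2)
        + of_bool (i \<le> int l \<or> i \<ge> int N + 1 - int l) * (C2 * mesh N ^ (2 * q + 2)))"
    using truncation_error[OF d p f u, of q] by (elim exE conjE)
  \<comment> \<open>There are at most \<open>2 * l\<close> outer rows, at distance at most \<open>l\<close> from the nearer end.\<close>
  define C where "C = C1 * C2 * (1 + 2 * real l) * (1 + real l)"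
  have C: "C \<ge> 0" using C1 C2 by (simp add: C_def)
  show ?thesis
  proof (intro exI[of _ C] conjI allI impI ballI C)
    fix N v i
    assume N: "2 * l \<le> N" and nz: "\<forall>k\<in>{1..N}. reduced_symbol l x (cos (freq N k)) \<noteq> 0"
      and v: "v \<in> carrier_vec N"
      and eq: "D_matrix N d *\<^sub>v v = (of_real (mesh N))\<^sup>2 \<cdot>\<^sub>v S_operator l (2 * p) (2 * q) d N (\<lambda>j. f (grid N j))"
      and i: "i < N"
    define h where "h = mesh N"
    define T where "T = inverse_symbol_sum l x N"
    define B where "B j \<longleftrightarrow> int j + 1 \<le> int l \<or> int j + 1 \<ge> int N + 1 - int l" for j
    have h: "h > 0" "real N * h \<le> 1"
      using mesh_bounds[of N] by (simp_all add: h_def distrib_right)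
    have T: "T \<ge> 0" unfolding T_def inverse_symbol_sum_def by (intro sum_nonneg) simp
    define U where "U = vec N (\<lambda>j. u (grid N (int j + 1)))"
    define w where "w m = (\<Sum>j<N. u (grid N (int j + 1)) * E_basis N (int j + 1) m)" for m
    have w: "w \<in> E_space N"
      unfolding w_def by (rule E_space_sum) (rule E_basis_in)
    have wu: "w (int k + 1) = u (grid N (int k + 1))" if "k < N" for k
      unfolding w_def using that by (rule sum_E_basis)
    have U: "U \<in> carrier_vec N" and e: "U - v \<in> carrier_vec N"
      using v by (simp_all add: U_def)
    have D: "D_matrix N d \<in> carrier_mat N N"
      using D_matrix_carrier[OF C_formulasD(1)[OF d]] .
    let ?r = "\<lambda>j. (D_matrix N d *\<^sub>v (U - v)) $ j"
    have r_eq: "?r j = residual l (2 * p) (2 * q) d N f w (int j + 1)" if j: "j < N" for j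
    proof -
      have "D_matrix N d *\<^sub>v (U - v) = D_matrix N d *\<^sub>v U - D_matrix N d *\<^sub>v v"
        using mult_minus_distrib_mat_vec[OF D U v] .
      then have "?r j = (D_matrix N d *\<^sub>v U) $ j - (D_matrix N d *\<^sub>v v) $ j"
        using j D v by simp
      also have "(D_matrix N d *\<^sub>v U) $ j = conv d w (int j + 1)"
        by (rule D_matrix_mult_vec[OF C_formulasD(1)[OF d] w U _ j]) (simp add: U_def wu)
      also have "(D_matrix N d *\<^sub>v v) $ j
          = (of_real (mesh N))\<^sup>2 * S_row l (2 * p) (2 * q) d N (\<lambda>j. f (grid N j)) (int j + 1)"
        unfolding eq using j by (simp add: S_operator_def)
      finally show ?thesis by (simp add: residual_def)
    qed
    have "w j = u (grid N j)" if "j \<in> {1..int N}" for j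
    proof -
      have "int (nat (j - 1)) + 1 = j" "nat (j - 1) < N" using that by auto
      then show ?thesis using wu by metis
    qed
    then have res: "\<forall>i\<in>{1..int N}. cmod (residual l (2 * p) (2 * q) d N f w i) \<le> C2 * h ^ (2 * p + 2)
        + of_bool (i \<le> int l \<or> i \<ge> int N + 1 - int l) * (C2 * h ^ (2 * q + 2))"
      unfolding h_def by (intro trunc[THEN spec, THEN mp, THEN bspec, THEN mp, OF N w] ballI)
    have r: "cmod (?r j) \<le> C2 * h ^ (2 * p + 2) + of_bool (B j) * (C2 * h ^ (2 * q + 2))" if "j < N" for j
    proof -
      have "int j + 1 \<in> {1..int N}" using that by simp
      from bspec[OF res this] show ?thesis unfolding r_eq[OF that] B_def .
    qed
    let ?G = "\<lambda>j. green l x N (i + 1) (j + 1)"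
    have G: "cmod (?G j) \<le> C1 * real (min (j + 1) (N - j)) + C1 * h * T" if "j < N" for j
    proof -
      have "i + 1 \<in> {1..N}" "j + 1 \<in> {1..N}" using i that by auto
      then have "cmod (?G j) \<le> C1 * real (min (j + 1) (N + 1 - (j + 1))) + C1 * mesh N * inverse_symbol_sum l x N"
        by (rule green[THEN spec, THEN mp, OF nz, THEN bspec, THEN bspec])
      then show ?thesis by (simp add: h_def T_def)
    qed
    have row: "cmod (?G j * ?r j) \<le> (C1 * real N + C1 * h * T) * (C2 * h ^ (2 * p + 2))
        + of_bool (B j) * ((C1 * real l + C1 * h * T) * (C2 * h ^ (2 * q + 2)))" if j: "j < N" for j
    proof -
      have "C1 * real (min (j + 1) (N - j)) \<le> C1 * real N"
        using C1 j by (intro mult_left_mono) auto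
      then have all: "cmod (?G j) \<le> C1 * real N + C1 * h * T" using G[OF j] by linarith
      have bd: "cmod (?G j) \<le> C1 * real l + C1 * h * T" if "B j"
      proof -
        have "min (j + 1) (N - j) \<le> l" using that by (auto simp: B_def)
        then have "C1 * real (min (j + 1) (N - j)) \<le> C1 * real l"
          using C1 by (intro mult_left_mono) (simp_all only: of_nat_le_iff)
        then show ?thesis using G[OF j] by linarith
      qed
      have "cmod (?G j * ?r j) \<le> cmod (?G j) * (C2 * h ^ (2 * p + 2) + of_bool (B j) * (C2 * h ^ (2 * q + 2)))"
        unfolding norm_mult using r[OF j] by (rule mult_left_mono) simp
      also have "\<dots> = cmod (?G j) * (C2 * h ^ (2 * p + 2)) + of_bool (B j) * (cmod (?G j) * (C2 * h ^ (2 * q + 2)))"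
        by (simp only: distrib_left mult_ac)
      also have "\<dots> \<le> (C1 * real N + C1 * h * T) * (C2 * h ^ (2 * p + 2))
        + of_bool (B j) * ((C1 * real l + C1 * h * T) * (C2 * h ^ (2 * q + 2)))"
      proof (rule add_mono)
        show "cmod (?G j) * (C2 * h ^ (2 * p + 2)) \<le> (C1 * real N + C1 * h * T) * (C2 * h ^ (2 * p + 2))"
          using all C2 h by (intro mult_right_mono) auto
        show "of_bool (B j) * (cmod (?G j) * (C2 * h ^ (2 * q + 2)))
            \<le> of_bool (B j) * ((C1 * real l + C1 * h * T) * (C2 * h ^ (2 * q + 2)))"
        proof (cases "B j")
          case True
          have "cmod (?G j) * (C2 * h ^ (2 * q + 2)) \<le> (C1 * real l + C1 * h * T) * (C2 * h ^ (2 * q + 2))"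
            using bd[OF True] C2 h by (intro mult_right_mono) auto
          with True show ?thesis by (simp only: of_bool_eq mult_1_left)
        qed simp
      qed
      finally show ?thesis .
    qed
    have card: "(\<Sum>j<N. of_bool (B j)) \<le> 2 * real l"
    proof -
      have "(\<Sum>j<N. of_bool (B j)) = real (card ({..<N} \<inter> {j. B j}))"
        by (simp add: sum_of_bool_eq)
      also have "({..<N} \<inter> {j. B j}) \<subseteq> {..<l} \<union> {N - l..<N}"
        by (auto simp: B_def)
      then have "card ({..<N} \<inter> {j. B j}) \<le> card ({..<l} \<union> {N - l..<N})"
        by (intro card_mono) auto
      also have "\<dots> \<le> 2 * l"
        using card_Un_le[of "{..<l}" "{N - l..<N}"] by simp
      finally show ?thesis by simp
    qed
    have nzE: "eigenvalue l x (freq N k) \<noteq> 0" if "k \<in> {1..N}" for k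
      using eigenvalue_nonzero that nz by blast
    have "u (grid N (int i + 1)) - v $ i = (U - v) $ i"
      using i v by (simp add: U_def)
    also have "\<dots> = (\<Sum>j<N. ?G j * ?r j)"
      using D_matrix_solution[OF nzE e i] unfolding d_def .
    finally have "cmod (u (grid N (int i + 1)) - v $ i) = cmod (\<Sum>j<N. ?G j * ?r j)"
      by (rule arg_cong)
    also have "\<dots> \<le> (\<Sum>j<N. (C1 * real N + C1 * h * T) * (C2 * h ^ (2 * p + 2))
        + of_bool (B j) * ((C1 * real l + C1 * h * T) * (C2 * h ^ (2 * q + 2))))"
      using row by (intro sum_norm_le) auto
    also have "\<dots> = real N * ((C1 * real N + C1 * h * T) * (C2 * h ^ (2 * p + 2)))
        + (\<Sum>j<N. of_bool (B j)) * ((C1 * real l + C1 * h * T) * (C2 * h ^ (2 * q + 2)))"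
    proof -
      have "(\<Sum>j<N. a + of_bool (B j) * b) = real N * a + (\<Sum>j<N. of_bool (B j)) * b" for a b :: real
        by (subst sum.distrib, subst sum_distrib_right, simp)
      then show ?thesis .
    qed
    also have "\<dots> \<le> C * (h ^ (2 * p) * (1 + h\<^sup>2 * T)) + C * (h ^ (2 * q + 2) * (1 + h * T))"
    proof (rule add_mono)
      have "real N * ((C1 * real N + C1 * h * T) * (C2 * h ^ (2 * p + 2)))
          = C1 * C2 * (h ^ (2 * p) * ((real N * h) * (real N * h) + (real N * h) * (h\<^sup>2 * T)))"
        by (simp only: distrib_left distrib_right power_add power2_eq_square mult_ac)
      also have "\<dots> \<le> C1 * C2 * (h ^ (2 * p) * (1 * 1 + 1 * (h\<^sup>2 * T)))"
        using C1 C2 h T by (intro mult_left_mono add_mono mult_mono mult_right_mono) auto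
      also have "\<dots> \<le> C * (h ^ (2 * p) * (1 * 1 + 1 * (h\<^sup>2 * T)))"
      proof (rule mult_right_mono)
        have "1 * 1 \<le> (1 + 2 * real l) * (1 + real l)" by (intro mult_mono) auto
        then show "C1 * C2 \<le> C"
          unfolding C_def using mult_left_mono[of 1 "(1 + 2 * real l) * (1 + real l)" "C1 * C2"] C1 C2
          by (simp add: mult.assoc)
      qed (use h T in auto)
      finally show "real N * ((C1 * real N + C1 * h * T) * (C2 * h ^ (2 * p + 2)))
          \<le> C * (h ^ (2 * p) * (1 + h\<^sup>2 * T))" by simp
      have "(\<Sum>j<N. of_bool (B j)) * ((C1 * real l + C1 * h * T) * (C2 * h ^ (2 * q + 2)))
          \<le> (2 * real l) * ((C1 * real l + C1 * h * T) * (C2 * h ^ (2 * q + 2)))"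
        using card C1 C2 h T by (intro mult_right_mono) auto
      also have "\<dots> = C1 * C2 * (h ^ (2 * q + 2) * ((2 * real l) * (real l + h * T)))"
        by (simp only: distrib_left distrib_right mult_ac)
      also have "(2 * real l) * (real l + h * T) \<le> (1 + 2 * real l) * ((1 + real l) * (1 + h * T))"
      proof (intro mult_mono)
        have "0 \<le> real l * (h * T)" using h T by simp
        then show "real l + h * T \<le> (1 + real l) * (1 + h * T)" by (simp add: algebra_simps)
      qed (use h T in auto)
      then have "C1 * C2 * (h ^ (2 * q + 2) * ((2 * real l) * (real l + h * T)))
          \<le> C1 * C2 * (h ^ (2 * q + 2) * ((1 + 2 * real l) * ((1 + real l) * (1 + h * T))))"
        using C1 C2 h by (intro mult_left_mono) auto
      also have "\<dots> = C * (h ^ (2 * q + 2) * (1 + h * T))"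
        unfolding C_def by (simp only: mult_ac)
      finally show "(\<Sum>j<N. of_bool (B j)) * ((C1 * real l + C1 * h * T) * (C2 * h ^ (2 * q + 2)))
          \<le> C * (h ^ (2 * q + 2) * (1 + h * T))" .
    qed
    also have "\<dots> = C * (h ^ (2 * p) * (1 + h\<^sup>2 * T) + h ^ (2 * q + 2) * (1 + h * T))"
      by (simp only: distrib_left)
    finally show "cmod (u (grid N (int i + 1)) - v $ i)
      \<le> C * (mesh N ^ (2 * p) * (1 + (mesh N)\<^sup>2 * inverse_symbol_sum l x N)
             + mesh N ^ (2 * q + 2) * (1 + mesh N * inverse_symbol_sum l x N))"
      unfolding h_def T_def .
  qed
qed

section \<open>Inverse sums near simple zeros\<close>

text \<open>The zeros of \<open>q a = p (cos a)\<close> are simple too, because \<open>sin a\<close> vanishes only where \<open>cos a\<close> is \<open>1\<close> or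
  \<open>- 1\<close>, and there \<open>p\<close> has no zero. By compactness \<open>\<bar>q a\<bar> + \<bar>q' a\<bar>\<close> is bounded below; so where \<open>q\<close> is small it
  moves with a speed that is bounded below on intervals of a fixed length \<open>\<eta>\<close>, and it cannot be small at two
  distant points of such an interval.\<close>

lemma simple_zero_spacing:
  fixes p :: "real poly"
  assumes simple: "\<And>t. t \<in> {-1..1} \<Longrightarrow> poly p t \<noteq> 0 \<or> poly (pderiv p) t \<noteq> 0"
    and ends: "poly p 1 \<noteq> 0" "poly p (- 1) \<noteq> 0"
  shows "\<exists>c>0. \<exists>\<eta>>0. \<forall>a\<in>{0..pi}. \<forall>b\<in>{0..pi}. b - a \<in> {0<..<\<eta>} \<longrightarrow>
    (\<forall>\<delta>\<le>c. \<bar>poly p (cos a)\<bar> < \<delta> \<longrightarrow> \<bar>poly p (cos b)\<bar> < \<delta> \<longrightarrow> b - a \<le> \<delta> / c)"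
proof -
  define q where "q a = poly p (cos a)" for a
  define q' where "q' a = - (sin a * poly (pderiv p) (cos a))" for a
  have deriv: "(q has_real_derivative q' a) (at a)" for a
    unfolding q_def q'_def
    by (rule derivative_eq_intros refl)+ simp
  have cont: "continuous_on {0..pi} (\<lambda>a. \<bar>q a\<bar> + \<bar>q' a\<bar>)" "continuous_on {0..pi} q'"
    unfolding q_def q'_def by (intro continuous_intros)+
  obtain a0 where a0: "a0 \<in> {0..pi}" "\<And>a. a \<in> {0..pi} \<Longrightarrow> \<bar>q a0\<bar> + \<bar>q' a0\<bar> \<le> \<bar>q a\<bar> + \<bar>q' a\<bar>"
    using continuous_attains_inf[OF _ _ cont(1)] by auto
  have "\<bar>q a0\<bar> + \<bar>q' a0\<bar> > 0"
  proof (cases "sin a0 = 0")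
    case True
    then have "(cos a0)\<^sup>2 = 1" using sin_cos_squared_add[of a0] by simp
    then have "cos a0 = 1 \<or> cos a0 = - 1" by (simp add: power2_eq_1_iff)
    then have "q a0 \<noteq> 0" using ends by (auto simp: q_def)
    then show ?thesis by linarith
  next
    case False
    then have "q a0 \<noteq> 0 \<or> q' a0 \<noteq> 0"
      using simple[of "cos a0"] by (auto simp: q_def q'_def)
    then show ?thesis by linarith
  qed
  then obtain c where c: "c > 0" "\<And>a. a \<in> {0..pi} \<Longrightarrow> c \<le> \<bar>q a\<bar> + \<bar>q' a\<bar>"
    using that[of "\<bar>q a0\<bar> + \<bar>q' a0\<bar>"] a0(2) by simp
  have "uniformly_continuous_on {0..pi} q'"
    using cont(2) by (intro compact_uniformly_continuous) auto
  moreover have "c / 4 > 0" using c(1) by simp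
  ultimately have "\<exists>\<eta>>0. \<forall>a\<in>{0..pi}. \<forall>b\<in>{0..pi}. dist b a < \<eta> \<longrightarrow> dist (q' b) (q' a) < c / 4"
    unfolding uniformly_continuous_on_def by (elim allE[of _ "c / 4"]) simp
  then obtain \<eta> where \<eta>: "\<eta> > 0"
    "\<And>a b. a \<in> {0..pi} \<Longrightarrow> b \<in> {0..pi} \<Longrightarrow> dist b a < \<eta> \<Longrightarrow> dist (q' b) (q' a) < c / 4"
    by blast
  have "b - a \<le> \<delta> / (c / 4)"
    if a: "a \<in> {0..pi}" and b: "b \<in> {0..pi}" and ab: "b - a \<in> {0<..<\<eta>}"
      and \<delta>: "\<delta> \<le> c / 4" "\<bar>q a\<bar> < \<delta>" "\<bar>q b\<bar> < \<delta>" for a b \<delta>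
  proof -
    obtain z where z: "a < z" "z < b" "q b - q a = (b - a) * q' z"
      using MVT2[of a b q q'] ab deriv by auto
    have "dist (q' z) (q' a) < c / 4"
      using z(1,2) a b ab by (intro \<eta>(2)) (auto simp: dist_real_def)
    moreover have "\<bar>q' a\<bar> \<ge> 3 * c / 4" using c(2)[OF a] \<delta> by linarith
    ultimately have "\<bar>q' z\<bar> \<ge> c / 2" unfolding dist_real_def by linarith
    then have "(b - a) * (c / 2) \<le> (b - a) * \<bar>q' z\<bar>"
      using ab by (intro mult_left_mono) auto
    also have "\<dots> = \<bar>q b - q a\<bar>"
      using z(3) ab by (simp add: abs_mult)
    also have "\<dots> \<le> 2 * \<delta>" using \<delta> by linarith
    finally have "(b - a) * (c / 4) \<le> \<delta>" by simp
    then show ?thesis using c(1) by (simp add: le_divide_eq del: divide_divide_eq_right)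
  qed
  then show ?thesis
    using c(1) \<eta>(1) unfolding q_def by (intro exI[of _ "c / 4"] exI[of _ \<eta>] conjI) auto
qed

text \<open>Two nodes are at least \<open>\<pi> / (N + 1)\<close> apart, so each of the finitely many intervals of length \<open>\<eta>\<close> contains at
  most one node where \<open>\<bar>p\<bar>\<close> is below \<open>c / (N + 1)\<close>. These nodes contribute at most \<open>1 / \<epsilon>\<close> each, all others at
  most \<open>(N + 1) / c\<close> each.\<close>

lemma inverse_sum_at_nodes:
  fixes p :: "real poly"
  assumes simple: "\<And>t. t \<in> {-1..1} \<Longrightarrow> poly p t \<noteq> 0 \<or> poly (pderiv p) t \<noteq> 0"
    and ends: "poly p 1 \<noteq> 0" "poly p (- 1) \<noteq> 0"
  shows "\<exists>K\<ge>0. \<forall>N \<epsilon>. \<epsilon> > 0 \<longrightarrow> (\<forall>k\<in>{1..N}. \<bar>poly p (cos (freq N k))\<bar> \<ge> \<epsilon>) \<longrightarrow>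
    (\<Sum>k = 1..N. 1 / \<bar>poly p (cos (freq N k))\<bar>) \<le> K * (1 / \<epsilon> + (real N + 1)\<^sup>2)"
proof -
  obtain c \<eta> where c: "c > 0" and \<eta>: "\<eta> > 0"
    and spacing: "\<And>a b \<delta>. a \<in> {0..pi} \<Longrightarrow> b \<in> {0..pi} \<Longrightarrow> b - a \<in> {0<..<\<eta>} \<Longrightarrow> \<delta> \<le> c \<Longrightarrow>
      \<bar>poly p (cos a)\<bar> < \<delta> \<Longrightarrow> \<bar>poly p (cos b)\<bar> < \<delta> \<Longrightarrow> b - a \<le> \<delta> / c"
    using simple_zero_spacing[OF simple ends] by blast
  define m where "m = nat \<lfloor>pi / \<eta>\<rfloor> + 1"
  define K where "K = real m + 1 / c"
  have "(\<Sum>k = 1..N. 1 / \<bar>poly p (cos (freq N k))\<bar>) \<le> K * (1 / \<epsilon> + (real N + 1)\<^sup>2)"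
    if \<epsilon>: "\<epsilon> > 0" and low: "\<And>k. k \<in> {1..N} \<Longrightarrow> \<bar>poly p (cos (freq N k))\<bar> \<ge> \<epsilon>" for N \<epsilon>
  proof -
    let ?q = "\<lambda>k. \<bar>poly p (cos (freq N k))\<bar>"
    define \<delta> where "\<delta> = c / (real N + 1)"
    have \<delta>: "\<delta> > 0" "\<delta> \<le> c"
      using c by (auto simp: \<delta>_def divide_le_eq mult_left_mono)
    define bad where "bad = {k\<in>{1..N}. ?q k < \<delta>}"
    have range: "freq N k \<in> {0..pi}" if "k \<in> {1..N}" for k
      using freq_bounds[OF that] by auto
    have gap: "\<not> freq N j - freq N i < \<eta>" if ij: "i < j" "i \<in> bad" "j \<in> bad" for i j
    proof
      assume less: "freq N j - freq N i < \<eta>"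
      have "freq N j - freq N i = (real j - real i) * pi / (real N + 1)"
        by (simp add: freq_def left_diff_distrib diff_divide_distrib)
      moreover have "1 * pi \<le> (real j - real i) * pi"
        using ij(1) by (intro mult_right_mono) auto
      ultimately have ge: "freq N j - freq N i \<ge> pi / (real N + 1)"
        by (simp add: divide_right_mono)
      then have "freq N j - freq N i > 0"
        by (rule less_le_trans[rotated]) simp
      then have "freq N j - freq N i \<le> \<delta> / c"
        using ij less range \<delta>(2) by (intro spacing) (auto simp: bad_def)
      also have "\<delta> / c = 1 / (real N + 1)" using c by (simp add: \<delta>_def)
      also have "\<dots> < pi / (real N + 1)"
        using pi_gt3 by (intro divide_strict_right_mono) auto
      finally show False using ge by simp
    qed
    \<comment> \<open>The value of the map is the number of the interval of length \<open>\<eta>\<close> that contains the node.\<close>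
    have inj: "inj_on (\<lambda>k. \<lfloor>freq N k / \<eta>\<rfloor>) bad"
    proof (rule inj_onI)
      fix i j assume ij: "i \<in> bad" "j \<in> bad" and eq: "\<lfloor>freq N i / \<eta>\<rfloor> = \<lfloor>freq N j / \<eta>\<rfloor>"
      have "\<bar>freq N i / \<eta> - freq N j / \<eta>\<bar> < 1" using eq by linarith
      then have "\<bar>(freq N i - freq N j) / \<eta>\<bar> < 1" by (simp add: diff_divide_distrib)
      then have "\<bar>freq N i - freq N j\<bar> < \<eta>" using \<eta> by (simp add: abs_divide)
      then show "i = j"
        using gap[of i j] gap[of j i] ij by (cases i j rule: linorder_cases) auto
    qed
    have "(\<lambda>k. \<lfloor>freq N k / \<eta>\<rfloor>) ` bad \<subseteq> {0..\<lfloor>pi / \<eta>\<rfloor>}"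
    proof (rule image_subsetI)
      fix k assume "k \<in> bad"
      then have "freq N k \<in> {0..pi}" using range by (simp add: bad_def)
      then show "\<lfloor>freq N k / \<eta>\<rfloor> \<in> {0..\<lfloor>pi / \<eta>\<rfloor>}"
        using \<eta> by (auto intro!: floor_mono divide_right_mono)
    qed
    then have "card bad \<le> card {0..\<lfloor>pi / \<eta>\<rfloor>}"
      using inj by (intro card_inj_on_le) auto
    also have "\<dots> = m"
      using \<eta> by (simp add: m_def nat_add_distrib)
    finally have card: "card bad \<le> m" .
    have sub: "bad \<subseteq> {1..N}" by (auto simp: bad_def)
    have "(\<Sum>k = 1..N. 1 / ?q k) = (\<Sum>k\<in>bad. 1 / ?q k) + (\<Sum>k\<in>{1..N} - bad. 1 / ?q k)"
      using sum.subset_diff[of bad "{1..N}" "\<lambda>k. 1 / ?q k"] by (simp only: sub finite_atLeastAtMost add.commute)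
    also have "\<dots> \<le> real m * (1 / \<epsilon>) + real N * (1 / \<delta>)"
    proof (rule add_mono)
      have "(\<Sum>k\<in>bad. 1 / ?q k) \<le> real (card bad) * (1 / \<epsilon>)"
        using low \<epsilon> by (intro sum_bounded_above divide_left_mono mult_pos_pos) (force simp: bad_def)+
      also have "\<dots> \<le> real m * (1 / \<epsilon>)"
        using card \<epsilon> by (intro mult_right_mono) auto
      finally show "(\<Sum>k\<in>bad. 1 / ?q k) \<le> real m * (1 / \<epsilon>)" .
      have "(\<Sum>k\<in>{1..N} - bad. 1 / ?q k) \<le> real (card ({1..N} - bad)) * (1 / \<delta>)"
        using \<delta>(1) low \<epsilon> by (intro sum_bounded_above divide_left_mono mult_pos_pos) (force simp: bad_def)+
      also have "\<dots> \<le> real N * (1 / \<delta>)"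
        using \<delta>(1) card_mono[of "{1..N}" "{1..N} - bad"] by (intro mult_right_mono) auto
      finally show "(\<Sum>k\<in>{1..N} - bad. 1 / ?q k) \<le> real N * (1 / \<delta>)" .
    qed
    also have "real N * (1 / \<delta>) \<le> (1 / c) * (real N + 1)\<^sup>2"
    proof -
      have "real N * (real N + 1) \<le> (real N + 1) * (real N + 1)" by (intro mult_right_mono) auto
      then show ?thesis using c by (simp add: \<delta>_def power2_eq_square divide_right_mono)
    qed
    also have "real m * (1 / \<epsilon>) + (1 / c) * (real N + 1)\<^sup>2 \<le> K * (1 / \<epsilon>) + K * (real N + 1)\<^sup>2"
      using c \<epsilon> by (intro add_mono mult_right_mono) (auto simp: K_def)
    finally show ?thesis by (simp add: distrib_left)
  qed
  moreover have "K \<ge> 0" using c by (simp add: K_def)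
  ultimately show ?thesis by blast
qed

section \<open>Exceptional sets of measure zero\<close>

lemma AE_PiM_lborel_coordinate:
  fixes G :: "(nat \<Rightarrow> 'a::euclidean_space) \<Rightarrow> bool"
  defines "M \<equiv> \<lambda>J. (\<Pi>\<^sub>M k\<in>J. (lborel :: 'a measure))"
  assumes I: "finite I" "i \<notin> I"
    and meas: "Measurable.pred (M (insert i I)) G"
    and slice: "\<And>x. AE y in lborel. G (x(i := y))"
  shows "AE x in M (insert i I). G x"
proof -
  interpret product_sigma_finite "\<lambda>_::nat. (lborel :: 'a measure)" ..
  define f :: "(nat \<Rightarrow> 'a) \<Rightarrow> ennreal" where "f x = indicator {x. \<not> G x} x" for x
  have f[measurable]: "f \<in> borel_measurable (M (insert i I))"
    unfolding f_def using meas by measurable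
  have "integral\<^sup>N (M (insert i I)) f = (\<integral>\<^sup>+ x. (\<integral>\<^sup>+ y. f (x(i := y)) \<partial>lborel) \<partial>M I)"
    using f unfolding M_def by (intro product_nn_integral_insert I)
  also have "\<dots> = (\<integral>\<^sup>+ x. 0 \<partial>M I)"
  proof (rule nn_integral_cong)
    fix x
    have "AE y in lborel. f (x(i := y)) = 0"
      using slice[of x] by eventually_elim (simp add: f_def)
    then show "(\<integral>\<^sup>+ y. f (x(i := y)) \<partial>lborel) = 0"
      by (subst nn_integral_cong_AE[of _ "\<lambda>_. 0"]) auto
  qed
  also have "\<dots> = 0" by simp
  finally have "AE x in M (insert i I). f x = 0"
    by (simp add: nn_integral_0_iff_AE)
  then show ?thesis
    by eventually_elim (auto simp: f_def indicator_def split: if_splits)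
qed

text \<open>Lower bounds on \<open>[- 1, 1]\<close> are stated on the rationals below: a countable intersection of conditions is
  visibly measurable in the coefficients, and by continuity nothing is lost.\<close>

lemma ge_on_rationals_imp_ge:
  fixes F :: "real \<Rightarrow> real"
  assumes cont: "continuous_on UNIV F" and rat: "\<And>q. (of_rat q :: real) \<in> {-1..1} \<Longrightarrow> F (of_rat q) \<ge> c"
    and t: "t \<in> {-1..1}"
  shows "F t \<ge> c"
proof (rule ccontr)
  assume "\<not> F t \<ge> c"
  then have "t \<in> F -` {..<c}" by simp
  moreover have "open (F -` {..<c})"
    using cont by (intro open_vimage) auto
  ultimately obtain e where e: "e > 0" "\<And>s. dist s t < e \<Longrightarrow> F s < c"
    by (auto simp: open_dist)
  have "max (- 1) (t - e) < min 1 (t + e)" using e(1) t by auto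
  then obtain q :: rat where "max (- 1) (t - e) < of_rat q" "of_rat q < min 1 (t + e)"
    using of_rat_dense by blast
  then have "of_rat q \<in> {-1..1::real}" "dist (of_rat q) t < e"
    by (auto simp: dist_real_def)
  then show False using rat[of q] e(2)[of "of_rat q"] by simp
qed

text \<open>The terms are dominated by the differences of \<open>1 / ln (n + 2)\<close>, a telescoping series. The shift by
  two keeps the logarithm away from zero.\<close>

lemma sum_log_summable: "summable (\<lambda>n. 1 / ((real n + 2) * (ln (real n + 2))\<^sup>2))"
proof -
  have tele: "1 / ((real n + 3) * (ln (real n + 3))\<^sup>2) \<le> 1 / ln (real n + 2) - 1 / ln (real (Suc n) + 2)" for n
  proof -
    define a b where "a = ln (real n + 2)" and "b = ln (real n + 3)"
    have a: "a > 0" and b: "b > 0" and ab: "a \<le> b" by (simp_all add: a_def b_def)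
    have "ln ((real n + 2) / (real n + 3)) \<le> (real n + 2) / (real n + 3) - 1"
      by (rule ln_le_minus_one) simp
    also have "(real n + 2) / (real n + 3) - 1 = - (1 / (real n + 3))"
      by (simp add: field_simps)
    finally have "1 / (real n + 3) \<le> b - a"
      by (simp add: a_def b_def ln_div)
    then have "1 / (real n + 3) / b\<^sup>2 \<le> (b - a) / b\<^sup>2"
      by (rule divide_right_mono) simp
    also have "\<dots> \<le> (b - a) / (a * b)"
      using a b ab by (intro divide_left_mono) (auto simp: power2_eq_square)
    also have "\<dots> = 1 / a - 1 / b"
      using a b by (simp add: field_simps)
    finally show ?thesis by (simp add: a_def b_def add.commute)
  qed
  have lim: "(\<lambda>n. 1 / ln (real n + 2)) \<longlonglongrightarrow> 0"
    by real_asymp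
  have "summable (\<lambda>n. 1 / ln (real n + 2) - 1 / ln (real (Suc n) + 2))"
    using telescope_summable'[OF lim] .
  then have "summable (\<lambda>n. 1 / ((real n + 3) * (ln (real n + 3))\<^sup>2))"
    by (rule summable_comparison_test'[where N = 0]) (use tele in simp)
  then have "summable (\<lambda>n. 1 / ((real (Suc n) + 2) * (ln (real (Suc n) + 2))\<^sup>2))"
    by (simp add: add.commute add.left_commute)
  then show ?thesis by (rule iffD1[OF summable_Suc_iff])
qed

text \<open>For a given \<open>N\<close> the excluded set consists of \<open>N\<close> intervals of length \<open>2 / ((N + 1) ln (N + 1))\<^sup>2\<close>. Its
  measure is summable in \<open>N\<close>, and the Borel-Cantelli lemma applies. The exponent \<open>2\<close> of the logarithm is
  the source of the squared logarithm in the rate of convergence.\<close>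

lemma AE_far_from_nodes:
  fixes Q :: "nat \<Rightarrow> nat \<Rightarrow> real"
  shows "AE y in lborel. \<exists>N0. \<forall>N\<ge>N0. \<forall>k\<in>{1..N}. \<bar>y + Q N k\<bar> \<ge> 1 / ((real N + 1)\<^sup>2 * (ln (real N + 1))\<^sup>2)"
proof -
  \<comment> \<open>Here \<open>n\<close> stands for \<open>N - 1\<close>, so that the logarithm never vanishes.\<close>
  define \<delta> where "\<delta> n = 1 / ((real n + 2)\<^sup>2 * (ln (real n + 2))\<^sup>2)" for n :: nat
  define A where "A n = (\<Union>k\<in>{1..n + 1}. {- Q (n + 1) k - \<delta> n<..<- Q (n + 1) k + \<delta> n})" for n
  have A[measurable]: "A n \<in> sets lborel" for n
    by (simp add: A_def)
  have \<delta>: "\<delta> n \<ge> 0" for n by (simp add: \<delta>_def)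
  have em: "emeasure lborel (A n) \<le> ennreal (2 / ((real n + 2) * (ln (real n + 2))\<^sup>2))" for n
  proof -
    have "emeasure lborel (A n) \<le> (\<Sum>k\<in>{1..n + 1}. emeasure lborel {- Q (n + 1) k - \<delta> n<..<- Q (n + 1) k + \<delta> n})"
      unfolding A_def by (rule emeasure_subadditive_finite) auto
    also have "\<dots> = (\<Sum>k\<in>{1..n + 1}. ennreal (2 * \<delta> n))"
      using \<delta>[of n] by (intro sum.cong) auto
    also have "\<dots> = ennreal (real (n + 1) * (2 * \<delta> n))"
      using \<delta>[of n] by (simp add: ennreal_mult ennreal_of_nat_eq_real_of_nat)
    also have "\<dots> \<le> ennreal (2 / ((real n + 2) * (ln (real n + 2))\<^sup>2))"
    proof (rule ennreal_leI)
      have "real (n + 1) * (2 * \<delta> n) \<le> (real n + 2) * (2 * \<delta> n)"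
        using \<delta>[of n] by (intro mult_right_mono) auto
      also have "\<dots> = 2 / ((real n + 2) * (ln (real n + 2))\<^sup>2)"
      proof -
        have "a * (2 * (1 / (a\<^sup>2 * b))) = 2 / (a * b)" if "a \<noteq> 0" for a b :: real
          using that by (simp add: power2_eq_square)
        moreover have "real n + 2 \<noteq> 0" by linarith
        ultimately show ?thesis unfolding \<delta>_def by blast
      qed
      finally show "real (n + 1) * (2 * \<delta> n) \<le> 2 / ((real n + 2) * (ln (real n + 2))\<^sup>2)" .
    qed
    finally show ?thesis .
  qed
  have "AE y in lborel. eventually (\<lambda>n. y \<in> space lborel - A n) sequentially"
  proof (rule borel_cantelli_AE1[OF A])
    show "emeasure lborel (A n) < \<infinity>" for n
      using em[of n] by (simp add: order_le_less_trans)
    have "measure lborel (A n) \<le> 2 * (1 / ((real n + 2) * (ln (real n + 2))\<^sup>2))" for n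
      unfolding measure_def using em[of n] by (intro enn2real_leI) auto
    then have "norm (measure lborel (A n)) \<le> 2 * (1 / ((real n + 2) * (ln (real n + 2))\<^sup>2))" for n
      by (simp only: real_norm_def abs_of_nonneg measure_nonneg)
    then show "summable (\<lambda>n. measure lborel (A n))"
      by (rule summable_comparison_test'[OF summable_mult[OF sum_log_summable, of 2]])
  qed
  then show ?thesis
  proof eventually_elim
    case (elim y)
    then obtain n0 where n0: "\<And>n. n \<ge> n0 \<Longrightarrow> y \<notin> A n"
      by (auto simp: eventually_sequentially)
    have "\<bar>y + Q N k\<bar> \<ge> 1 / ((real N + 1)\<^sup>2 * (ln (real N + 1))\<^sup>2)"
      if N: "N \<ge> n0 + 1" and k: "k \<in> {1..N}" for N k
    proof -
      have "y \<notin> A (N - 1)" using n0 N by simp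
      moreover have e: "N - 1 + 1 = N" "real (N - 1) + 2 = real N + 1" using N by auto
      ultimately have "y \<notin> {- Q N k - \<delta> (N - 1)<..<- Q N k + \<delta> (N - 1)}"
        using k unfolding A_def e by blast
      moreover have "\<delta> (N - 1) = 1 / ((real N + 1)\<^sup>2 * (ln (real N + 1))\<^sup>2)"
        unfolding \<delta>_def e ..
      ultimately show ?thesis
        unfolding greaterThanLessThan_iff by linarith
    qed
    then show ?case by blast
  qed
qed

definition bounded_away_from_zero :: "nat \<Rightarrow> (nat \<Rightarrow> complex) \<Rightarrow> bool" where
  "bounded_away_from_zero l x \<longleftrightarrow>
     (\<exists>m::nat. \<forall>q. (of_rat q :: real) \<in> {-1..1} \<longrightarrow> cmod (reduced_symbol l x (of_rat q)) \<ge> 1 / (real m + 1))"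

lemma continuous_reduced_symbol: "continuous_on A (reduced_symbol l x)"
  unfolding reduced_symbol_def by (intro continuous_intros)

lemma bounded_away_from_zeroD:
  assumes "bounded_away_from_zero l x"
  obtains c where "c > 0" "\<And>t. t \<in> {-1..1} \<Longrightarrow> cmod (reduced_symbol l x t) \<ge> c"
proof -
  obtain m :: nat where m: "\<And>q. (of_rat q :: real) \<in> {-1..1} \<Longrightarrow> cmod (reduced_symbol l x (of_rat q)) \<ge> 1 / (real m + 1)"
    using assms unfolding bounded_away_from_zero_def by blast
  have "cmod (reduced_symbol l x t) \<ge> 1 / (real m + 1)" if "t \<in> {-1..1}" for t
    using ge_on_rationals_imp_ge[OF continuous_on_norm[OF continuous_reduced_symbol] m that] .
  then show thesis by (intro that[of "1 / (real m + 1)"]) auto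
qed

lemma exists_inverse_nat_bound:
  fixes F :: "real \<Rightarrow> real"
  assumes "continuous_on {-1..1} F" "\<And>t. t \<in> {-1..1} \<Longrightarrow> F t > 0"
  shows "\<exists>m::nat. \<forall>t\<in>{-1..1}. F t \<ge> 1 / (real m + 1)"
proof -
  obtain t0 where t0: "t0 \<in> {-1..1}" "\<And>t. t \<in> {-1..1} \<Longrightarrow> F t0 \<le> F t"
    using continuous_attains_inf[OF _ _ assms(1)] by auto
  obtain m where m: "inverse (real (Suc m)) < F t0"
    using reals_Archimedean[OF assms(2)[OF t0(1)]] by blast
  have "F t \<ge> 1 / (real m + 1)" if "t \<in> {-1..1}" for t
    using t0(2)[OF that] m by (simp add: inverse_eq_divide add.commute)
  then show ?thesis by blast
qed

lemma coordinate_indices: "{1..l + 1} = insert 1 {2..l + 1}" for l :: nat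
  by auto

lemma measurable_coordinate:
  "k \<in> I \<Longrightarrow> (\<lambda>x. x k) \<in> borel_measurable (\<Pi>\<^sub>M k\<in>I. (lborel :: 'a::euclidean_space measure))"
  using measurable_component_singleton[of k I "\<lambda>_. lborel :: 'a measure"] by simp

text \<open>With the other coordinates fixed, the symbol is \<open>y + Q t\<close>. It has a zero in \<open>[- 1, 1]\<close> exactly if \<open>y\<close> lies
  on the curve \<open>- Q [- 1, 1]\<close>, and a differentiable curve is negligible in the plane.\<close>

lemma AE_bounded_away_from_zero:
  "AE x in (\<Pi>\<^sub>M k\<in>{1..l + 1}. (lborel :: complex measure)). bounded_away_from_zero l x"
  unfolding coordinate_indices
proof (rule AE_PiM_lborel_coordinate)
  let ?I = "insert 1 {2..l + 1}"
  have [measurable]: "(\<lambda>x. reduced_symbol l x t) \<in> borel_measurable (\<Pi>\<^sub>M k\<in>?I. (lborel :: complex measure))" for t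
    unfolding reduced_symbol_def coordinate_indices
    by (intro borel_measurable_sum borel_measurable_times measurable_coordinate borel_measurable_const)
  show "Measurable.pred (\<Pi>\<^sub>M k\<in>?I. (lborel :: complex measure)) (bounded_away_from_zero l)"
    unfolding bounded_away_from_zero_def by measurable
  fix x :: "nat \<Rightarrow> complex"
  define Q where "Q t = (\<Sum>k = 2..l + 1. x k * of_real (poly (fejer k) t))" for t
  have slice: "reduced_symbol l (x(1 := y)) t = y + Q t" for y t
    unfolding reduced_symbol_def coordinate_indices Q_def by simp
  have "(\<lambda>t. - Q t) differentiable (at t within {-1..1})" for t
  proof -
    have "((\<lambda>t. complex_of_real (poly (fejer k) t)) has_vector_derivative of_real (poly (pderiv (fejer k)) t))
        (at t within {-1..1})" for k
      by (intro has_vector_derivative_of_real poly_DERIV[THEN DERIV_subset]) simp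
    then have "(Q has_vector_derivative (\<Sum>k = 2..l + 1. x k * of_real (poly (pderiv (fejer k)) t))) (at t within {-1..1})"
      unfolding Q_def by (intro has_vector_derivative_sum has_vector_derivative_mult_right)
    then have "Q differentiable (at t within {-1..1})"
      by (rule differentiableI_vector)
    then show ?thesis by (rule differentiable_minus)
  qed
  then have "negligible ((\<lambda>t. - Q t) ` {-1..1})"
    by (intro negligible_differentiable_image_lowdim) (auto simp: differentiable_on_def)
  then have "AE y in lebesgue. y \<notin> (\<lambda>t. - Q t) ` {-1..1}"
    by (intro AE_not_in) (simp add: negligible_iff_null_sets)
  then have "AE y in lborel. y \<notin> (\<lambda>t. - Q t) ` {-1..1}"
    by (simp only: AE_completion_iff)
  then show "AE y in lborel. bounded_away_from_zero l (x(1 := y))"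
  proof eventually_elim
    case (elim y)
    have "cmod (reduced_symbol l (x(1 := y)) t) > 0" if "t \<in> {-1..1}" for t
      using elim that unfolding slice by (auto simp: add_eq_0_iff2)
    then have "\<exists>m::nat. \<forall>t\<in>{-1..1}. cmod (reduced_symbol l (x(1 := y)) t) \<ge> 1 / (real m + 1)"
      by (intro exists_inverse_nat_bound continuous_on_norm continuous_reduced_symbol)
    then show ?case unfolding bounded_away_from_zero_def by blast
  qed
qed auto

definition real_symbol :: "nat \<Rightarrow> (nat \<Rightarrow> real) \<Rightarrow> real poly" where
  "real_symbol l x = (\<Sum>k = 1..l + 1. Polynomial.smult (x k) (fejer k))"

lemma reduced_symbol_of_real:
  "reduced_symbol l (\<lambda>k. of_real (x k)) t = of_real (poly (real_symbol l x) t)"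
  by (simp add: reduced_symbol_def real_symbol_def poly_sum)

text \<open>What almost every real symbol satisfies and what the rate in the real case rests on. The third condition
  makes all zeros in \<open>[- 1, 1]\<close> simple; it is quantitative and restricted to rational points to be measurable in
  the coefficients. The last two concern the eigenvalues: they are never zero, and for large \<open>N\<close> not too small.\<close>

definition generic_symbol :: "real poly \<Rightarrow> bool" where
  "generic_symbol P \<longleftrightarrow>
     poly P 1 \<noteq> 0 \<and> poly P (- 1) \<noteq> 0 \<and>
     (\<exists>m::nat. \<forall>q. (of_rat q :: real) \<in> {-1..1} \<longrightarrow>
        \<bar>poly P (of_rat q)\<bar> + \<bar>poly (pderiv P) (of_rat q)\<bar> \<ge> 1 / (real m + 1)) \<and>
     (\<forall>N. \<forall>k\<in>{1..N}. poly P (cos (freq N k)) \<noteq> 0) \<and>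
     (\<exists>N0. \<forall>N\<ge>N0. \<forall>k\<in>{1..N}. \<bar>poly P (cos (freq N k))\<bar> \<ge> 1 / ((real N + 1)\<^sup>2 * (ln (real N + 1))\<^sup>2))"

lemma AE_translate_not_zero:
  "AE y in lborel. y + c \<noteq> (0 :: real)"
proof -
  have "AE y in lborel. y \<notin> {- c}"
    by (intro AE_not_in countable_imp_null_set_lborel) simp
  then show ?thesis by eventually_elim (auto simp: add_eq_0_iff2)
qed

text \<open>A multiple zero of \<open>y + R\<close> makes \<open>- y\<close> a critical value of \<open>R\<close>. A polynomial has only finitely many
  critical values: if \<open>R\<close> is constant it has a single value, otherwise its derivative has finitely
  many zeros.\<close>

lemma AE_generic_translate:
  "AE y in lborel. generic_symbol ([:y:] + R)"
proof -
  define E where "E = (\<lambda>t. - poly R t) ` {t. poly (pderiv R) t = 0}"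
  have "finite E"
  proof (cases "pderiv R = 0")
    case True
    then obtain a where "R = [:a:]"
      by (metis degree_eq_zeroE pderiv_eq_0_iff)
    then have "E \<subseteq> {- a}" by (auto simp: E_def)
    then show ?thesis by (rule finite_subset) simp
  next
    case False
    then show ?thesis unfolding E_def by (intro finite_imageI poly_roots_finite)
  qed
  then have "AE y in lborel. y \<notin> E"
    by (intro AE_not_in countable_imp_null_set_lborel countable_finite)
  moreover have "AE y in lborel. \<forall>N k. y + poly R (cos (freq N k)) \<noteq> 0"
    unfolding AE_all_countable by (intro allI AE_translate_not_zero)
  ultimately show ?thesis
    using AE_far_from_nodes[of "\<lambda>N k. poly R (cos (freq N k))"]
      AE_translate_not_zero[of "poly R 1"] AE_translate_not_zero[of "poly R (- 1)"]
  proof eventually_elim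
    case (elim y)
    have "\<bar>y + poly R t\<bar> + \<bar>poly (pderiv R) t\<bar> > 0" for t
    proof (cases "poly (pderiv R) t = 0")
      case True
      then have "- poly R t \<in> E" by (auto simp: E_def)
      then have "y \<noteq> - poly R t" using elim(1) by blast
      then show ?thesis by (simp add: add_eq_0_iff2)
    qed linarith
    then have "\<exists>m::nat. \<forall>t\<in>{-1..1}. \<bar>y + poly R t\<bar> + \<bar>poly (pderiv R) t\<bar> \<ge> 1 / (real m + 1)"
      by (intro exists_inverse_nat_bound continuous_intros)
    then obtain m :: nat where m: "\<forall>t\<in>{-1..1}. \<bar>y + poly R t\<bar> + \<bar>poly (pderiv R) t\<bar> \<ge> 1 / (real m + 1)"
      by (elim exE)
    have eqs: "pderiv ([:y:] + R) = pderiv R" "poly ([:y:] + R) t = y + poly R t" for t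
      by (simp_all add: pderiv_add pderiv_pCons)
    show ?case
      unfolding generic_symbol_def eqs
    proof (intro conjI)
      show "\<exists>m::nat. \<forall>q. (of_rat q :: real) \<in> {-1..1} \<longrightarrow>
          \<bar>y + poly R (of_rat q)\<bar> + \<bar>poly (pderiv R) (of_rat q)\<bar> \<ge> 1 / (real m + 1)"
        by (intro exI[of _ m] allI impI) (rule bspec[OF m])
    qed (use elim in blast)+
  qed
qed

lemma pderiv_sum_smult: "pderiv (\<Sum>k\<in>I. Polynomial.smult (x k) (p k)) = (\<Sum>k\<in>I. Polynomial.smult (x k) (pderiv (p k)))"
  by (induction I rule: infinite_finite_induct) (simp_all add: pderiv_add pderiv_smult)

lemma AE_generic_real_symbol:
  "AE x in (\<Pi>\<^sub>M k\<in>{1..l + 1}. (lborel :: real measure)). generic_symbol (real_symbol l x)"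
  unfolding coordinate_indices
proof (rule AE_PiM_lborel_coordinate)
  let ?I = "insert 1 {2..l + 1}"
  have [measurable]: "(\<lambda>x. poly (real_symbol l x) t) \<in> borel_measurable (\<Pi>\<^sub>M k\<in>?I. (lborel :: real measure))" for t
    unfolding real_symbol_def coordinate_indices poly_sum poly_smult
    by (intro borel_measurable_sum borel_measurable_times measurable_coordinate borel_measurable_const)
  have [measurable]: "(\<lambda>x. poly (pderiv (real_symbol l x)) t) \<in> borel_measurable (\<Pi>\<^sub>M k\<in>?I. (lborel :: real measure))" for t
    unfolding real_symbol_def coordinate_indices pderiv_sum_smult poly_sum poly_smult
    by (intro borel_measurable_sum borel_measurable_times measurable_coordinate borel_measurable_const)
  show "Measurable.pred (\<Pi>\<^sub>M k\<in>?I. (lborel :: real measure)) (\<lambda>x. generic_symbol (real_symbol l x))"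
    unfolding generic_symbol_def Ball_def by measurable
  fix x :: "nat \<Rightarrow> real"
  have "real_symbol l (x(1 := y)) = [:y:] + (\<Sum>k = 2..l + 1. Polynomial.smult (x k) (fejer k))" for y
    unfolding real_symbol_def coordinate_indices by simp
  then show "AE y in lborel. generic_symbol (real_symbol l (x(1 := y)))"
    using AE_generic_translate by simp
qed auto

lemma generic_inverse_symbol_sum:
  assumes g: "generic_symbol (real_symbol l x)"
  shows "\<exists>K\<ge>0. \<exists>N0. \<forall>N\<ge>N0. inverse_symbol_sum l (\<lambda>k. of_real (x k)) N \<le> K * (real N + 1)\<^sup>2 * (1 + (ln (real N + 1))\<^sup>2)"
proof -
  let ?P = "real_symbol l x"
  obtain m :: nat where m: "\<And>q. (of_rat q :: real) \<in> {-1..1} \<Longrightarrow>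
      \<bar>poly ?P (of_rat q)\<bar> + \<bar>poly (pderiv ?P) (of_rat q)\<bar> \<ge> 1 / (real m + 1)"
    using g unfolding generic_symbol_def by blast
  have "\<bar>poly ?P t\<bar> + \<bar>poly (pderiv ?P) t\<bar> \<ge> 1 / (real m + 1)" if "t \<in> {-1..1}" for t
    by (rule ge_on_rationals_imp_ge[where F = "\<lambda>t. \<bar>poly ?P t\<bar> + \<bar>poly (pderiv ?P) t\<bar>", OF _ m that])
      (intro continuous_intros)
  moreover have "1 / (real m + 1) > 0" by simp
  ultimately have simple: "poly ?P t \<noteq> 0 \<or> poly (pderiv ?P) t \<noteq> 0" if "t \<in> {-1..1}" for t
    using order_less_le_trans[OF \<open>1 / (real m + 1) > 0\<close>] that by fastforce
  obtain K where K: "K \<ge> 0" and sum: "\<forall>N \<epsilon>. \<epsilon> > 0 \<longrightarrow> (\<forall>k\<in>{1..N}. \<bar>poly ?P (cos (freq N k))\<bar> \<ge> \<epsilon>) \<longrightarrow>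
    (\<Sum>k = 1..N. 1 / \<bar>poly ?P (cos (freq N k))\<bar>) \<le> K * (1 / \<epsilon> + (real N + 1)\<^sup>2)"
    using inverse_sum_at_nodes[of ?P, OF simple] g unfolding generic_symbol_def by (elim exE conjE) blast
  obtain N0 where N0: "\<And>N k. N \<ge> N0 \<Longrightarrow> k \<in> {1..N} \<Longrightarrow>
      \<bar>poly ?P (cos (freq N k))\<bar> \<ge> 1 / ((real N + 1)\<^sup>2 * (ln (real N + 1))\<^sup>2)"
    using g unfolding generic_symbol_def by blast
  have "inverse_symbol_sum l (\<lambda>k. of_real (x k)) N \<le> K * (real N + 1)\<^sup>2 * (1 + (ln (real N + 1))\<^sup>2)"
    if N: "N \<ge> max N0 1" for N
  proof -
    let ?L = "(real N + 1)\<^sup>2 * (ln (real N + 1))\<^sup>2"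
    have "?L > 0" using N by (intro mult_pos_pos) (auto simp: ln_gt_zero_iff)
    then have "(\<Sum>k = 1..N. 1 / \<bar>poly ?P (cos (freq N k))\<bar>) \<le> K * (1 / (1 / ?L) + (real N + 1)\<^sup>2)"
      using N N0 by (intro sum[rule_format]) auto
    then show ?thesis
      by (simp add: inverse_symbol_sum_def reduced_symbol_of_real algebra_simps)
  qed
  then show ?thesis using K by blast
qed

section \<open>Convergence for almost all formulas\<close>

lemma max_norm_le:
  assumes "dim_vec v \<ge> 1" "\<And>j. j < dim_vec v \<Longrightarrow> cmod (v $ j) \<le> B"
  shows "max_norm v \<le> B"
proof -
  have "0 \<in> {..<dim_vec v}" using assms(1) by simp
  then have "{..<dim_vec v} \<noteq> {}" by blast
  then show ?thesis
    unfolding max_norm_def using assms(2) by (subst Max_le_iff) auto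
qed

lemma invertible_mat_unique_solution:
  fixes A :: "complex mat"
  assumes inv: "invertible_mat A" and A: "A \<in> carrier_mat N N"
    and v: "v \<in> carrier_vec N" and w: "w \<in> carrier_vec N" and eq: "A *\<^sub>v v = A *\<^sub>v w"
  shows "v = w"
proof -
  obtain B where B: "A * B = 1\<^sub>m (dim_row A)" "B * A = 1\<^sub>m (dim_row B)"
    using inv unfolding invertible_mat_def inverts_mat_def by blast
  have "dim_col B = N" using arg_cong[OF B(1), of dim_col] A by simp
  moreover have "dim_row B = N" using arg_cong[OF B(2), of dim_col] A by simp
  ultimately have Bc: "B \<in> carrier_mat N N" by blast
  have "B *\<^sub>v (A *\<^sub>v v) = v" if "v \<in> carrier_vec N" for v
    using assoc_mult_mat_vec[OF Bc A that] B(2) Bc that by simp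
  then show ?thesis using v w eq by metis
qed

text \<open>An error bound for large \<open>N\<close> is enough: for each of the finitely many remaining \<open>N\<close> the system has at most
  one solution, so its error is a single number, and \<open>\<epsilon> N > 0\<close> allows it to be absorbed into the constant.\<close>

lemma convergent_at_rateI:
  assumes S: "associated_S l n \<mu> d S"
    and D: "\<And>N. D N \<in> carrier_mat N N" "\<And>N. N \<ge> 1 \<Longrightarrow> invertible_mat (D N)"
    and pos: "\<And>N. N \<ge> 1 \<Longrightarrow> \<epsilon> N > 0"
    and bound: "\<And>f u. C_infinity f \<Longrightarrow> solves_dirichlet f u \<Longrightarrow> \<exists>C N0. \<forall>N\<ge>N0. \<forall>v\<in>carrier_vec N.
       D N *\<^sub>v v = (of_real (mesh N))\<^sup>2 \<cdot>\<^sub>v S_operator l n \<mu> d N (\<lambda>j. f (grid N j)) \<longrightarrow>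
       (\<forall>j<N. cmod (u (grid N (int j + 1)) - v $ j) \<le> C * \<epsilon> N)"
  shows "convergent_at_rate D S \<epsilon>"
  unfolding convergent_at_rate_def
proof (intro conjI allI impI)
  show "invertible_mat (D N)" if "N \<ge> 1" for N using D(2)[OF that] .
  fix f u assume f: "C_infinity f" and u: "solves_dirichlet f u"
  define err where "err N v = max_norm (vec N (\<lambda>j. u (grid N (int j + 1))) - v)" for N and v :: "complex vec"
  define solves where "solves N v \<longleftrightarrow> v \<in> carrier_vec N \<and> D N *\<^sub>v v = (of_real (mesh N))\<^sup>2 \<cdot>\<^sub>v S N (\<lambda>j. f (grid N j))"
    for N v
  obtain C N0 where C: "\<forall>N\<ge>N0. \<forall>v\<in>carrier_vec N.
       D N *\<^sub>v v = (of_real (mesh N))\<^sup>2 \<cdot>\<^sub>v S_operator l n \<mu> d N (\<lambda>j. f (grid N j)) \<longrightarrow>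
       (\<forall>j<N. cmod (u (grid N (int j + 1)) - v $ j) \<le> C * \<epsilon> N)"
    using bound[OF f u] by (elim exE)
  obtain N1 where N1: "\<And>N. N \<ge> N1 \<Longrightarrow> S N = S_operator l n \<mu> d N"
    using S unfolding associated_S_def eventually_sequentially by blast
  define N2 where "N2 = max N0 N1"
  have large: "err N v \<le> C * \<epsilon> N" if N: "N \<ge> 1" "N \<ge> N2" and v: "solves N v" for N v
  proof -
    have eq: "D N *\<^sub>v v = (of_real (mesh N))\<^sup>2 \<cdot>\<^sub>v S_operator l n \<mu> d N (\<lambda>j. f (grid N j))"
      and vc: "v \<in> carrier_vec N"
      using v N1[of N] N unfolding solves_def N2_def by auto
    have "N0 \<le> N" using N by (simp add: N2_def)
    from C[THEN spec, THEN mp, OF this, THEN bspec, OF vc, THEN mp, OF eq]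
    have "\<forall>j<N. cmod (u (grid N (int j + 1)) - v $ j) \<le> C * \<epsilon> N" .
    then show ?thesis
      unfolding err_def using N(1) v by (intro max_norm_le) (auto simp: solves_def)
  qed
  \<comment> \<open>The error of the solution relative to \<open>\<epsilon> N\<close>; the choice operator picks the only solution.\<close>
  define b where "b N = (if \<exists>v. solves N v then \<bar>err N (SOME v. solves N v)\<bar> / \<epsilon> N else 0)" for N
  have small: "err N v \<le> b N * \<epsilon> N" if N: "N \<ge> 1" and v: "solves N v" for N v
  proof -
    have "solves N (SOME v. solves N v)" using v by (rule someI)
    then have "(SOME v. solves N v) = v"
      using v invertible_mat_unique_solution[OF D(2)[OF N] D(1)] unfolding solves_def by metis
    then show ?thesis
      using v pos[OF N] unfolding b_def by auto
  qed
  have b: "b N \<ge> 0" if "N \<ge> 1" for N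
    using pos[OF that] unfolding b_def by auto
  define c where "c = 1 + \<bar>C\<bar> + (\<Sum>N\<in>{1..<N2}. b N)"
  have sum0: "(\<Sum>N\<in>{1..<N2}. b N) \<ge> 0" by (intro sum_nonneg b) simp
  have "err N v \<le> c * \<epsilon> N" if N: "N \<ge> 1" and v: "solves N v" for N v
  proof (cases "N \<ge> N2")
    case True
    have "C * \<epsilon> N \<le> c * \<epsilon> N"
      using pos[OF N] sum0 by (intro mult_right_mono) (auto simp: c_def)
    then show ?thesis using large[OF N True v] by linarith
  next
    case False
    then have "b N \<le> (\<Sum>N\<in>{1..<N2}. b N)"
      using N b by (intro member_le_sum) auto
    then have "b N * \<epsilon> N \<le> c * \<epsilon> N"
      using pos[OF N] by (intro mult_right_mono) (auto simp: c_def)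
    then show ?thesis using small[OF N v] by linarith
  qed
  moreover have "c > 0" using sum0 by (simp add: c_def)
  ultimately show "\<exists>c>0. \<forall>N\<ge>1. \<forall>v\<in>carrier_vec N.
      D N *\<^sub>v v = (of_real (mesh N))\<^sup>2 \<cdot>\<^sub>v S N (\<lambda>j. f (grid N j)) \<longrightarrow>
      max_norm (vec N (\<lambda>j. u (grid N (int j + 1))) - v) \<le> c * \<epsilon> N"
    unfolding err_def solves_def by blast
qed

lemma cos_freq_range: "cos (freq N k) \<in> {-1..1}"
  by simp

lemma formula_D_matrix_carrier: "D_matrix N (formula_of_coords l x) \<in> carrier_mat N N"
  using D_matrix_carrier[OF C_formulasD(1)[OF formula_of_coords_in[of UNIV l x]]] by simp

text \<open>Here \<open>2 * q + 2 = 2 * p\<close>, and the lower bound on the symbol makes \<open>h T\<close> bounded, where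
  \<open>T = inverse_symbol_sum l x N\<close>. So both terms of the
  error bound are of order \<open>h ^ (2 p)\<close>.\<close>

lemma convergent_complex:
  assumes P: "bounded_away_from_zero l x" and p: "p \<ge> 1"
    and S: "associated_S l (2 * p) (2 * p - 2) (formula_of_coords l x) S"
  shows "convergent_of_order (\<lambda>N. D_matrix N (formula_of_coords l x)) S (2 * p)"
  unfolding convergent_of_order_def
proof (rule convergent_at_rateI[OF S formula_D_matrix_carrier])
  obtain c where c: "c > 0" "\<And>t. t \<in> {-1..1} \<Longrightarrow> cmod (reduced_symbol l x t) \<ge> c"
    using bounded_away_from_zeroD[OF P] by blast
  have nz: "reduced_symbol l x t \<noteq> 0" if "t \<in> {-1..1}" for t
    using c(1) c(2)[OF that] by auto
  then have one: "reduced_symbol l x 1 \<noteq> 0" by simp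
  show "invertible_mat (D_matrix N (formula_of_coords l x))" for N
    by (intro D_matrix_invertible eigenvalue_nonzero nz cos_freq_range)
  show "mesh N ^ (2 * p) > 0" for N
    using mesh_bounds(1)[of N] by simp
  fix f u assume f: "C_infinity f" and u: "solves_dirichlet f u"
  define d where "d = formula_of_coords l x"
  define q where "q = p - 1"
  have q: "2 * q + 2 = 2 * p" "2 * p - 2 = 2 * q" using p by (simp_all add: q_def)
  obtain C where C: "C \<ge> 0" and err: "\<forall>N\<ge>2 * l. (\<forall>k\<in>{1..N}. reduced_symbol l x (cos (freq N k)) \<noteq> 0) \<longrightarrow>
    (\<forall>v\<in>carrier_vec N.
       D_matrix N d *\<^sub>v v = (of_real (mesh N))\<^sup>2 \<cdot>\<^sub>v S_operator l (2 * p) (2 * q) d N (\<lambda>j. f (grid N j)) \<longrightarrow>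
       (\<forall>j<N. cmod (u (grid N (int j + 1)) - v $ j)
          \<le> C * (mesh N ^ (2 * p) * (1 + (mesh N)\<^sup>2 * inverse_symbol_sum l x N)
                 + mesh N ^ (2 * q + 2) * (1 + mesh N * inverse_symbol_sum l x N))))"
    using discretization_error[OF p f u one, of q] unfolding d_def by (elim exE conjE)
  define K where "K = 1 + 1 / c"
  have T: "0 \<le> mesh N * inverse_symbol_sum l x N" "mesh N * inverse_symbol_sum l x N \<le> 1 / c" for N
  proof -
    have nonneg: "inverse_symbol_sum l x N \<ge> 0"
      unfolding inverse_symbol_sum_def by (intro sum_nonneg) simp
    then show "0 \<le> mesh N * inverse_symbol_sum l x N" using mesh_bounds(1)[of N] by simp
    have "inverse_symbol_sum l x N \<le> real (card {1..N}) * (1 / c)"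
      unfolding inverse_symbol_sum_def
      using c nz by (intro sum_bounded_above divide_left_mono mult_pos_pos) auto
    then have "mesh N * inverse_symbol_sum l x N \<le> mesh N * (real N * (1 / c))"
      using mesh_bounds(1)[of N] by (intro mult_left_mono) auto
    also have "\<dots> = (real N * mesh N) * (1 / c)" by simp
    also have "\<dots> \<le> 1 * (1 / c)"
      using mesh_bounds[of N] c(1) by (intro mult_right_mono) (auto simp: distrib_right)
    finally show "mesh N * inverse_symbol_sum l x N \<le> 1 / c" by simp
  qed
  have total: "C * (mesh N ^ (2 * p) * (1 + (mesh N)\<^sup>2 * inverse_symbol_sum l x N)
                 + mesh N ^ (2 * q + 2) * (1 + mesh N * inverse_symbol_sum l x N))
      \<le> C * (2 * K) * mesh N ^ (2 * p)" for N
  proof -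
    have "(mesh N)\<^sup>2 * inverse_symbol_sum l x N = mesh N * (mesh N * inverse_symbol_sum l x N)"
      by (simp add: power2_eq_square)
    also have "\<dots> \<le> 1 * (mesh N * inverse_symbol_sum l x N)"
      using T(1)[of N] mesh_bounds(2)[of N] by (intro mult_right_mono)
    finally have "(mesh N)\<^sup>2 * inverse_symbol_sum l x N \<le> 1 / c" using T(2)[of N] by linarith
    then have "mesh N ^ (2 * p) * (1 + (mesh N)\<^sup>2 * inverse_symbol_sum l x N)
        + mesh N ^ (2 * p) * (1 + mesh N * inverse_symbol_sum l x N) \<le> mesh N ^ (2 * p) * K + mesh N ^ (2 * p) * K"
      using T(2)[of N] mesh_bounds(1)[of N] unfolding K_def by (intro add_mono mult_left_mono) auto
    then have "C * (mesh N ^ (2 * p) * (1 + (mesh N)\<^sup>2 * inverse_symbol_sum l x N)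
        + mesh N ^ (2 * p) * (1 + mesh N * inverse_symbol_sum l x N)) \<le> C * (mesh N ^ (2 * p) * K + mesh N ^ (2 * p) * K)"
      using C by (rule mult_left_mono)
    also have "\<dots> = C * (2 * K) * mesh N ^ (2 * p)" by (simp add: algebra_simps)
    finally show ?thesis unfolding q(1) .
  qed
  show "\<exists>C N0. \<forall>N\<ge>N0. \<forall>v\<in>carrier_vec N.
       D_matrix N (formula_of_coords l x) *\<^sub>v v
         = (of_real (mesh N))\<^sup>2 \<cdot>\<^sub>v S_operator l (2 * p) (2 * p - 2) (formula_of_coords l x) N (\<lambda>j. f (grid N j)) \<longrightarrow>
       (\<forall>j<N. cmod (u (grid N (int j + 1)) - v $ j) \<le> C * mesh N ^ (2 * p))"
    unfolding q(2) d_def[symmetric]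
  proof (intro exI[of _ "C * (2 * K)"] exI[of _ "2 * l"] allI impI ballI)
    fix N v j
    assume N: "2 * l \<le> N" and v: "v \<in> carrier_vec N" and j: "j < N"
      and eq: "D_matrix N d *\<^sub>v v = (of_real (mesh N))\<^sup>2 \<cdot>\<^sub>v S_operator l (2 * p) (2 * q) d N (\<lambda>j. f (grid N j))"
    have "\<forall>k\<in>{1..N}. reduced_symbol l x (cos (freq N k)) \<noteq> 0"
      by (intro ballI nz cos_freq_range)
    from err[THEN spec, THEN mp, OF N, THEN mp, OF this, THEN bspec, OF v, THEN mp, OF eq, THEN spec, THEN mp, OF j]
    show "cmod (u (grid N (int j + 1)) - v $ j) \<le> C * (2 * K) * mesh N ^ (2 * p)"
      using total[of N] by linarith
  qed
qed

text \<open>Here \<open>q = p\<close>, and \<open>h\<^sup>2 T\<close> with \<open>T = inverse_symbol_sum l z N\<close> grows at most like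
  \<open>(ln (N + 1))\<^sup>2\<close>. The second term of the error bound is not larger than the first one, because \<open>h \<le> 1\<close>.\<close>

lemma convergent_real:
  fixes x :: "nat \<Rightarrow> real"
  defines "z \<equiv> \<lambda>k. complex_of_real (x k)"
  assumes P: "generic_symbol (real_symbol l x)" and p: "p \<ge> 1"
    and S: "associated_S l (2 * p) (2 * p) (formula_of_coords l z) S"
  shows "convergent_at_rate (\<lambda>N. D_matrix N (formula_of_coords l z)) S (\<lambda>N. mesh N ^ (2 * p) * (ln (mesh N))\<^sup>2)"
proof (rule convergent_at_rateI[OF S formula_D_matrix_carrier])
  have sym: "reduced_symbol l z t = of_real (poly (real_symbol l x) t)" for t
    unfolding z_def by (rule reduced_symbol_of_real)
  have nz: "reduced_symbol l z (cos (freq N k)) \<noteq> 0" if "k \<in> {1..N}" for N k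
    using P that unfolding sym generic_symbol_def of_real_eq_0_iff by blast
  have one: "reduced_symbol l z 1 \<noteq> 0"
    using P unfolding sym generic_symbol_def of_real_eq_0_iff by blast
  show "invertible_mat (D_matrix N (formula_of_coords l z))" for N
    by (intro D_matrix_invertible eigenvalue_nonzero nz)
  have ln_mesh: "ln (mesh N) = - ln (real N + 1)" for N
    by (simp add: mesh_def ln_div)
  show "mesh N ^ (2 * p) * (ln (mesh N))\<^sup>2 > 0" if "N \<ge> 1" for N
    using mesh_bounds(1)[of N] that unfolding ln_mesh by (intro mult_pos_pos) auto
  fix f u assume f: "C_infinity f" and u: "solves_dirichlet f u"
  define d where "d = formula_of_coords l z"
  obtain C where C: "C \<ge> 0" and err: "\<forall>N\<ge>2 * l. (\<forall>k\<in>{1..N}. reduced_symbol l z (cos (freq N k)) \<noteq> 0) \<longrightarrow>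
    (\<forall>v\<in>carrier_vec N.
       D_matrix N d *\<^sub>v v = (of_real (mesh N))\<^sup>2 \<cdot>\<^sub>v S_operator l (2 * p) (2 * p) d N (\<lambda>j. f (grid N j)) \<longrightarrow>
       (\<forall>j<N. cmod (u (grid N (int j + 1)) - v $ j)
          \<le> C * (mesh N ^ (2 * p) * (1 + (mesh N)\<^sup>2 * inverse_symbol_sum l z N)
                 + mesh N ^ (2 * p + 2) * (1 + mesh N * inverse_symbol_sum l z N))))"
    using discretization_error[OF p f u one, of p] unfolding d_def by (elim exE conjE)
  obtain K N1 where K: "K \<ge> 0" and sum: "\<And>N. N \<ge> N1 \<Longrightarrow>
      inverse_symbol_sum l z N \<le> K * (real N + 1)\<^sup>2 * (1 + (ln (real N + 1))\<^sup>2)"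
    using generic_inverse_symbol_sum[OF P] unfolding z_def by blast
  have total: "C * (mesh N ^ (2 * p) * (1 + (mesh N)\<^sup>2 * inverse_symbol_sum l z N)
                 + mesh N ^ (2 * p + 2) * (1 + mesh N * inverse_symbol_sum l z N))
      \<le> C * (4 * (1 + 2 * K)) * (mesh N ^ (2 * p) * (ln (mesh N))\<^sup>2)" if N: "N \<ge> max N1 2" for N
  proof -
    define h L T where "h = mesh N" and "L = (ln (real N + 1))\<^sup>2" and "T = inverse_symbol_sum l z N"
    have h: "0 < h" "h \<le> 1" "(real N + 1) * h = 1" using mesh_bounds[of N] by (simp_all add: h_def)
    \<comment> \<open>For \<open>N \<ge> 2\<close> the logarithm is at least \<open>1\<close> and absorbs the bounded terms.\<close>
    have "exp 1 \<le> real N + 1"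
      using N exp_le by linarith
    then have "1 \<le> ln (real N + 1)" by (simp add: ln_ge_iff)
    then have L1: "1 \<le> L" unfolding L_def by (simp add: one_le_power)
    have T0: "T \<ge> 0" unfolding T_def inverse_symbol_sum_def by (intro sum_nonneg) simp
    have "h\<^sup>2 * T \<le> h\<^sup>2 * (K * (real N + 1)\<^sup>2 * (1 + L))"
      using sum[of N] N by (intro mult_left_mono) (auto simp: T_def L_def)
    also have "\<dots> = ((real N + 1) * h)\<^sup>2 * (K * (1 + L))"
      by (simp only: power_mult_distrib mult_ac)
    also have "\<dots> \<le> K * (2 * L)"
      using h(3) K L1 by (simp add: mult_left_mono)
    finally have a: "h\<^sup>2 * T \<le> 2 * K * L" by simp
    have one_plus: "1 + h\<^sup>2 * T \<le> (1 + 2 * K) * L"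
      using a L1 by (simp add: distrib_right)
    have "h ^ (2 * p + 2) * (1 + h * T) = h ^ (2 * p) * (h * h + h * (h\<^sup>2 * T))"
      by (simp add: power_add power2_eq_square algebra_simps)
    also have "\<dots> \<le> h ^ (2 * p) * (1 * 1 + 1 * (h\<^sup>2 * T))"
      using h T0 by (intro mult_left_mono add_mono mult_mono) auto
    finally have "h ^ (2 * p) * (1 + h\<^sup>2 * T) + h ^ (2 * p + 2) * (1 + h * T)
        \<le> 2 * (h ^ (2 * p) * (1 + h\<^sup>2 * T))" by simp
    also have "\<dots> \<le> 2 * (h ^ (2 * p) * ((1 + 2 * K) * L))"
      using one_plus h by (intro mult_left_mono) auto
    also have "\<dots> = 2 * (1 + 2 * K) * (h ^ (2 * p) * L)" by simp
    also have "\<dots> \<le> 4 * (1 + 2 * K) * (h ^ (2 * p) * L)"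
      using K h L1 by (intro mult_right_mono) auto
    finally have "C * (h ^ (2 * p) * (1 + h\<^sup>2 * T) + h ^ (2 * p + 2) * (1 + h * T))
        \<le> C * (4 * (1 + 2 * K) * (h ^ (2 * p) * L))"
      using C by (rule mult_left_mono)
    then show ?thesis
      unfolding h_def T_def L_def ln_mesh by (simp only: power2_minus mult.assoc)
  qed
  show "\<exists>C N0. \<forall>N\<ge>N0. \<forall>v\<in>carrier_vec N.
       D_matrix N (formula_of_coords l z) *\<^sub>v v
         = (of_real (mesh N))\<^sup>2 \<cdot>\<^sub>v S_operator l (2 * p) (2 * p) (formula_of_coords l z) N (\<lambda>j. f (grid N j)) \<longrightarrow>
       (\<forall>j<N. cmod (u (grid N (int j + 1)) - v $ j) \<le> C * (mesh N ^ (2 * p) * (ln (mesh N))\<^sup>2))"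
    unfolding d_def[symmetric]
  proof (intro exI[of _ "C * (4 * (1 + 2 * K))"] exI[of _ "max (2 * l) (max N1 2)"] allI impI ballI)
    fix N v j
    assume N: "max (2 * l) (max N1 2) \<le> N" and v: "v \<in> carrier_vec N" and j: "j < N"
      and eq: "D_matrix N d *\<^sub>v v = (of_real (mesh N))\<^sup>2 \<cdot>\<^sub>v S_operator l (2 * p) (2 * p) d N (\<lambda>j. f (grid N j))"
    have "2 * l \<le> N" "max N1 2 \<le> N" using N by simp_all
    have "\<forall>k\<in>{1..N}. reduced_symbol l z (cos (freq N k)) \<noteq> 0"
      by (intro ballI nz)
    from err[THEN spec, THEN mp, OF \<open>2 * l \<le> N\<close>, THEN mp, OF this, THEN bspec, OF v, THEN mp, OF eq, THEN spec, THEN mp, OF j]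
    show "cmod (u (grid N (int j + 1)) - v $ j) \<le> C * (4 * (1 + 2 * K)) * (mesh N ^ (2 * p) * (ln (mesh N))\<^sup>2)"
      using total[OF \<open>max N1 2 \<le> N\<close>] by linarith
  qed
qed

theorem proposition2p10:
  fixes l n :: nat
  assumes "n \<ge> 2" and "even n"
  shows "(AE d in lebesgue_C_complex l. \<forall>S. associated_S l n (n - 2) d S \<longrightarrow>
            convergent_of_order (\<lambda>N. D_matrix N d) S n)
       \<and> (AE d in lebesgue_C_real l. \<forall>S. associated_S l n n d S \<longrightarrow>
            convergent_at_rate (\<lambda>N. D_matrix N d) S (\<lambda>N. mesh N ^ n * (ln (mesh N))\<^sup>2))"
proof
  obtain p where n: "n = 2 * p" using \<open>even n\<close> by blast
  then have p: "p \<ge> 1" using \<open>n \<ge> 2\<close> by simp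
  show "AE d in lebesgue_C_complex l. \<forall>S. associated_S l n (n - 2) d S \<longrightarrow>
      convergent_of_order (\<lambda>N. D_matrix N d) S n"
    unfolding lebesgue_C_complex_def AE_embed_measure'[OF inj_on_formula_of_coords_complex] n
    using AE_bounded_away_from_zero by eventually_elim (use convergent_complex p in blast)
  show "AE d in lebesgue_C_real l. \<forall>S. associated_S l n n d S \<longrightarrow>
      convergent_at_rate (\<lambda>N. D_matrix N d) S (\<lambda>N. mesh N ^ n * (ln (mesh N))\<^sup>2)"
    unfolding lebesgue_C_real_def AE_embed_measure'[OF inj_on_formula_of_coords_real] n
    using AE_generic_real_symbol by eventually_elim (use convergent_real p in blast)
qed

end
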